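(* Let $F(\alpha)=\dfrac{1+e^{-\alpha}}{1+e^{-\alpha}+e^{-2\alpha}}$ for $\alpha\ge 0$. Then, uniformly for all integers $\ell$, as $N\to+\infty$, $$V_d\left(\ell,\,N+\frac{|\ell|(|\ell|+1)}{2}\right)=p(N)\,F\left(\frac{\pi|\ell|}{\sqrt{6N}}\right)\left(1+O\left(N^{-1/10}\right)\right),$$ where the implied constant is absolute (i.e. there are absolute constants $C,N_0$ such that the relative error is at most $CN^{-1/10}$ for all integers $N\ge N_0$ and all $\ell\in\mathbb{Z}$). In particular, if $m=m(N)$ is an integer with $m=o(N^{3/8})$, then as $N\to\infty$ $$\frac{V_d(m,N)}{V_d(N)}\sim \frac{1}{(24N)^{1/4}}\exp\left(-\frac{\pi m^2}{\sqrt{24N}}\right).$$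
   Context: A strongly concave composition of a nonnegative integer $n$ is a finite sequence of nonnegative integers $(a_1,\dots,a_s)$, $s\ge 1$, summing to $n$, such that for some index $k$ with $1\le k\le s$ one has $a_1>a_2>\dots>a_{k-1}>a_k<a_{k+1}<\dots<a_s$; $a_k$ is called the central part. Its rank is $s-2k+1$. $V_d(m,n)$ denotes the number of strongly concave compositions of $n$ with rank $m$, and $V_d(n)$ the total number of strongly concave compositions of $n$. $p(n)$ is the partition function, with $p(n)=0$ for negative integers $n$. *)

theory Defs
  imports "HOL-Analysis.Analysis" "HOL-Library.Landau_Symbols"
begin

(* A strongly concave composition of n with central index k (1-based):
   xs = (a_1,...,a_s), s >= 1, sum n, a_1 > ... > a_k < ... < a_s.
   a_i is xs ! (i-1). *)
definition scc_at :: "nat \<Rightarrow> nat list \<Rightarrow> nat \<Rightarrow> bool" where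
  "scc_at n xs k \<longleftrightarrow> length xs \<ge> 1 \<and> sum_list xs = n \<and> 1 \<le> k \<and> k \<le> length xs \<and>
     (\<forall>i. 1 \<le> i \<and> i < k \<longrightarrow> xs ! (i - 1) > xs ! i) \<and>
     (\<forall>i. k \<le> i \<and> i < length xs \<longrightarrow> xs ! (i - 1) < xs ! i)"

definition strongly_concave :: "nat \<Rightarrow> nat list \<Rightarrow> bool" where
  "strongly_concave n xs \<longleftrightarrow> (\<exists>k. scc_at n xs k)"

definition Vd_rank :: "int \<Rightarrow> nat \<Rightarrow> nat" where
  "Vd_rank m n = card {xs. \<exists>k. scc_at n xs k \<and>
       int (length xs) - 2 * int k + 1 = m}"

definition Vd :: "nat \<Rightarrow> nat" where
  "Vd n = card {xs. strongly_concave n xs}"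

definition partition_count :: "nat \<Rightarrow> nat" where
  "partition_count n = card {xs :: nat list. sorted (rev xs) \<and> (\<forall>x\<in>set xs. x > 0) \<and> sum_list xs = n}"

definition F_conc :: "real \<Rightarrow> real" where
  "F_conc \<alpha> = (1 + exp (-\<alpha>)) / (1 + exp (-\<alpha>) + exp (-2*\<alpha>))"

end

theory Submission
  imports Defs "HOL-Complex_Analysis.Complex_Analysis" "HOL-Probability.Distributions"
    "HOL-Real_Asymp.Real_Asymp"
begin

text \<open>
Summing over the central part, the compositions of rank \<open>l \<ge> 0\<close> with \<open>n = N + l (l + 1) / 2\<close> are
counted by \<open>\<Sum>r. q ^ (r (r + l + 1)) / ((q)_r (q)_(r + l) (1 - q ^ (2 r + l + 1)))\<close>. Comparing
this series termwise with Durfee's \<open>1 / (q)_\<infinity> = \<Sum>r. q ^ (r (r + m)) / ((q)_r (q)_(r + m))\<close>, twice,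
relates rank \<open>l\<close> to rank \<open>l + 4\<close>. Iterating gives the count as the alternating sum of the
\<open>p (N - j l - 2 j (j + 1) / 3)\<close> over \<open>j \<equiv> 0\<close> (sign \<open>+\<close>) and \<open>j \<equiv> 2\<close> (sign \<open>-\<close>) modulo 3.

The circle method gives \<open>p n = A e ^ (2 \<pi> \<surd>(n / 6)) / n * (1 + O(1 / \<surd>n))\<close>. The value of \<open>A\<close> is
irrelevant, since only the ratios \<open>p (N - x) / p N \<approx> e ^ (- a x)\<close> with \<open>a = \<pi> / \<surd>(6 N)\<close> are
needed. For \<open>u = e ^ (- a l)\<close> the alternating sum then behaves like
\<open>\<Sum>k. u ^ (3 k) - u ^ (3 k + 2) = (1 + u) / (1 + u + u ^ 2)\<close>. As it has about \<open>N ^ (1/4)\<close> terms, an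
error \<open>N ^ (-2/5)\<close> in each ratio is good enough. Finally, the number of all compositions is a sum
over ranks, where \<open>p (N - m (m + 1) / 2) / p N\<close> turns it into a Gaussian sum.
\<close>

section \<open>The false theta expansion of the rank generating function\<close>

text \<open>The estimate must be uniform in \<open>l\<close>. \<open>F\<close> stays in [2/3, 1], so
  it is enough to bound the absolute error of V_d / p, and the alternating sum is never expanded in
  \<open>l\<close>: it is compared with \<open>F\<close> times a telescoping sum, with an error
  bound that does not involve u.

  The circle method works without the modularity of the eta function. The logarithm of the partition
  generating function at e ^ (- z) is a Lambert series. After removal of its poles and of Ln z / 2,
  the rest has a bounded derivative near 0 in the sector |Im z| <= Re z, because the derivative is a
  Riemann sum of step z whose main part telescopes. Hence the rest has a limit at 0 with error
  O(|z|), and z of order n ^ (- 1/2) gives the relative error n ^ (- 1/2) for p n. Some such rate is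
  essential: about N ^ (1/4) ratios are added up, so the bare asymptotic formula would not do.

  The exponent 3/8 is where the second-order term x ^ 2 / N ^ (3/2) of ln (p (N - x)), with x about
  m ^ 2 / 2, stops being o(1).\<close>

definition qp :: "nat \<Rightarrow> real fps" where
  "qp m = (\<Prod>i=1..m. 1 - fps_X ^ i)"

text \<open>The reciprocal 1 / (q)_m of the q-Pochhammer symbol. It generates the partitions into
  parts of size at most \<open>m\<close>, as \<open>iq_nth\<close> confirms.\<close>

definition iq :: "nat \<Rightarrow> real fps" where
  "iq m = inverse (qp m)"

definition geo :: "nat \<Rightarrow> real fps" where
  "geo k = inverse (1 - fps_X ^ k)"

lemma qp_0 [simp]: "qp 0 = 1"
  by (simp add: qp_def)

lemma qp_Suc: "qp (Suc m) = qp m * (1 - fps_X ^ Suc m)"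
  by (simp add: qp_def)

lemma qp_nth_0: "fps_nth (qp m) 0 = 1"
  by (induction m) (simp_all add: qp_Suc)

lemma iq_mult_qp: "iq m * qp m = 1"
  unfolding iq_def by (rule inverse_mult_eq_1) (simp add: qp_nth_0)

lemma iq_0 [simp]: "iq 0 = 1"
  using iq_mult_qp[of 0] by simp

lemma geo_mult: "k > 0 \<Longrightarrow> geo k * (1 - fps_X ^ k) = 1"
  unfolding geo_def by (rule inverse_mult_eq_1) simp

lemma iq_eqI: "f * qp m = 1 \<Longrightarrow> f = iq m"
  using iq_mult_qp[of m] by (metis mult.assoc mult.commute mult.left_neutral)

text \<open>Oriented so as to lift every factor to the largest index in an identity. Afterwards both
  sides share a common factor, called \<open>Z\<close> below, and only polynomials in q remain to be
  compared.\<close>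

lemma iq_Suc: "iq m = iq (Suc m) * (1 - fps_X ^ Suc m)"
proof -
  have "iq (Suc m) * (1 - fps_X ^ Suc m) * qp m = 1"
    using iq_mult_qp[of "Suc m"] by (simp only: qp_Suc mult_ac)
  then show ?thesis by (metis iq_eqI)
qed

section \<open>Partitions with bounded parts\<close>

definition bounded_partitions :: "nat \<Rightarrow> nat \<Rightarrow> nat list set" where
  "bounded_partitions M n =
     {xs. sorted (rev xs) \<and> (\<forall>x\<in>set xs. 0 < x \<and> x \<le> M) \<and> sum_list xs = n}"

lemma length_le_sum_list: "(\<And>x. x \<in> set xs \<Longrightarrow> 0 < x) \<Longrightarrow> length xs \<le> sum_list (xs :: nat list)"
proof (induction xs)
  case (Cons a xs)
  then have "length xs \<le> sum_list xs" "0 < a" by simp_all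
  then show ?case by simp
qed simp

lemma finite_lists_sum_le: "finite {xs :: nat list. (\<forall>x\<in>set xs. 0 < x) \<and> sum_list xs \<le> n}"
proof (rule finite_subset)
  show "{xs :: nat list. (\<forall>x\<in>set xs. 0 < x) \<and> sum_list xs \<le> n}
      \<subseteq> {xs. set xs \<subseteq> {..n} \<and> length xs \<le> n}"
    using length_le_sum_list by (fastforce dest: member_le_sum_list)
  show "finite {xs. set xs \<subseteq> {..n} \<and> length xs \<le> n}"
    by (rule finite_lists_length_le) simp
qed

lemma finite_bounded_partitions: "finite (bounded_partitions M n)"
  by (rule finite_subset[OF _ finite_lists_sum_le[of n]]) (auto simp: bounded_partitions_def)

lemma bounded_partitions_0: "bounded_partitions 0 n = (if n = 0 then {[]} else {})"
proof -
  have "xs = []" if "\<forall>x\<in>set xs. 0 < x \<and> x \<le> (0::nat)" for xs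
    using that by (cases xs) auto
  then have "bounded_partitions 0 n \<subseteq> {[]}"
    by (auto simp: bounded_partitions_def)
  then show ?thesis by (auto simp: bounded_partitions_def)
qed

text \<open>Split by the head, the largest part: if it equals \<open>Suc M\<close> it can be
  removed, and the rest keeps the same bound because parts may repeat.\<close>

lemma bounded_partitions_Suc:
  "bounded_partitions (Suc M) n = bounded_partitions M n \<union>
     (if Suc M \<le> n then (#) (Suc M) ` bounded_partitions (Suc M) (n - Suc M) else {})"
  (is "?L = ?A \<union> ?B")
proof (intro equalityI subsetI)
  fix xs assume xs: "xs \<in> ?L"
  show "xs \<in> ?A \<union> ?B"
  proof (cases xs)
    case Nil
    then show ?thesis using xs by (auto simp: bounded_partitions_def)
  next
    case (Cons y ys)
    show ?thesis
    proof (cases "y = Suc M")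
      case True
      then have "ys \<in> bounded_partitions (Suc M) (n - Suc M)" "Suc M \<le> n"
        using xs Cons by (auto simp: bounded_partitions_def sorted_append)
      then show ?thesis using True Cons by auto
    next
      case False
      then have "\<forall>x\<in>set xs. x \<le> M"
        using xs Cons by (fastforce simp: bounded_partitions_def sorted_append)
      then show ?thesis using xs by (auto simp: bounded_partitions_def)
    qed
  qed
next
  fix xs assume "xs \<in> ?A \<union> ?B"
  then show "xs \<in> ?L"
    by (fastforce simp: bounded_partitions_def sorted_append split: if_splits)
qed

lemma card_bounded_partitions_Suc:
  "card (bounded_partitions (Suc M) n) = card (bounded_partitions M n) +
     (if Suc M \<le> n then card (bounded_partitions (Suc M) (n - Suc M)) else 0)"
proof (cases "Suc M \<le> n")
  case True
  have "Suc M # xs \<notin> bounded_partitions M n" for xs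
    by (simp add: bounded_partitions_def)
  then have "bounded_partitions M n \<inter> (#) (Suc M) ` bounded_partitions (Suc M) (n - Suc M) = {}"
    by blast
  then show ?thesis
    using True by (subst bounded_partitions_Suc)
      (simp add: card_Un_disjoint finite_bounded_partitions card_image)
qed (subst bounded_partitions_Suc, simp)

text \<open>By \<open>card_bounded_partitions_Suc\<close> the counting series satisfy G (M + 1) * (1
  - q ^ (M + 1)) = G M, which is the recursion of \<open>iq\<close>.\<close>

lemma iq_nth: "fps_nth (iq M) n = card (bounded_partitions M n)"
proof -
  define G where "G M = Abs_fps (\<lambda>n. real (card (bounded_partitions M n)))" for M
  have "G M * qp M = 1" for M
  proof (induction M)
    case 0
    show ?case by (rule fps_ext) (simp add: G_def bounded_partitions_0)
  next
    case (Suc M)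
    have "G (Suc M) = G M + fps_X ^ Suc M * G (Suc M)"
      by (rule fps_ext) (simp only: fps_add_nth fps_X_power_mult_nth G_def fps_nth_Abs_fps,
           subst card_bounded_partitions_Suc, simp)
    then have "G (Suc M) * (1 - fps_X ^ Suc M) = G M"
      by (simp add: algebra_simps)
    then show ?case using Suc by (metis qp_Suc mult.assoc mult.commute)
  qed
  then have "G M = iq M" by (rule iq_eqI)
  then show ?thesis by (metis G_def fps_nth_Abs_fps)
qed

lemma bounded_partitions_ge:
  assumes "n \<le> M"
  shows "bounded_partitions M n
    = {xs :: nat list. sorted (rev xs) \<and> (\<forall>x\<in>set xs. x > 0) \<and> sum_list xs = n}"
proof -
  have "x \<le> M" if "x \<in> set xs" "sum_list xs = n" for x and xs :: "nat list"
    using member_le_sum_list[OF that(1)] that(2) assms by simp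
  then show ?thesis unfolding bounded_partitions_def by blast
qed

lemma iq_nth_partition_count: "n \<le> M \<Longrightarrow> fps_nth (iq M) n = partition_count n"
  by (simp add: iq_nth bounded_partitions_ge partition_count_def)

section \<open>Durfee's identity and the two series to be compared with it\<close>

definition dterm :: "nat \<Rightarrow> nat \<Rightarrow> real fps" where
  "dterm m r = fps_X ^ (r * (r + m)) * iq r * iq (r + m)"

text \<open>The rank \<open>l\<close> series of the overview without its factor q ^ (l (l + 1) / 2).
  Here \<open>r\<close> is the length of the shorter arm, and \<open>geo\<close> results from the
  sum over the central part.\<close>

definition aterm :: "nat \<Rightarrow> nat \<Rightarrow> real fps" where
  "aterm l r = fps_X ^ (r * (r + l + 1)) * iq r * iq (r + l) * geo (2 * r + l + 1)"

text \<open>Forced by the comparison of \<open>aterm\<close> with Durfee's terms: the same quotient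
  with \<open>r\<close> more in the exponent of q. Comparing it in turn leads back to
  \<open>aterm\<close>.\<close>

definition bterm :: "nat \<Rightarrow> nat \<Rightarrow> real fps" where
  "bterm m r = fps_X ^ (r * (r + m + 2)) * iq r * iq (r + m) * geo (2 * r + m + 1)"

text \<open>Over the common factor \<open>Z\<close> this is (1 - q ^ (r + m + 2)) - q ^ (r + 1) = (1
  - q ^ (r + 1)) - q ^ (r + m + 2). Exchanging the two subtracted powers is what prepares the shift
  of the index in \<open>durfee_diff\<close>.\<close>

lemma dterm_diff_Suc:
  "dterm m (Suc r) - dterm (Suc m) (Suc r) =
     fps_X ^ (Suc r * (Suc r + m)) * iq r * iq (Suc (Suc (r + m)))
     - fps_X ^ (Suc r * (Suc r + m) + r + m + 2) * iq (Suc r) * iq (Suc (Suc (r + m)))"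
proof -
  define Z where "Z = fps_X ^ (Suc r * (Suc r + m)) * iq (Suc r) * iq (Suc (Suc (r + m)))"
  have 1: "dterm m (Suc r) = Z * (1 - fps_X ^ (r + m + 2))"
    unfolding dterm_def Z_def using iq_Suc[of "Suc (r + m)"] by (simp add: mult_ac)
  have 2: "dterm (Suc m) (Suc r) = Z * fps_X ^ Suc r"
    unfolding dterm_def Z_def by (simp add: mult_ac power_add)
  have 3: "fps_X ^ (Suc r * (Suc r + m)) * iq r * iq (Suc (Suc (r + m))) = Z * (1 - fps_X ^ Suc r)"
    unfolding Z_def by (subst iq_Suc) (simp only: mult_ac)
  have 4: "fps_X ^ (Suc r * (Suc r + m) + r + m + 2) * iq (Suc r) * iq (Suc (Suc (r + m)))
      = Z * fps_X ^ (r + m + 2)"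
    unfolding Z_def by (simp add: power_add mult_ac)
  show ?thesis
    unfolding 1 2 3 4 by (simp only: right_diff_distrib) simp
qed

lemma dterm_diff_0:
  "dterm m 0 - dterm (Suc m) 0 = - (fps_X ^ (m + 1) * iq (Suc m))"
  using iq_Suc[of m] by (simp add: dterm_def algebra_simps del: power_Suc)

lemma fps_X_power_mult_nth_less: "n < k \<Longrightarrow> fps_nth (fps_X ^ k * f) n = (0 :: real)"
  by (simp add: fps_X_power_mult_nth)

lemma dterm_nth_eq_0: "N < r \<Longrightarrow> fps_nth (dterm m r) N = 0"
  unfolding dterm_def mult.assoc
  by (rule fps_X_power_mult_nth_less) (rule less_le_trans, assumption, simp)

text \<open>Durfee's series is treated one coefficient at a time: a term with r > N starts above q ^
  N, so the truncated sum is the full coefficient and infinite sums of formal series are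
  avoided.\<close>

definition durfee :: "nat \<Rightarrow> nat \<Rightarrow> real" where
  "durfee m N = (\<Sum>r\<le>N. fps_nth (dterm m r) N)"

lemma sum_eq_sum_atMost:
  fixes f :: "nat \<Rightarrow> real"
  assumes "\<And>r. N < r \<Longrightarrow> f r = 0" "N \<le> R"
  shows "(\<Sum>r\<le>R. f r) = (\<Sum>r\<le>N. f r)"
  by (rule sum.mono_neutral_right) (use assms in \<open>auto simp: not_le\<close>)

lemma durfee_eq: "N \<le> R \<Longrightarrow> (\<Sum>r\<le>R. fps_nth (dterm m r) N) = durfee m N"
  unfolding durfee_def by (rule sum_eq_sum_atMost) (auto simp: dterm_nth_eq_0)

text \<open>The key to Durfee's identity: the difference of two consecutive sums reproduces itself,
  with a factor \<open>- q ^ (m + 1)\<close>, one step further, so it is divisible by every power of \<open>q\<close>.\<close>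

lemma durfee_diff:
  "durfee m N - durfee (Suc m) N =
     (if m + 1 \<le> N then - (durfee (Suc m) (N - (m + 1)) - durfee (Suc (Suc m)) (N - (m + 1))) else 0)"
proof -
  \<comment> \<open>The difference of the two terms of index \<open>r\<close> is
    \<open>e' r - g r\<close>. Pairing \<open>g r\<close> with \<open>e' (Suc r)\<close> instead of
    \<open>e' r\<close> reproduces the difference for \<open>m + 1\<close>.\<close>
  define g where "g r = fps_X ^ (r * (r + m) + r + m + 1) * iq r * iq (Suc (r + m))" for r
  define e' where "e' r = (if r = 0 then 0 else fps_X ^ (r * (r + m)) * iq (r - 1) * iq (Suc (r + m)))" for r
  have diff: "dterm m r - dterm (Suc m) r = e' r - g r" for r
    by (cases r) (simp_all only: dterm_diff_0 dterm_diff_Suc e'_def g_def, simp_all)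
  have shift: "g r - e' (Suc r) = fps_X ^ (m + 1) * (dterm (Suc m) r - dterm (Suc (Suc m)) r)" for r
  proof -
    define Z where "Z = fps_X ^ (r * (r + m) + r + m + 1) * iq r * iq (Suc (Suc (r + m)))"
    have 1: "g r = Z * (1 - fps_X ^ (r + m + 2))"
      unfolding g_def Z_def using iq_Suc[of "Suc (r + m)"] by (simp add: mult_ac)
    have 2: "e' (Suc r) = Z * fps_X ^ r"
      unfolding e'_def Z_def by (simp add: mult_ac power_add)
    have 3: "fps_X ^ (m + 1) * dterm (Suc m) r = Z * (1 - fps_X ^ (r + m + 2))"
      unfolding dterm_def Z_def using iq_Suc[of "Suc (r + m)"] by (simp add: mult_ac power_add)
    have 4: "fps_X ^ (m + 1) * dterm (Suc (Suc m)) r = Z * fps_X ^ r"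
      unfolding dterm_def Z_def by (simp add: mult_ac power_add)
    show ?thesis
      unfolding right_diff_distrib 3 4 1 2 by (simp add: right_diff_distrib)
  qed
  \<comment> \<open>The term added at the upper end contributes nothing to q ^ N, and
    \<open>e' 0 = 0\<close> at the lower end, so the index can be shifted freely.\<close>
  have e'_0: "fps_nth (e' (Suc N)) N = 0"
    unfolding e'_def mult.assoc by (simp del: power_Suc mult_Suc add: fps_X_power_mult_nth_less mult.assoc)
  have "durfee m N - durfee (Suc m) N = (\<Sum>r\<le>N. fps_nth (dterm m r - dterm (Suc m) r) N)"
    by (simp add: durfee_def sum_subtractf)
  also have "\<dots> = (\<Sum>r\<le>N. fps_nth (e' r) N) - (\<Sum>r\<le>N. fps_nth (g r) N)"
    by (simp add: diff sum_subtractf)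
  also have "(\<Sum>r\<le>N. fps_nth (e' r) N) = (\<Sum>r\<le>Suc N. fps_nth (e' r) N)"
    using e'_0 by simp
  also have "\<dots> = (\<Sum>r\<le>N. fps_nth (e' (Suc r)) N)"
    by (subst sum.atMost_Suc_shift) (simp add: e'_def)
  also have "\<dots> - (\<Sum>r\<le>N. fps_nth (g r) N) = - (\<Sum>r\<le>N. fps_nth (g r - e' (Suc r)) N)"
    by (simp add: sum_subtractf)
  also have "\<dots> = (if m + 1 \<le> N then - (\<Sum>r\<le>N. fps_nth (dterm (Suc m) r - dterm (Suc (Suc m)) r) (N - (m + 1))) else 0)"
    unfolding shift fps_X_power_mult_nth by auto
  also have "\<dots> = (if m + 1 \<le> N then - (durfee (Suc m) (N - (m + 1)) - durfee (Suc (Suc m)) (N - (m + 1))) else 0)"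
    by (simp add: sum_subtractf durfee_eq del: One_nat_def)
  finally show ?thesis .
qed

lemma durfee_Suc: "durfee (Suc m) N = durfee m N"
proof -
  have "durfee m N - durfee (Suc m) N = 0"
  proof (induction N arbitrary: m rule: less_induct)
    case (less N)
    show ?case
      by (subst durfee_diff) (use less[of "N - (m + 1)" "Suc m"] in auto)
  qed
  then show ?thesis by simp
qed

text \<open>The sum is constant in \<open>m\<close>, so it may be evaluated at m + N. There every
  term with r >= 1 starts above q ^ N, and the term r = 0 generates the partitions with parts at
  most m + N.\<close>

lemma durfee_eq_partition_count: "durfee m N = partition_count N"
proof -
  have "durfee (m + k) N = durfee m N" for k
    by (induction k) (simp_all add: durfee_Suc)
  then have "durfee m N = durfee (m + N) N" by simp
  also have "\<dots> = (\<Sum>r\<in>{0}. fps_nth (dterm (m + N) r) N)"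
    unfolding durfee_def
  proof (rule sum.mono_neutral_right)
    show "\<forall>r\<in>{..N} - {0}. fps_nth (dterm (m + N) r) N = 0"
    proof
      fix r assume "r \<in> {..N} - {0}"
      then have "N < r + (m + N)" "r + (m + N) \<le> r * (r + (m + N))" by auto
      then show "fps_nth (dterm (m + N) r) N = 0"
        unfolding dterm_def mult.assoc by (intro fps_X_power_mult_nth_less) linarith
    qed
  qed auto
  also have "\<dots> = partition_count N"
    by (simp add: dterm_def iq_nth_partition_count)
  finally show ?thesis .
qed

section \<open>The recursion from rank l to rank l + 4\<close>

lemma aterm_0: "aterm l 0 = dterm (l + 1) 0"
proof -
  have "iq l * geo (l + 1) = iq (Suc l) * (geo (l + 1) * (1 - fps_X ^ (l + 1)))"
    by (subst iq_Suc) (simp add: mult_ac)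
  then show ?thesis by (simp add: aterm_def dterm_def geo_mult del: power_Suc)
qed

text \<open>Over \<open>Z\<close> this is 1 - A = (1 - A B) - A (1 - B) with A = q ^ (r + l + 2) and
  B = q ^ (r + 1). It works because A B is the power of q in the denominator
  \<open>geo\<close>.\<close>

lemma aterm_Suc:
  "aterm l (Suc r) = dterm (l + 1) (Suc r) - fps_X ^ (2 * l + 4) * bterm (l + 2) r"
proof -
  define Z where "Z = fps_X ^ (Suc r * (r + l + 2)) * iq (Suc r) * iq (Suc (Suc (r + l))) * geo (2 * r + l + 3)"
  have g: "geo (2 * r + l + 3) * (1 - fps_X ^ (2 * r + l + 3)) = 1"
    by (rule geo_mult) simp
  have 1: "aterm l (Suc r) = Z * (1 - fps_X ^ (r + l + 2))"
    unfolding aterm_def Z_def using iq_Suc[of "Suc (r + l)"]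
    by (simp add: mult_ac eval_nat_numeral)
  have "dterm (l + 1) (Suc r) = dterm (l + 1) (Suc r) * (geo (2 * r + l + 3) * (1 - fps_X ^ (2 * r + l + 3)))"
    by (simp only: g mult_1_right)
  also have "\<dots> = Z * (1 - fps_X ^ (2 * r + l + 3))"
    unfolding dterm_def Z_def by (simp add: mult_ac eval_nat_numeral)
  finally have 2: "dterm (l + 1) (Suc r) = Z * (1 - fps_X ^ (2 * r + l + 3))" .
  have "fps_X ^ (2 * l + 4) * bterm (l + 2) r
    = fps_X ^ (Suc r * (r + l + 2) + r + l + 2) * iq r * iq (Suc (Suc (r + l))) * geo (2 * r + l + 3)"
    unfolding bterm_def mult.assoc[symmetric] power_add[symmetric]
    by (simp add: algebra_simps eval_nat_numeral)
  also have "\<dots> = Z * fps_X ^ (r + l + 2) * (1 - fps_X ^ Suc r)"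
    unfolding Z_def by (subst iq_Suc) (simp only: mult_ac power_add)
  also have "\<dots> = Z * (fps_X ^ (r + l + 2) - fps_X ^ (2 * r + l + 3))"
    by (simp add: algebra_simps power_add[symmetric] del: power_Suc)
  finally have 3: "fps_X ^ (2 * l + 4) * bterm (l + 2) r
    = Z * (fps_X ^ (r + l + 2) - fps_X ^ (2 * r + l + 3))" .
  show ?thesis unfolding 1 2 3 by (simp only: right_diff_distrib) simp
qed

lemma bterm_0: "bterm m 0 = dterm (m + 1) 0"
  using aterm_0[of m] by (simp add: aterm_def bterm_def)

text \<open>Over \<open>Z\<close>, with A = q ^ (r + m + 2) and B = q ^ (r + 1), this is (1 - A) B =
  (1 - A B) - (1 - B).\<close>

lemma bterm_Suc:
  "bterm m (Suc r) = dterm (m + 1) (Suc r) - fps_X ^ (m + 2) * aterm (m + 2) r"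
proof -
  define Z where "Z = fps_X ^ (Suc r * (r + m + 2)) * iq (Suc r) * iq (Suc (Suc (r + m))) * geo (2 * r + m + 3)"
  have g: "geo (2 * r + m + 3) * (1 - fps_X ^ (2 * r + m + 3)) = 1"
    by (rule geo_mult) simp
  have 4: "fps_X ^ (r + m + 2) * fps_X ^ Suc r = (fps_X ^ (2 * r + m + 3) :: real fps)"
    unfolding power_add[symmetric] by (simp add: eval_nat_numeral mult_2)
  have "bterm m (Suc r) = fps_X ^ (Suc r * (r + m + 2) + Suc r) * iq (Suc r) * iq (Suc (r + m)) * geo (2 * r + m + 3)"
    unfolding bterm_def by (simp add: algebra_simps eval_nat_numeral)
  also have "\<dots> = Z * (1 - fps_X ^ Suc (Suc (r + m))) * fps_X ^ Suc r"
    unfolding Z_def power_add by (subst iq_Suc[of "Suc (r + m)"]) (simp only: mult_ac)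
  finally have 1: "bterm m (Suc r) = Z * (1 - fps_X ^ (r + m + 2)) * fps_X ^ Suc r" by simp
  have "dterm (m + 1) (Suc r) = dterm (m + 1) (Suc r) * (geo (2 * r + m + 3) * (1 - fps_X ^ (2 * r + m + 3)))"
    by (simp only: g mult_1_right)
  also have "\<dots> = Z * (1 - fps_X ^ (2 * r + m + 3))"
    unfolding dterm_def Z_def by (simp add: mult_ac eval_nat_numeral)
  finally have 2: "dterm (m + 1) (Suc r) = Z * (1 - fps_X ^ (2 * r + m + 3))" .
  have "fps_X ^ (m + 2) * aterm (m + 2) r
    = fps_X ^ (Suc r * (r + m + 2)) * iq r * iq (Suc (Suc (r + m))) * geo (2 * r + m + 3)"
    unfolding aterm_def mult.assoc[symmetric] power_add[symmetric]
    by (simp add: algebra_simps eval_nat_numeral)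
  also have "\<dots> = Z * (1 - fps_X ^ Suc r)"
    unfolding Z_def by (subst iq_Suc) (simp only: mult_ac power_add)
  finally have 3: "fps_X ^ (m + 2) * aterm (m + 2) r = Z * (1 - fps_X ^ Suc r)" .
  show ?thesis unfolding 1 2 3 
    by (simp only: right_diff_distrib left_diff_distrib mult.assoc 4) (simp add: algebra_simps)
qed

definition aco :: "nat \<Rightarrow> nat \<Rightarrow> real" where
  "aco l N = (\<Sum>r\<le>N. fps_nth (aterm l r) N)"

definition bco :: "nat \<Rightarrow> nat \<Rightarrow> real" where
  "bco l N = (\<Sum>r\<le>N. fps_nth (bterm l r) N)"

lemma aterm_nth_eq_0: "N < r \<Longrightarrow> fps_nth (aterm m r) N = 0"
  unfolding aterm_def mult.assoc
  by (rule fps_X_power_mult_nth_less) (rule less_le_trans, assumption, simp)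

lemma bterm_nth_eq_0: "N < r \<Longrightarrow> fps_nth (bterm m r) N = 0"
  unfolding bterm_def mult.assoc
  by (rule fps_X_power_mult_nth_less) (rule less_le_trans, assumption, simp)

lemma aco_eq: "N \<le> R \<Longrightarrow> (\<Sum>r\<le>R. fps_nth (aterm m r) N) = aco m N"
  unfolding aco_def by (rule sum_eq_sum_atMost) (auto simp: aterm_nth_eq_0)

text \<open>Sums both comparisons at once: the term of index 0 and the Durfee terms add up to p N,
  and what remains is a coefficient of the other series at N - e.\<close>

lemma sum_dterm_shift:
  assumes "f 0 = dterm l 0" "\<And>r. f (Suc r) = dterm l (Suc r) - fps_X ^ e * g r"
    and f: "\<And>n r. n < r \<Longrightarrow> fps_nth (f r) n = 0" and g: "\<And>n r. n < r \<Longrightarrow> fps_nth (g r) n = 0"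
  shows "(\<Sum>r\<le>N. fps_nth (f r) N)
    = partition_count N - (if e \<le> N then \<Sum>r\<le>N - e. fps_nth (g r) (N - e) else 0)"
proof -
  have "(\<Sum>r\<le>N. fps_nth (f r) N) = (\<Sum>r\<le>Suc N. fps_nth (f r) N)"
    using f by simp
  also have "\<dots> = fps_nth (dterm l 0) N + (\<Sum>r\<le>N. fps_nth (dterm l (Suc r)) N)
      - (\<Sum>r\<le>N. fps_nth (fps_X ^ e * g r) N)"
    by (subst sum.atMost_Suc_shift) (simp only: assms(1,2) fps_sub_nth sum_subtractf add_diff_eq)
  also have "fps_nth (dterm l 0) N + (\<Sum>r\<le>N. fps_nth (dterm l (Suc r)) N) = durfee l N"
    using sum.atMost_Suc_shift[of "\<lambda>r. fps_nth (dterm l r) N" N] durfee_eq[of N "Suc N" l]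
    by simp
  also have "(\<Sum>r\<le>N. fps_nth (fps_X ^ e * g r) N)
     = (if e \<le> N then \<Sum>r\<le>N - e. fps_nth (g r) (N - e) else 0)"
    unfolding fps_X_power_mult_nth by (auto intro!: sum_eq_sum_atMost g)
  finally show ?thesis by (simp only: durfee_eq_partition_count)
qed

lemma aco_rec:
  "aco l N = partition_count N - (if 2 * l + 4 \<le> N then bco (l + 2) (N - (2 * l + 4)) else 0)"
  unfolding aco_def bco_def
  by (rule sum_dterm_shift[OF aterm_0 aterm_Suc aterm_nth_eq_0 bterm_nth_eq_0])

lemma bco_rec:
  "bco m N = partition_count N - (if m + 2 \<le> N then aco (m + 2) (N - (m + 2)) else 0)"
  unfolding aco_def bco_def
  by (rule sum_dterm_shift[OF bterm_0 bterm_Suc bterm_nth_eq_0 aterm_nth_eq_0])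

text \<open>The extension by 0 to negative arguments removes the case distinctions of
  \<open>aco_rec\<close> and \<open>bco_rec\<close>, so that the recursion can be iterated without
  side conditions.\<close>

definition pz :: "int \<Rightarrow> real" where
  "pz x = (if x < 0 then 0 else partition_count (nat x))"

definition az :: "nat \<Rightarrow> int \<Rightarrow> real" where
  "az l x = (if x < 0 then 0 else aco l (nat x))"

text \<open>\<open>aco_rec\<close> followed by \<open>bco_rec\<close> at rank l + 2: the shifts 2 l
  + 4 and (l + 2) + 2 add up to 3 l + 8.\<close>

lemma az_rec:
  "az l x = pz x - pz (x - (2 * int l + 4)) + az (l + 4) (x - (3 * int l + 8))"
proof (cases "x < 0")
  case False
  then obtain N where x: "x = int N" by (metis nonneg_int_cases not_less)
  show ?thesis
  proof (cases "2 * l + 4 \<le> N")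
    case True
    have e1: "nat (int N - (2 * int l + 4)) = N - (2 * l + 4)" by linarith
    have e2: "nat (int N - (3 * int l + 8)) = N - (2 * l + 4) - (l + 2 + 2)" by linarith
    have e3: "l + 2 + 2 \<le> N - (2 * l + 4) \<longleftrightarrow> \<not> int N - (3 * int l + 8) < 0"
      using True by linarith
    have "az l x = aco l N" by (simp add: az_def x)
    also have "\<dots> = partition_count N - bco (l + 2) (N - (2 * l + 4))"
      using True by (simp add: aco_rec)
    also have "bco (l + 2) (N - (2 * l + 4)) = pz (x - (2 * int l + 4)) - az (l + 4) (x - (3 * int l + 8))"
      unfolding bco_rec e3 az_def pz_def x e1 e2 using True by (auto simp: add.assoc numeral_eq_Suc)
    finally show ?thesis by (simp add: pz_def x)
  next
    case F: False
    then show ?thesis by (simp add: az_def pz_def x aco_rec[of l N])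
  qed
qed (simp add: az_def pz_def)

text \<open>The shifts 3 (l + 4 i) + 8 for i < K add up to 3 K l + 6 K ^ 2 + 2 K.\<close>

lemma az_eq_sum:
  "az l x = (\<Sum>k<K. pz (x - int (3 * k * l + 6 * k\<^sup>2 + 2 * k))
                 - pz (x - int ((3 * k + 2) * l + 6 * k\<^sup>2 + 10 * k + 4)))
         + az (l + 4 * K) (x - int (3 * K * l + 6 * K\<^sup>2 + 2 * K))"
proof (induction K)
  case (Suc K)
  have "az (l + 4 * K) (x - int (3 * K * l + 6 * K\<^sup>2 + 2 * K))
     = pz (x - int (3 * K * l + 6 * K\<^sup>2 + 2 * K))
       - pz (x - int ((3 * K + 2) * l + 6 * K\<^sup>2 + 10 * K + 4))
       + az (l + 4 * Suc K) (x - int (3 * Suc K * l + 6 * (Suc K)\<^sup>2 + 2 * Suc K))"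
    by (subst az_rec) (simp add: algebra_simps power2_eq_square)
  then show ?case using Suc by simp
qed simp

text \<open>For K > N the remainder of the iteration sits at a negative argument, where
  \<open>az\<close> is 0.\<close>

lemma aco_eq_sum:
  assumes "N < K"
  shows "aco l N = (\<Sum>k<K. pz (int N - int (3 * k * l + 6 * k\<^sup>2 + 2 * k))
                 - pz (int N - int ((3 * k + 2) * l + 6 * k\<^sup>2 + 10 * k + 4)))"
proof -
  have "K * 1 \<le> K * K" using assms by (intro mult_left_mono) auto
  then have "int N - int (3 * K * l + 6 * K\<^sup>2 + 2 * K) < 0"
    using assms unfolding power2_eq_square by linarith
  then show ?thesis
    using az_eq_sum[of l "int N" K] by (simp add: az_def)
qed

section \<open>Generating function of one arm, read from the central part c outwards\<close>

definition incr_lists :: "nat \<Rightarrow> nat \<Rightarrow> nat \<Rightarrow> nat list set" where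
  "incr_lists r c n = {xs. sorted_wrt (<) (c # xs) \<and> length xs = r \<and> sum_list xs = n}"

lemma finite_incr_lists: "finite (incr_lists r c n)"
  by (rule finite_subset[OF _ finite_lists_sum_le[of n]]) (auto simp: incr_lists_def)

lemma incr_lists_0: "incr_lists 0 c n = (if n = 0 then {[]} else {})"
  by (auto simp: incr_lists_def)

lemma incr_lists_map_Suc:
  "incr_lists r (Suc c) n = (if r \<le> n then map Suc ` incr_lists r c (n - r) else {})"
proof (cases "r \<le> n")
  case True
  have sum: "sum_list (map Suc xs) = sum_list xs + length xs" for xs
    by (induction xs) auto
  have "xs \<in> map Suc ` incr_lists r c (n - r)" if "xs \<in> incr_lists r (Suc c) n" for xs
  proof
    have pos: "\<forall>x\<in>set xs. Suc c < x" using that by (simp add: incr_lists_def)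
    then have "map (Suc \<circ> (\<lambda>x. x - 1)) xs = map id xs"
      by (intro map_cong) auto
    then show eq: "xs = map Suc (map (\<lambda>x. x - 1) xs)" by simp
    have "sum_list (map (\<lambda>x. x - 1) xs) + length xs = sum_list xs"
      using sum[of "map (\<lambda>x. x - 1) xs"] eq by simp
    moreover have "sorted_wrt (<) (map (\<lambda>x. x - 1) xs)"
      unfolding sorted_wrt_map
      by (rule sorted_wrt_mono_rel[of _ "(<)"]) (use pos that in \<open>auto simp: incr_lists_def\<close>)
    ultimately show "map (\<lambda>x. x - 1) xs \<in> incr_lists r c (n - r)"
      using that by (fastforce simp: incr_lists_def)
  qed
  moreover have "map Suc xs \<in> incr_lists r (Suc c) n" if "xs \<in> incr_lists r c (n - r)" for xs
    using that True by (simp add: incr_lists_def sum sorted_wrt_map)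
  ultimately show ?thesis using True by auto
next
  case False
  have "length xs \<le> sum_list xs" if "\<forall>x\<in>set xs. Suc c < x" for xs
    by (rule length_le_sum_list) (use that in auto)
  then show ?thesis using False by (auto simp: incr_lists_def)
qed

lemma card_incr_lists_map_Suc:
  "card (incr_lists r (Suc c) n) = (if r \<le> n then card (incr_lists r c (n - r)) else 0)"
proof -
  have "inj_on (map Suc) A" for A
    by (rule inj_on_subset[OF inj_mapI[OF inj_Suc]]) simp
  then show ?thesis by (simp add: incr_lists_map_Suc card_image)
qed

lemma incr_lists_Suc:
  "incr_lists (Suc r) c n = incr_lists (Suc r) (Suc c) n \<union>
     (if Suc c \<le> n then (#) (Suc c) ` incr_lists r (Suc c) (n - Suc c) else {})"
  (is "?L = ?A \<union> ?B")
proof (intro equalityI subsetI)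
  fix xs assume xs: "xs \<in> ?L"
  then obtain y ys where y: "xs = y # ys" by (cases xs) (auto simp: incr_lists_def)
  show "xs \<in> ?A \<union> ?B"
  proof (cases "y = Suc c")
    case True
    then have "Suc c \<le> n" "ys \<in> incr_lists r (Suc c) (n - Suc c)"
      using xs by (auto simp: incr_lists_def y)
    then show ?thesis by (simp add: y True)
  next
    case False
    then have "Suc c < y" using xs by (simp add: incr_lists_def y)
    then have "xs \<in> ?A" using xs by (fastforce simp: incr_lists_def y)
    then show ?thesis by simp
  qed
next
  fix xs assume "xs \<in> ?A \<union> ?B"
  then show "xs \<in> ?L"
    by (fastforce simp: incr_lists_def split: if_splits)
qed

lemma card_incr_lists_Suc:
  "card (incr_lists (Suc r) c n) = card (incr_lists (Suc r) (Suc c) n) +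
     (if Suc c \<le> n then card (incr_lists r (Suc c) (n - Suc c)) else 0)"
proof (cases "Suc c \<le> n")
  case True
  have "Suc c # xs \<notin> incr_lists (Suc r) (Suc c) n" for xs
    by (simp add: incr_lists_def)
  then have "incr_lists (Suc r) (Suc c) n \<inter> (#) (Suc c) ` incr_lists r (Suc c) (n - Suc c) = {}"
    by blast
  then show ?thesis
    using True by (subst incr_lists_Suc) (simp add: card_Un_disjoint finite_incr_lists card_image)
qed (subst incr_lists_Suc, simp)

definition incr_fps :: "nat \<Rightarrow> nat \<Rightarrow> real fps" where
  "incr_fps r c = Abs_fps (\<lambda>n. real (card (incr_lists r c n)))"

lemma incr_fps_0: "incr_fps 0 c = 1"
  by (rule fps_ext) (simp add: incr_fps_def incr_lists_0)

lemma incr_fps_Suc_right: "incr_fps r (Suc c) = fps_X ^ r * incr_fps r c"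
  by (rule fps_ext) (auto simp: incr_fps_def fps_X_power_mult_nth card_incr_lists_map_Suc)

lemma incr_fps_Suc: "incr_fps (Suc r) c = incr_fps (Suc r) (Suc c) + fps_X ^ Suc c * incr_fps r (Suc c)"
  by (rule fps_ext)
     (simp only: incr_fps_def fps_add_nth fps_X_power_mult_nth fps_nth_Abs_fps card_incr_lists_Suc[of r c] of_nat_add, auto)

text \<open>The two recursions in \<open>c\<close> combine to one in \<open>r\<close>: F (r + 1) (1
  - q ^ (r + 1)) = q ^ (c + 1 + r) F r. The leading exponent is the weight of the smallest arm c +
  1, ..., c + r.\<close>

lemma incr_fps_eq: "incr_fps r c = fps_X ^ (r * c + r * (r + 1) div 2) * iq r"
proof -
  have "incr_fps r c * qp r = fps_X ^ (r * c + r * (r + 1) div 2)"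
  proof (induction r)
    case 0
    show ?case by (simp add: incr_fps_0)
  next
    case (Suc r)
    have "incr_fps (Suc r) c = fps_X ^ Suc r * incr_fps (Suc r) c + fps_X ^ Suc c * (fps_X ^ r * incr_fps r c)"
      using incr_fps_Suc[of r c] by (simp only: incr_fps_Suc_right)
    then have "incr_fps (Suc r) c * (1 - fps_X ^ Suc r) = fps_X ^ (Suc c + r) * incr_fps r c"
      by (simp only: power_add right_diff_distrib mult_ac) (simp add: algebra_simps)
    then have "incr_fps (Suc r) c * qp (Suc r) = fps_X ^ (Suc c + r) * (incr_fps r c * qp r)"
      by (simp only: qp_Suc mult_ac)
    also have "\<dots> = fps_X ^ (Suc c + r + (r * c + r * (r + 1) div 2))"
      by (simp only: Suc power_add)
    also have "Suc c + r + (r * c + r * (r + 1) div 2) = Suc r * c + Suc r * (Suc r + 1) div 2"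
      by simp
    finally show ?case .
  qed
  then have "incr_fps r c * (iq r * qp r) = fps_X ^ (r * c + r * (r + 1) div 2) * iq r"
    by (simp only: mult_ac)
  then show ?thesis by (simp only: iq_mult_qp mult_1_right)
qed


section \<open>Compositions as triples: reversed left arm, central part, right arm\<close>

definition concave_triples :: "nat \<Rightarrow> (nat list \<times> nat \<times> nat list) set" where
  "concave_triples n = {(L, c, R). sorted_wrt (<) (c # L) \<and> sorted_wrt (<) (c # R) \<and>
     sum_list L + c + sum_list R = n}"

definition triple_list :: "nat list \<times> nat \<times> nat list \<Rightarrow> nat list" where
  "triple_list = (\<lambda>(L, c, R). rev L @ c # R)"

definition triple_rank :: "nat list \<times> nat \<times> nat list \<Rightarrow> int" where
  "triple_rank = (\<lambda>(L, c, R). int (length R) - int (length L))"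

text \<open>The central part is strictly below all other entries, so the list determines it, and it
  occurs only once, so the list determines its position as well.\<close>

lemma inj_on_triple_list: "inj_on triple_list (concave_triples n)"
proof (rule inj_onI)
  fix t t'
  assume tt: "t \<in> concave_triples n" "t' \<in> concave_triples n" "triple_list t = triple_list t'"
  obtain L c R L' c' R' where t: "t = (L, c, R)" "t' = (L', c', R')" by (metis prod_cases3)
  have *: "(L, c, R) \<in> concave_triples n" "(L', c', R') \<in> concave_triples n"
    and eq: "triple_list (L, c, R) = triple_list (L', c', R')"
    using tt by (simp_all add: t)
  have eq': "rev L @ c # R = rev L' @ c' # R'" using eq by (simp add: triple_list_def)
  have gt: "\<forall>x\<in>set L \<union> set R. c < x" "\<forall>x\<in>set L' \<union> set R'. c' < x"
    using * by (auto simp: concave_triples_def)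
  have sets: "insert c (set L \<union> set R) = insert c' (set L' \<union> set R')"
    using arg_cong[OF eq', of set] by auto
  have c: "c = c'"
  proof (rule ccontr)
    assume "c \<noteq> c'"
    then have "c \<in> set L' \<union> set R'" "c' \<in> set L \<union> set R" using sets by (metis insertE insertI1)+
    then show False using gt by (meson less_asym)
  qed
  have notin: "c \<notin> set (rev L)" "c \<notin> set (rev L')" using gt c by auto
  have "rev L = takeWhile (\<lambda>x. x \<noteq> c) (rev L @ c # R)"
    using notin by (subst takeWhile_append2) auto
  moreover have "rev L' = takeWhile (\<lambda>x. x \<noteq> c) (rev L' @ c # R')"
    using notin by (subst takeWhile_append2) auto
  ultimately have "rev L = rev L'" using eq' c by simp
  then show "t = t'" using eq' c t by simp
qed

lemma sorted_wrt_less_iff_nth: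
  "sorted_wrt (<) (xs :: nat list) \<longleftrightarrow> (\<forall>i. Suc i < length xs \<longrightarrow> xs ! i < xs ! Suc i)"
  by (rule sorted_wrt_iff_nth_Suc_transp) simp

lemma scc_at_iff:
  "scc_at n xs k \<longleftrightarrow> (\<exists>L c R. (L, c, R) \<in> concave_triples n \<and> xs = triple_list (L, c, R) \<and> k = Suc (length L))"
proof
  assume scc: "scc_at n xs k"
  define L c R where "L = rev (take (k - 1) xs)" and "c = xs ! (k - 1)" and "R = drop k xs"
  have k: "1 \<le> k" "k \<le> length xs" "sum_list xs = n"
    and dec: "\<And>i. 1 \<le> i \<Longrightarrow> i < k \<Longrightarrow> xs ! i < xs ! (i - 1)"
    and inc: "\<And>i. k \<le> i \<Longrightarrow> i < length xs \<Longrightarrow> xs ! (i - 1) < xs ! i"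
    using scc by (auto simp: scc_at_def)
  have xs: "xs = rev L @ c # R"
    using k id_take_nth_drop[of "k - 1" xs] by (simp add: L_def c_def R_def)
  have cR: "c # R = drop (k - 1) xs"
    using k Cons_nth_drop_Suc[of "k - 1" xs] by (simp add: c_def R_def)
  have cL: "c # L = rev (take k xs)"
    using k take_Suc_conv_app_nth[of "k - 1" xs] by (simp add: c_def L_def)
  have "sorted_wrt (<) (c # R)"
    unfolding sorted_wrt_less_iff_nth cR
  proof (intro allI impI)
    fix i assume "Suc i < length (drop (k - 1) xs)"
    then show "drop (k - 1) xs ! i < drop (k - 1) xs ! Suc i"
      using inc[of "k + i"] k by (simp add: add.commute)
  qed
  moreover have "sorted_wrt (<) (c # L)"
    unfolding sorted_wrt_less_iff_nth cL
  proof (intro allI impI)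
    fix i assume i: "Suc i < length (rev (take k xs))"
    then show "rev (take k xs) ! i < rev (take k xs) ! Suc i"
      using dec[of "k - Suc i"] k by (simp add: rev_nth min_absorb2)
  qed
  moreover have "sum_list L + c + sum_list R = n"
    using k(3) by (subst (asm) xs) (simp add:)
  moreover have "k = Suc (length L)" using k by (simp add: L_def)
  ultimately show "\<exists>L c R. (L, c, R) \<in> concave_triples n \<and> xs = triple_list (L, c, R) \<and> k = Suc (length L)"
    using xs by (intro exI[of _ L] exI[of _ c] exI[of _ R]) (simp add: concave_triples_def triple_list_def)
next
  assume "\<exists>L c R. (L, c, R) \<in> concave_triples n \<and> xs = triple_list (L, c, R) \<and> k = Suc (length L)"
  then obtain L c R where T: "(L, c, R) \<in> concave_triples n" and xs: "xs = rev L @ c # R"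
    and k: "k = Suc (length L)"
    by (auto simp: triple_list_def)
  have sL: "\<And>i. Suc i < length (c # L) \<Longrightarrow> (c # L) ! i < (c # L) ! Suc i"
    and sR: "\<And>i. Suc i < length (c # R) \<Longrightarrow> (c # R) ! i < (c # R) ! Suc i"
    using T sorted_wrt_less_iff_nth[of "c # L"] sorted_wrt_less_iff_nth[of "c # R"]
    by (auto simp: concave_triples_def)
  have xs1: "xs = rev (c # L) @ R" by (simp add: xs)
  have dec: "xs ! i < xs ! (i - 1)" if "1 \<le> i" "i < k" for i
  proof -
    have "xs ! i = (c # L) ! (length L - i)" "xs ! (i - 1) = (c # L) ! Suc (length L - i)"
      using that unfolding xs1
      by (simp_all add: nth_append_left rev_nth k Suc_diff_le del: rev.simps nth_Cons_Suc)
    then show ?thesis using sL[of "length L - i"] that k by simp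
  qed
  have inc: "xs ! (i - 1) < xs ! i" if "k \<le> i" "i < length xs" for i
  proof -
    have "xs ! i = (c # R) ! Suc (i - k)" "xs ! (i - 1) = (c # R) ! (i - k)"
      using that unfolding xs by (simp_all add: nth_append_right k Suc_diff_le)
    then show ?thesis using sR[of "i - k"] that k xs by simp
  qed
  show "scc_at n xs k"
    unfolding scc_at_def using T dec inc
    by (auto simp: xs k concave_triples_def)
qed

lemma Vd_rank_eq_card: "Vd_rank m n = card {t \<in> concave_triples n. triple_rank t = m}"
proof -
  have "{xs. \<exists>k. scc_at n xs k \<and> int (length xs) - 2 * int k + 1 = m}
     = triple_list ` {t \<in> concave_triples n. triple_rank t = m}"
  proof (intro equalityI subsetI)
    fix xs assume "xs \<in> {xs. \<exists>k. scc_at n xs k \<and> int (length xs) - 2 * int k + 1 = m}"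
    then obtain L c R where t: "(L, c, R) \<in> concave_triples n" "xs = triple_list (L, c, R)"
      and "int (length xs) - 2 * int (Suc (length L)) + 1 = m"
      by (auto simp: scc_at_iff)
    then have "triple_rank (L, c, R) = m"
      by (simp add: triple_list_def triple_rank_def)
    then show "xs \<in> triple_list ` {t \<in> concave_triples n. triple_rank t = m}"
      using t by blast
  next
    fix xs assume "xs \<in> triple_list ` {t \<in> concave_triples n. triple_rank t = m}"
    then obtain L c R where t: "(L, c, R) \<in> concave_triples n" "xs = triple_list (L, c, R)"
      and r: "triple_rank (L, c, R) = m"
      by auto
    have "scc_at n xs (Suc (length L))" using t scc_at_iff by blast
    moreover have "int (length xs) - 2 * int (Suc (length L)) + 1 = m"
      using r by (simp add: t triple_list_def triple_rank_def)
    ultimately show "xs \<in> {xs. \<exists>k. scc_at n xs k \<and> int (length xs) - 2 * int k + 1 = m}" by blast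
  qed
  moreover have "inj_on triple_list {t \<in> concave_triples n. triple_rank t = m}"
    by (rule inj_on_subset[OF inj_on_triple_list[of n]]) auto
  ultimately show ?thesis by (simp add: Vd_rank_def card_image)
qed

lemma Vd_eq_card: "Vd n = card (concave_triples n)"
proof -
  have "{xs. strongly_concave n xs} = triple_list ` concave_triples n"
    by (auto simp: strongly_concave_def scc_at_iff image_iff)
  then show ?thesis by (simp add: Vd_def card_image inj_on_triple_list)
qed

lemma concave_triples_length:
  assumes "(L, c, R) \<in> concave_triples n"
  shows "length L \<le> n" "length R \<le> n"
proof -
  have "length L \<le> sum_list L" "length R \<le> sum_list R"
    using assms by (auto simp: concave_triples_def intro!: length_le_sum_list)
  then show "length L \<le> n" "length R \<le> n"
    using assms by (auto simp: concave_triples_def)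
qed

lemma finite_concave_triples: "finite (concave_triples n)"
proof -
  have "finite ({xs :: nat list. (\<forall>x\<in>set xs. 0 < x) \<and> sum_list xs \<le> n} \<times> {..n} \<times>
      {xs :: nat list. (\<forall>x\<in>set xs. 0 < x) \<and> sum_list xs \<le> n})"
    using finite_lists_sum_le by simp
  then show ?thesis
    by (rule finite_subset[rotated]) (auto simp: concave_triples_def)
qed

lemma Vd_eq_sum: "Vd n = (\<Sum>m=-int n..int n. Vd_rank m n)"
proof -
  have "card (concave_triples n)
      = (\<Sum>m=-int n..int n. card {t \<in> concave_triples n. triple_rank t = m})"
  proof -
    have "triple_rank ` concave_triples n \<subseteq> {-int n..int n}"
    proof
      fix m assume "m \<in> triple_rank ` concave_triples n"
      then obtain L c R where "(L, c, R) \<in> concave_triples n" "m = int (length R) - int (length L)"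
        by (auto simp: triple_rank_def)
      then show "m \<in> {-int n..int n}" using concave_triples_length[of L c R n] by auto
    qed
    then show ?thesis
      using sum.group[of "concave_triples n" "{-int n..int n}" triple_rank "\<lambda>_. 1 :: nat"]
      by (simp add: finite_concave_triples)
  qed
  then show ?thesis by (simp add: Vd_eq_card Vd_rank_eq_card)
qed

lemma Vd_rank_minus: "Vd_rank (- m) n = Vd_rank m n"
proof -
  have "bij_betw (\<lambda>(L, c, R). (R, c, L)) {t \<in> concave_triples n. triple_rank t = m}
      {t \<in> concave_triples n. triple_rank t = - m}"
    by (rule bij_betwI[where g = "\<lambda>(L, c, R). (R, c, L)"])
       (auto simp: concave_triples_def triple_rank_def)
  then show ?thesis by (simp add: Vd_rank_eq_card bij_betw_same_card)
qed

lemma Vd_rank_abs: "Vd_rank m n = Vd_rank (int (nat \<bar>m\<bar>)) n"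
  by (cases "m \<ge> 0") (simp_all add: Vd_rank_minus)

lemma card_triples_fixed:
  assumes "c \<le> n"
  shows "real (card {(L, c', R). (L, c', R) \<in> concave_triples n \<and> c' = c \<and> length L = r \<and> length R = s})
    = fps_nth (incr_fps r c * incr_fps s c) (n - c)"
proof -
  have "{(L, c', R). (L, c', R) \<in> concave_triples n \<and> c' = c \<and> length L = r \<and> length R = s}
     = (\<Union>i\<in>{0..n - c}. incr_lists r c i \<times> {c} \<times> incr_lists s c (n - c - i))" (is "?T = _")
    using assms by (auto simp: concave_triples_def incr_lists_def)
  then have "card ?T = (\<Sum>i=0..n - c. card (incr_lists r c i \<times> {c} \<times> incr_lists s c (n - c - i)))"
    by (simp only:, subst card_UN_disjoint)
       (auto simp: finite_incr_lists, auto simp: incr_lists_def)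
  then show ?thesis
    by (simp add: fps_mult_nth incr_fps_def card_cartesian_product)
qed

text \<open>The finite sum differs from the full geometric series by a multiple of q ^ ((n + 1) y),
  which does not reach the coefficient of q ^ n.\<close>

lemma fps_nth_geo_sum:
  assumes "0 < y"
  shows "(\<Sum>c\<le>n. fps_nth (fps_X ^ (c * y) * f) n) = fps_nth (geo y * f) n"
proof -
  have tele: "(\<Sum>c\<le>n. fps_X ^ (c * y)) * (1 - fps_X ^ y) = 1 - (fps_X ^ (Suc n * y) :: real fps)" for n
    using sum_gp_basic[of "fps_X ^ y :: real fps" n]
    by (simp only: power_mult[symmetric] mult.commute[of y] mult.commute[of "1 - _"])
  have "(\<Sum>c\<le>n. fps_X ^ (c * y)) = (\<Sum>c\<le>n. fps_X ^ (c * y)) * (geo y * (1 - fps_X ^ y))"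
    by (simp only: geo_mult[OF assms] mult_1_right)
  also have "\<dots> = (\<Sum>c\<le>n. fps_X ^ (c * y)) * (1 - fps_X ^ y) * geo y"
    by (simp only: mult_ac)
  finally have s: "(\<Sum>c\<le>n. fps_X ^ (c * y)) = geo y - fps_X ^ (Suc n * y) * geo y"
    unfolding tele by (simp add: left_diff_distrib)
  have "Suc n * 1 \<le> Suc n * y" using assms by (intro mult_le_mono) auto
  then have "n < Suc n * y" by simp
  then have "fps_nth (fps_X ^ (Suc n * y) * (geo y * f)) n = 0"
    by (rule fps_X_power_mult_nth_less)
  moreover have "(\<Sum>c\<le>n. fps_nth (fps_X ^ (c * y) * f) n) = fps_nth ((\<Sum>c\<le>n. fps_X ^ (c * y)) * f) n"
    by (simp add: sum_distrib_right fps_sum_nth)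
  ultimately show ?thesis
    unfolding s by (simp add: left_diff_distrib mult.assoc)
qed

text \<open>Sort the triples by the length \<open>r\<close> of the left arm and the central part
  \<open>c\<close>. The powers depending on \<open>c\<close> collect to q ^ (c (2 r + l + 1)): the
  centre itself, and \<open>c\<close> for each of the 2 r + l arm entries. Summing over
  \<open>c\<close> gives \<open>geo\<close>.\<close>

lemma Vd_rank_eq_aco: "real (Vd_rank (int l) (N + l * (l + 1) div 2)) = aco l N"
proof -
  define n where "n = N + l * (l + 1) div 2"
  define T where "T = (\<lambda>(r, c). {(L, c', R). (L, c', R) \<in> concave_triples n \<and> c' = c \<and> length L = r \<and> length R = r + l})"
  have fin: "finite (T rc)" for rc
    by (rule finite_subset[OF _ finite_concave_triples[of n]]) (auto simp: T_def split: prod.splits)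
  have "{t \<in> concave_triples n. triple_rank t = int l} = (\<Union>rc\<in>{..n} \<times> {..n}. T rc)"
  proof (intro equalityI subsetI)
    fix t assume t: "t \<in> {t \<in> concave_triples n. triple_rank t = int l}"
    obtain L c R where [simp]: "t = (L, c, R)" by (cases t)
    have "t \<in> T (length L, c)" "length L \<le> n" "c \<le> n"
      using t concave_triples_length[of L c R n] by (auto simp: T_def triple_rank_def concave_triples_def)
    then show "t \<in> (\<Union>rc\<in>{..n} \<times> {..n}. T rc)" by blast
  next
    fix t assume "t \<in> (\<Union>rc\<in>{..n} \<times> {..n}. T rc)"
    then show "t \<in> {t \<in> concave_triples n. triple_rank t = int l}"
      by (auto simp: T_def triple_rank_def)
  qed
  then have "Vd_rank (int l) n = card (\<Union>rc\<in>{..n} \<times> {..n}. T rc)"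
    by (simp add: Vd_rank_eq_card)
  also have "\<dots> = (\<Sum>rc\<in>{..n} \<times> {..n}. card (T rc))"
    by (rule card_UN_disjoint) (use fin in \<open>auto simp: T_def\<close>)
  finally have "real (Vd_rank (int l) n) = (\<Sum>(r, c)\<in>{..n} \<times> {..n}. real (card (T (r, c))))"
    by (simp add: case_prod_unfold)
  also have "\<dots> = (\<Sum>r\<le>n. \<Sum>c\<le>n. fps_nth (incr_fps r c * incr_fps (r + l) c) (n - c))"
    unfolding sum.cartesian_product[symmetric] T_def by (auto intro!: sum.cong card_triples_fixed)
  also have "\<dots> = (\<Sum>r\<le>n. fps_nth (aterm l r) N)"
  proof (rule sum.cong[OF refl])
    fix r
    \<comment> \<open>The smallest weights of the two arms: T(r) + T(r + l) = r (r + l + 1) + T(l)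
      for the triangular numbers T.\<close>
    have exp: "r * (r + 1) div 2 + (r + l) * (r + l + 1) div 2 = r * (r + l + 1) + l * (l + 1) div 2"
    proof -
      have "2 * (r * (r + 1) div 2) = r * (r + 1)" "2 * (l * (l + 1) div 2) = l * (l + 1)"
        "2 * ((r + l) * (r + l + 1) div 2) = (r + l) * (r + l + 1)" by simp_all
      then have "2 * (r * (r + 1) div 2) + 2 * ((r + l) * (r + l + 1) div 2)
         = 2 * (r * (r + l + 1)) + 2 * (l * (l + 1) div 2)"
        by (simp only:) (simp add: algebra_simps)
      then show ?thesis by presburger
    qed
    have "fps_nth (incr_fps r c * incr_fps (r + l) c) (n - c)
       = fps_nth (fps_X ^ (c * (2 * r + l + 1)) * (fps_X ^ (r * (r + l + 1) + l * (l + 1) div 2) * iq r * iq (r + l))) n"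
      if "c \<le> n" for c
    proof -
      have "fps_nth (incr_fps r c * incr_fps (r + l) c) (n - c)
         = fps_nth (fps_X ^ c * (incr_fps r c * incr_fps (r + l) c)) n"
        using that by (simp add: fps_X_power_mult_nth)
      also have "fps_X ^ c * (incr_fps r c * incr_fps (r + l) c)
         = fps_X ^ (c + (r * c + r * (r + 1) div 2) + ((r + l) * c + (r + l) * (r + l + 1) div 2)) * iq r * iq (r + l)"
        unfolding incr_fps_eq power_add by (simp only: mult_ac)
      also have "c + (r * c + r * (r + 1) div 2) + ((r + l) * c + (r + l) * (r + l + 1) div 2)
         = c * (2 * r + l + 1) + (r * (r + 1) div 2 + (r + l) * (r + l + 1) div 2)"
        by (simp add: algebra_simps)
      also have "\<dots> = c * (2 * r + l + 1) + (r * (r + l + 1) + l * (l + 1) div 2)"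
        by (simp only: exp)
      finally show ?thesis by (simp only: power_add mult_ac)
    qed
    then have "(\<Sum>c\<le>n. fps_nth (incr_fps r c * incr_fps (r + l) c) (n - c))
       = (\<Sum>c\<le>n. fps_nth (fps_X ^ (c * (2 * r + l + 1)) * (fps_X ^ (r * (r + l + 1) + l * (l + 1) div 2) * iq r * iq (r + l))) n)"
      by (intro sum.cong) simp_all
    also have "\<dots> = fps_nth (geo (2 * r + l + 1) * (fps_X ^ (r * (r + l + 1) + l * (l + 1) div 2) * iq r * iq (r + l))) n"
      by (rule fps_nth_geo_sum) simp
    also have "geo (2 * r + l + 1) * (fps_X ^ (r * (r + l + 1) + l * (l + 1) div 2) * iq r * iq (r + l))
       = fps_X ^ (l * (l + 1) div 2) * aterm l r"
      unfolding aterm_def power_add by (simp only: mult_ac)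
    finally show "(\<Sum>c\<le>n. fps_nth (incr_fps r c * incr_fps (r + l) c) (n - c)) = fps_nth (aterm l r) N"
      by (simp add: fps_X_power_mult_nth n_def)
  qed
  also have "\<dots> = aco l N"
    by (rule aco_eq) (simp add: n_def)
  finally show ?thesis by (simp only: n_def)
qed

text \<open>The exponents are \<open>j * l + 2 * j * (j + 1) / 3\<close> for \<open>j = 3 * k\<close> and \<open>j = 3 * k + 2\<close>.\<close>

lemma Vd_rank_eq_sum:
  assumes "N < K"
  shows "real (Vd_rank m (N + nat \<bar>m\<bar> * (nat \<bar>m\<bar> + 1) div 2)) =
    (\<Sum>k<K. pz (int N - int (3 * k * nat \<bar>m\<bar> + 6 * k\<^sup>2 + 2 * k))
         - pz (int N - int ((3 * k + 2) * nat \<bar>m\<bar> + 6 * k\<^sup>2 + 10 * k + 4)))"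
  unfolding Vd_rank_eq_aco[symmetric] aco_eq_sum[OF assms, symmetric] by (rule arg_cong[OF Vd_rank_abs])

section \<open>The logarithm of the partition generating function\<close>

lemma power_Suc_lt_one:
  fixes x :: real
  assumes "0 \<le> x" "x < 1"
  shows "x ^ Suc n < 1"
proof -
  have "x * x ^ n \<le> x * 1" using assms by (intro mult_left_mono power_le_one) auto
  then show ?thesis using assms by simp
qed

text \<open>Stated for partial sums, so that it is available before any convergence is known.
  Truncation turns the product recursion into the inequality S (M + 1) (1 - x ^ (M + 1)) <= S
  M.\<close>

lemma sum_bounded_partitions_le:
  fixes x :: real
  assumes "0 \<le> x" "x < 1"
  shows "(\<Sum>n\<le>N. card (bounded_partitions M n) * x ^ n) \<le> (\<Prod>k=1..M. inverse (1 - x ^ k))"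
proof (induction M)
  case 0
  have "(\<Sum>n\<le>N. card (bounded_partitions 0 n) * x ^ n) = (\<Sum>n\<in>{0}. card (bounded_partitions 0 n) * x ^ n)"
    by (rule sum.mono_neutral_right) (auto simp: bounded_partitions_0)
  then show ?case by (simp add: bounded_partitions_0)
next
  case (Suc M)
  let ?S = "\<lambda>M. \<Sum>n\<le>N. card (bounded_partitions M n) * x ^ n"
  have lt: "x ^ Suc M < 1" using assms by (intro power_Suc_lt_one) auto
  have "?S (Suc M) = (\<Sum>n\<le>N. card (bounded_partitions M n) * x ^ n
      + (if Suc M \<le> n then card (bounded_partitions (Suc M) (n - Suc M)) * x ^ n else 0))"
    by (intro sum.cong refl) (subst card_bounded_partitions_Suc, simp add: distrib_right)
  also have "\<dots> = ?S M + (\<Sum>n\<in>{Suc M..N}. card (bounded_partitions (Suc M) (n - Suc M)) * x ^ n)"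
    unfolding sum.distrib by (subst sum.inter_filter[symmetric]) (auto intro!: sum.cong)
  also have "(\<Sum>n\<in>{Suc M..N}. card (bounded_partitions (Suc M) (n - Suc M)) * x ^ n)
      = (\<Sum>n\<in>{Suc M..N}. x ^ Suc M * (card (bounded_partitions (Suc M) (n - Suc M)) * x ^ (n - Suc M)))"
  proof (intro sum.cong refl)
    fix n assume "n \<in> {Suc M..N}"
    then have "x ^ n = x ^ Suc M * x ^ (n - Suc M)"
      by (metis le_add_diff_inverse power_add atLeastAtMost_iff)
    then show "card (bounded_partitions (Suc M) (n - Suc M)) * x ^ n
      = x ^ Suc M * (card (bounded_partitions (Suc M) (n - Suc M)) * x ^ (n - Suc M))"
      by (simp only: mult_ac)
  qed
  also have "\<dots> = x ^ Suc M * (\<Sum>n\<in>(\<lambda>n. n - Suc M) ` {Suc M..N}. card (bounded_partitions (Suc M) n) * x ^ n)"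
    by (subst sum.reindex) (auto simp: inj_on_def sum_distrib_left)
  also have "\<dots> \<le> x ^ Suc M * ?S (Suc M)"
    using assms by (intro mult_left_mono sum_mono2) auto
  finally have "?S (Suc M) * (1 - x ^ Suc M) \<le> ?S M"
    by (simp add: algebra_simps)
  also have "\<dots> \<le> (\<Prod>k=1..M. inverse (1 - x ^ k))" by (rule Suc)
  finally have "?S (Suc M) \<le> (\<Prod>k=1..M. inverse (1 - x ^ k)) / (1 - x ^ Suc M)"
    using lt by (subst pos_le_divide_eq) auto
  then show ?case by (simp add: divide_inverse)
qed

text \<open>The bound does not depend on \<open>M\<close>, so through
  \<open>sum_bounded_partitions_le\<close> it also bounds the partial sums with unrestricted
  partitions.\<close>

lemma prod_inverse_le_exp:
  fixes x :: real
  assumes "0 \<le> x" "x < 1"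
  shows "(\<Prod>k=1..M. inverse (1 - x ^ k)) \<le> exp (1 / (1 - x)\<^sup>2)"
proof -
  have "inverse (1 - x ^ k) \<le> exp (x ^ k / (1 - x))" if "1 \<le> k" for k
  proof -
    have "x ^ k \<le> x" using assms that by (metis less_imp_le power_decreasing power_one_right)
    have "inverse (1 - x ^ k) = 1 + x ^ k / (1 - x ^ k)"
      using \<open>x ^ k \<le> x\<close> assms by (simp add: field_simps)
    also have "\<dots> \<le> 1 + x ^ k / (1 - x)"
      using \<open>x ^ k \<le> x\<close> assms by (intro add_left_mono divide_left_mono mult_pos_pos) auto
    also have "\<dots> \<le> exp (x ^ k / (1 - x))" by (rule exp_ge_add_one_self)
    finally show ?thesis .
  qed
  moreover have "0 \<le> inverse (1 - x ^ k)" for k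
    using assms by (simp add: power_le_one)
  ultimately have "(\<Prod>k=1..M. inverse (1 - x ^ k)) \<le> (\<Prod>k=1..M. exp (x ^ k / (1 - x)))"
    by (intro prod_mono) auto
  also have "\<dots> = exp (\<Sum>k=1..M. x ^ k / (1 - x))" by (simp add: exp_sum)
  also have "(\<Sum>k=1..M. x ^ k / (1 - x)) = (\<Sum>k=1..M. x ^ k) / (1 - x)"
    by (simp add: sum_divide_distrib)
  also have "(\<Sum>k=1..M. x ^ k) \<le> (\<Sum>k. x ^ k)"
    using assms by (intro sum_le_suminf) (auto intro: summable_geometric)
  also have "\<dots> = 1 / (1 - x)" using assms by (intro suminf_geometric) auto
  finally show ?thesis using assms by (simp add: power2_eq_square divide_right_mono)
qed

lemma card_bounded_partitions_le: "card (bounded_partitions M n) \<le> partition_count n"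
proof -
  have "bounded_partitions M n \<subseteq> bounded_partitions n n"
    by (subst bounded_partitions_ge[OF order_refl]) (auto simp: bounded_partitions_def)
  then have "card (bounded_partitions M n) \<le> card (bounded_partitions n n)"
    by (rule card_mono[OF finite_bounded_partitions])
  then show ?thesis
    by (simp add: partition_count_def bounded_partitions_ge)
qed

lemma card_bounded_partitions_eq: "n \<le> M \<Longrightarrow> card (bounded_partitions M n) = partition_count n"
  by (simp add: partition_count_def bounded_partitions_ge)

lemma summable_partition_count:
  fixes x :: real
  assumes "0 \<le> x" "x < 1"
  shows "summable (\<lambda>n. partition_count n * x ^ n)"
proof (rule summableI_nonneg_bounded)
  show "0 \<le> partition_count n * x ^ n" for n using assms by simp
  show "(\<Sum>n<N. partition_count n * x ^ n) \<le> exp (1 / (1 - x)\<^sup>2)" for N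
  proof -
    have "(\<Sum>n<N. partition_count n * x ^ n) = (\<Sum>n<N. card (bounded_partitions N n) * x ^ n)"
      by (intro sum.cong) (auto simp: card_bounded_partitions_eq)
    also have "\<dots> \<le> (\<Sum>n\<le>N. card (bounded_partitions N n) * x ^ n)"
      using assms by (intro sum_mono2) auto
    also have "\<dots> \<le> (\<Prod>k=1..N. inverse (1 - x ^ k))"
      using assms by (rule sum_bounded_partitions_le)
    also have "\<dots> \<le> exp (1 / (1 - x)\<^sup>2)" using assms by (rule prod_inverse_le_exp)
    finally show ?thesis .
  qed
qed

lemma summable_norm_partition_count:
  fixes q :: complex
  assumes "norm q < 1"
  shows "summable (\<lambda>n. norm (of_nat (partition_count n) * q ^ n))"
  using summable_partition_count[of "norm q"] assms by (simp add: norm_mult norm_power)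

lemma summable_bounded_partitions:
  fixes q :: complex
  assumes "norm q < 1"
  shows "summable (\<lambda>n. of_nat (card (bounded_partitions M n)) * q ^ n)"
  by (rule summable_comparison_test'[OF summable_norm_partition_count[OF assms], of 0])
     (auto simp: norm_mult card_bounded_partitions_le intro!: mult_right_mono)

lemma bounded_partitions_gf:
  fixes q :: complex
  assumes "norm q < 1"
  shows "(\<Sum>n. of_nat (card (bounded_partitions M n)) * q ^ n) = (\<Prod>k=1..M. inverse (1 - q ^ k))"
proof (induction M)
  case 0
  have "(\<Sum>n. of_nat (card (bounded_partitions 0 n)) * q ^ n)
      = (\<Sum>n\<in>{0}. of_nat (card (bounded_partitions 0 n)) * q ^ n)"
    by (rule suminf_finite) (auto simp: bounded_partitions_0)
  then show ?case by (simp add: bounded_partitions_0)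
next
  case (Suc M)
  let ?f = "\<lambda>M n. of_nat (card (bounded_partitions M n)) * q ^ n"
  let ?g = "\<lambda>n. if Suc M \<le> n then of_nat (card (bounded_partitions (Suc M) (n - Suc M))) * q ^ n else 0"
  have "(\<lambda>i. ?g (i + Suc M)) sums (q ^ Suc M * suminf (?f (Suc M)))"
  proof -
    have "(\<lambda>i. q ^ Suc M * ?f (Suc M) i) sums (q ^ Suc M * suminf (?f (Suc M)))"
      using assms by (intro sums_mult summable_sums summable_bounded_partitions)
    moreover have "(\<lambda>i. ?g (i + Suc M)) = (\<lambda>i. q ^ Suc M * ?f (Suc M) i)"
      by (rule ext) (simp add: power_add mult_ac)
    ultimately show ?thesis by (simp only:)
  qed
  then have g: "?g sums (q ^ Suc M * suminf (?f (Suc M)))"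
    by (subst (asm) sums_zero_iff_shift) auto
  have "suminf (?f (Suc M)) = (\<Sum>n. ?f M n + ?g n)"
    by (intro suminf_cong) (subst card_bounded_partitions_Suc, simp add: distrib_right)
  also have "\<dots> = suminf (?f M) + q ^ Suc M * suminf (?f (Suc M))"
    using assms g sums_unique[OF g]
    by (subst suminf_add[symmetric]) (auto intro: summable_bounded_partitions sums_summable)
  finally have "suminf (?f (Suc M)) * (1 - q ^ Suc M) = suminf (?f M)"
    by (simp add: algebra_simps)
  moreover have "1 - q ^ Suc M \<noteq> 0"
  proof
    assume "1 - q ^ Suc M = 0"
    then have "norm (q ^ Suc M) = 1" by simp
    moreover have "norm (q ^ Suc M) < 1"
      unfolding norm_power using assms by (intro power_Suc_lt_one) auto
    ultimately show False by simp
  qed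
  ultimately have "suminf (?f (Suc M)) = suminf (?f M) * inverse (1 - q ^ Suc M)"
    by (simp add: field_simps)
  then show ?case unfolding Suc by simp
qed

text \<open>Tannery's theorem: each coefficient is eventually constant in \<open>M\<close> and
  dominated by \<open>partition_count\<close>, whose series converges absolutely.\<close>

lemma bounded_partitions_gf_tendsto:
  fixes q :: complex
  assumes "norm q < 1"
  shows "(\<lambda>M. \<Prod>k=1..M. inverse (1 - q ^ k)) \<longlonglongrightarrow> (\<Sum>n. of_nat (partition_count n) * q ^ n)"
proof -
  have "(\<lambda>M. \<Sum>n. of_nat (card (bounded_partitions M n)) * q ^ n)
      \<longlonglongrightarrow> (\<Sum>n. of_nat (partition_count n) * q ^ n)"
  proof (rule tannerys_theorem[THEN conjunct2, THEN conjunct2])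
    fix n
    have "eventually (\<lambda>M. of_nat (card (bounded_partitions M n)) * q ^ n = of_nat (partition_count n) * q ^ n) sequentially"
      using eventually_ge_at_top[of n] by eventually_elim (simp add: card_bounded_partitions_eq)
    then show "(\<lambda>M. of_nat (card (bounded_partitions M n)) * q ^ n) \<longlonglongrightarrow> of_nat (partition_count n) * q ^ n"
      by (rule tendsto_eventually)
    show "\<forall>\<^sub>F (k, n) in sequentially \<times>\<^sub>F sequentially.
       norm (of_nat (card (bounded_partitions n k)) * q ^ k) \<le> norm (of_nat (partition_count k) * q ^ k)"
      by (intro always_eventually allI)
         (auto simp: norm_mult card_bounded_partitions_le intro!: mult_right_mono)
  qed (use summable_norm_partition_count[OF assms] in auto)
  then show ?thesis by (simp only: bounded_partitions_gf[OF assms])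
qed

text \<open>The logarithm of the partition product at q = e ^ (- z): expand - log (1 - q ^ k) in
  powers of q and sum over \<open>k\<close> first. This leaves the single function 1 / (e ^ w - 1)
  at the equally spaced points w = m z.\<close>

definition lam :: "complex \<Rightarrow> complex" where
  "lam z = (\<Sum>m. inverse (of_nat (Suc m)) * inverse (exp (of_nat (Suc m) * z) - 1))"

lemma summable_lam:
  assumes "0 < Re z"
  shows "summable (\<lambda>m. norm (inverse (of_nat (Suc m)) * inverse (exp (of_nat (Suc m) * z) - 1)))"
    and "(\<lambda>M. \<Sum>m. inverse (of_nat (Suc m)) * (\<Sum>k=1..M. (exp (- z) ^ Suc m) ^ k)) \<longlonglongrightarrow> lam z"
proof -
  define q where "q = exp (- z)"
  have q: "norm q < 1" using assms by (simp add: q_def norm_exp_eq_Re)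
  have qm: "norm (q ^ Suc m) < 1" for m
    unfolding norm_power using q by (intro power_Suc_lt_one) auto
  have lim: "(\<lambda>M. \<Sum>k=1..M. (q ^ Suc m) ^ k) \<longlonglongrightarrow> inverse (exp (of_nat (Suc m) * z) - 1)" for m
  proof -
    have "(\<Sum>k=1..M. (q ^ Suc m) ^ k) = (\<Sum>k<M. q ^ Suc m * (q ^ Suc m) ^ k)" for M
      by (rule sum.reindex_bij_witness[of _ Suc "\<lambda>k. k - 1"])
         (auto simp flip: power_Suc)
    moreover have "(\<lambda>M. \<Sum>k<M. q ^ Suc m * (q ^ Suc m) ^ k) \<longlonglongrightarrow> q ^ Suc m * (1 / (1 - q ^ Suc m))"
      using geometric_sums[OF qm[of m]] unfolding sums_def[symmetric] by (rule sums_mult)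
    moreover have "q ^ Suc m * (1 / (1 - q ^ Suc m)) = inverse (exp (of_nat (Suc m) * z) - 1)"
    proof -
      have e: "q ^ Suc m = inverse (exp (of_nat (Suc m) * z))"
        unfolding q_def exp_of_nat_mult exp_minus by (simp only: power_inverse)
      have "exp (of_nat (Suc m) * z) \<noteq> 1"
      proof
        assume "exp (of_nat (Suc m) * z) = 1"
        then have "q ^ Suc m = 1" by (simp only: e inverse_1)
        then show False using qm[of m] by (simp only: norm_one)
      qed
      then show ?thesis unfolding e by (simp add: field_simps)
    qed
    ultimately show ?thesis by (simp only:)
  qed
  define x where "x = norm q"
  have x: "0 \<le> x" "x < 1" using q by (auto simp: x_def)
  \<comment> \<open>Tannery needs a bound uniform in \<open>M\<close>. One factor x ^ (m + 1) is
    kept for summability in \<open>m\<close>; the other powers are weakened to x ^ (k - 1) and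
    summed geometrically.\<close>
  have bnd: "norm (inverse (of_nat (Suc m)) * (\<Sum>k=1..M. (q ^ Suc m) ^ k)) \<le> x ^ Suc m / (1 - x)" for m M
  proof -
    have "norm (\<Sum>k=1..M. (q ^ Suc m) ^ k) \<le> (\<Sum>k=1..M. x ^ Suc m * x ^ (k - 1))"
    proof (rule sum_norm_le)
      fix k assume "k \<in> {1..M}"
      then have k: "k = Suc (k - 1)" by simp
      have "norm ((q ^ Suc m) ^ k) = x ^ Suc m * (x ^ Suc m) ^ (k - 1)"
        by (subst k) (simp add: norm_power x_def norm_mult)
      also have "\<dots> \<le> x ^ Suc m * x ^ (k - 1)"
        using x by (intro mult_left_mono power_mono) (auto simp: mult_left_le power_le_one)
      finally show "norm ((q ^ Suc m) ^ k) \<le> x ^ Suc m * x ^ (k - 1)" .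
    qed
    also have "\<dots> = x ^ Suc m * (\<Sum>k=1..M. x ^ (k - 1))" by (simp add: sum_distrib_left)
    also have "(\<Sum>k=1..M. x ^ (k - 1)) = (\<Sum>k<M. x ^ k)"
      by (rule sum.reindex_bij_witness[of _ Suc "\<lambda>k. k - 1"]) auto
    also have "\<dots> \<le> (\<Sum>k. x ^ k)"
      using x by (intro sum_le_suminf summable_geometric) auto
    also have "\<dots> = 1 / (1 - x)" using x by (intro suminf_geometric) auto
    finally have *: "norm (\<Sum>k=1..M. (q ^ Suc m) ^ k) \<le> x ^ Suc m * (1 / (1 - x))"
      using x by (simp add: mult_left_mono)
    have "norm (inverse (of_nat (Suc m)) * (\<Sum>k=1..M. (q ^ Suc m) ^ k))
       \<le> 1 * norm (\<Sum>k=1..M. (q ^ Suc m) ^ k)"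
      unfolding norm_mult norm_inverse norm_of_nat by (intro mult_right_mono) (auto simp: field_simps)
    then show ?thesis using * by simp
  qed
  have sx: "summable (\<lambda>m. x ^ Suc m / (1 - x))"
    using x by (intro summable_divide) (subst summable_Suc_iff, rule summable_geometric, simp)
  have "summable (\<lambda>m. norm (inverse (of_nat (Suc m)) * inverse (exp (of_nat (Suc m) * z) - 1))) \<and>
    (\<lambda>M. \<Sum>m. inverse (of_nat (Suc m)) * (\<Sum>k=1..M. (q ^ Suc m) ^ k)) \<longlonglongrightarrow>
    (\<Sum>m. inverse (of_nat (Suc m)) * inverse (exp (of_nat (Suc m) * z) - 1))"
  proof (rule tannerys_theorem[THEN conjunct2])
    show "(\<lambda>M. inverse (of_nat (Suc m)) * (\<Sum>k=1..M. (q ^ Suc m) ^ k))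
      \<longlonglongrightarrow> inverse (of_nat (Suc m)) * inverse (exp (of_nat (Suc m) * z) - 1)" for m
      by (intro tendsto_mult tendsto_const lim)
    show "\<forall>\<^sub>F (m, M) in sequentially \<times>\<^sub>F sequentially.
      norm (inverse (of_nat (Suc m)) * (\<Sum>k=1..M. (q ^ Suc m) ^ k)) \<le> x ^ Suc m / (1 - x)"
      using bnd by (intro always_eventually allI) auto
  qed (use sx in auto)
  then show "summable (\<lambda>m. norm (inverse (of_nat (Suc m)) * inverse (exp (of_nat (Suc m) * z) - 1)))"
    "(\<lambda>M. \<Sum>m. inverse (of_nat (Suc m)) * (\<Sum>k=1..M. (exp (- z) ^ Suc m) ^ k)) \<longlonglongrightarrow> lam z"
    by (auto simp: q_def lam_def)
qed

text \<open>Proved for each finite product and passed to the limit. Only exponentials of the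
  logarithms are compared, so the branch of \<open>Ln\<close> causes no trouble.\<close>

lemma partition_count_gf_eq_exp_lam:
  assumes "0 < Re z"
  shows "(\<Sum>n. of_nat (partition_count n) * exp (- z) ^ n) = exp (lam z)"
proof -
  define q where "q = exp (- z)"
  have q: "norm q < 1" using assms by (simp add: q_def norm_exp_eq_Re)
  have "(\<Prod>k=1..M. inverse (1 - q ^ k))
    = exp (\<Sum>m. inverse (of_nat (Suc m)) * (\<Sum>k=1..M. (q ^ Suc m) ^ k))" for M
  proof -
    have ser: "(\<lambda>m. inverse (of_nat (Suc m)) * (q ^ Suc m) ^ k) sums (- Ln (1 - q ^ k))"
      and ne: "1 - q ^ k \<noteq> 0" if k1: "1 \<le> k" for k
    proof -
      obtain j where k: "k = Suc j" using k1 by (cases k) auto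
      have "norm q ^ k < 1" unfolding k by (rule power_Suc_lt_one) (use q in auto)
      then have lt: "norm (- (q ^ k)) < 1" by (simp add: norm_power)
      then show "1 - q ^ k \<noteq> 0" by auto
      have "(\<lambda>n. - ((- 1) ^ Suc n / of_nat n * (- (q ^ k)) ^ n)) sums (- ln (1 + - (q ^ k)))"
        by (intro sums_minus Ln_series lt)
      then have "(\<lambda>m. - ((- 1) ^ Suc (Suc m) / of_nat (Suc m) * (- (q ^ k)) ^ Suc m)) sums (- ln (1 - q ^ k))"
        by (subst sums_Suc_iff) simp
      moreover have "- ((- 1) ^ Suc (Suc m) / of_nat (Suc m) * (- (q ^ k)) ^ Suc m)
         = inverse (of_nat (Suc m)) * (q ^ Suc m) ^ k" for m
      proof -
        have "(- (q ^ k)) ^ Suc m = (- 1) ^ Suc m * (q ^ k) ^ Suc m" by (rule power_minus)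
        also have "(q ^ k) ^ Suc m = (q ^ Suc m) ^ k" by (metis power_commutes power_mult mult.commute)
        finally show ?thesis
          by (simp del: power_Suc of_nat_Suc add: divide_inverse mult.assoc flip: power_add)
             (simp add: power_add flip: mult.assoc power_mult_distrib del: of_nat_Suc)
      qed
      ultimately show "(\<lambda>m. inverse (of_nat (Suc m)) * (q ^ Suc m) ^ k) sums (- Ln (1 - q ^ k))"
        by simp
    qed
    have "(\<lambda>m. \<Sum>k=1..M. inverse (of_nat (Suc m)) * (q ^ Suc m) ^ k) sums (\<Sum>k=1..M. - Ln (1 - q ^ k))"
      by (intro sums_sum ser) simp
    then have "(\<Sum>m. inverse (of_nat (Suc m)) * (\<Sum>k=1..M. (q ^ Suc m) ^ k)) = (\<Sum>k=1..M. - Ln (1 - q ^ k))"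
      by (simp only: sum_distrib_left sums_unique[symmetric])
    also have "exp \<dots> = (\<Prod>k=1..M. exp (- Ln (1 - q ^ k)))" by (simp add: exp_sum)
    also have "\<dots> = (\<Prod>k=1..M. inverse (1 - q ^ k))"
      using ne by (intro prod.cong) (simp_all add: exp_minus)
    finally show ?thesis by simp
  qed
  then have "(\<lambda>M. \<Prod>k=1..M. inverse (1 - q ^ k)) \<longlonglongrightarrow> exp (lam z)"
    using tendsto_exp[OF summable_lam(2)[OF assms]] by (simp add: q_def)
  with bounded_partitions_gf_tendsto[OF q] show ?thesis
    unfolding q_def by (rule LIMSEQ_unique)
qed

section \<open>The pole-free part of 1 / (e ^ w - 1) on the sector of half angle pi / 4\<close>

definition sector :: "complex set" where
  "sector = {w. \<bar>Im w\<bar> \<le> Re w}"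

text \<open>1 / (e ^ w - 1) without its pole at 0, completed by its limit. The value - 1 / 2 there
  is the source of the term Ln z / 2 in \<open>rem\<close>.\<close>

definition phi :: "complex \<Rightarrow> complex" where
  "phi w = (if w = 0 then - 1 / 2 else inverse (exp w - 1) - inverse w)"

text \<open>An open set around the sector: 0 lies on the boundary of the half-plane, so a disc is
  added, small enough to avoid the other poles 2 pi i n.\<close>

definition phi_dom :: "complex set" where
  "phi_dom = ball 0 1 \<union> {w. 0 < Re w}"

lemma open_phi_dom: "open phi_dom"
  unfolding phi_dom_def by (intro open_Un open_ball open_halfspace_Re_gt)

lemma convex_sector: "convex sector"
proof (rule convexI)
  fix x y :: complex and u v :: real
  assume *: "x \<in> sector" "y \<in> sector" "0 \<le> u" "0 \<le> v" "u + v = 1"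
  have "\<bar>Im (u *\<^sub>R x + v *\<^sub>R y)\<bar> \<le> \<bar>u * Im x\<bar> + \<bar>v * Im y\<bar>"
    by simp
  also have "\<dots> = u * \<bar>Im x\<bar> + v * \<bar>Im y\<bar>"
    using * by (simp add: abs_mult)
  also have "\<dots> \<le> u * Re x + v * Re y"
    using * by (intro add_mono mult_left_mono) (auto simp: sector_def)
  finally show "u *\<^sub>R x + v *\<^sub>R y \<in> sector" by (simp add: sector_def)
qed

lemma closed_sector: "closed sector"
proof -
  have "sector = {w. \<bar>Im w\<bar> - Re w \<le> 0}" by (auto simp: sector_def)
  moreover have "closed {w. \<bar>Im w\<bar> - Re w \<le> 0}"
    by (intro closed_Collect_le continuous_intros)
  ultimately show ?thesis by (simp only:)
qed

text \<open>7/10 is a rational substitute for 1 / sqrt 2.\<close>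

lemma sector_Re_ge: "w \<in> sector \<Longrightarrow> 7 / 10 * norm w \<le> Re w"
proof -
  assume "w \<in> sector"
  then have w: "\<bar>Im w\<bar> \<le> Re w" by (simp add: sector_def)
  then have "(Im w)\<^sup>2 \<le> (Re w)\<^sup>2" by (metis abs_ge_zero abs_le_square_iff abs_of_nonneg order_trans)
  then have "(7 / 10 * norm w)\<^sup>2 \<le> (Re w)\<^sup>2"
    unfolding power_mult_distrib cmod_power2 power_divide
    by simp (use zero_le_power2[of "Re w"] in linarith)
  then show ?thesis by (rule power2_le_imp_le) (use w in linarith)
qed

lemma sector_scale: "w \<in> sector \<Longrightarrow> 0 \<le> r \<Longrightarrow> of_real r * w \<in> sector"
  by (auto simp: sector_def abs_mult mult_left_mono)

lemma sector_subset_phi_dom: "sector \<subseteq> phi_dom"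
proof
  fix w assume "w \<in> sector"
  then show "w \<in> phi_dom"
    using sector_Re_ge[of w] by (cases "w = 0") (auto simp: phi_dom_def)
qed

lemma exp_neq_1_phi_dom:
  assumes "w \<in> phi_dom" "w \<noteq> 0"
  shows "exp w \<noteq> 1"
proof
  assume "exp w = 1"
  then obtain n :: int where n: "Re w = 0" "Im w = of_int (2 * n) * pi" by (auto simp: exp_eq_1)
  with assms have "norm w < 1" by (auto simp: phi_dom_def)
  then have "\<bar>Im w\<bar> < 1" using abs_Im_le_cmod[of w] by linarith
  moreover have "n \<noteq> 0" using n assms(2) by (auto simp: complex_eq_iff)
  then have "1 \<le> \<bar>real_of_int n\<bar>" by linarith
  then have "1 * 1 \<le> \<bar>real_of_int n\<bar> * (2 * pi)" by (intro mult_mono) (use pi_gt3 in auto)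
  then have "1 \<le> \<bar>Im w\<bar>" unfolding n by (simp add: abs_mult mult_ac)
  ultimately show False by simp
qed

text \<open>\<open>E\<close> = (e ^ w - 1) / w and \<open>E2\<close> = (E - 1) / w are entire and
  phi = - E2 / E. Differentiating w E = e ^ w - 1 twice at 0 gives E' (0) = 1 / 2, which accounts
  for the value of \<open>phi\<close> at 0.\<close>

lemma phi_holomorphic: "phi holomorphic_on phi_dom"
proof -
  define E :: "complex \<Rightarrow> complex" where "E = (\<lambda>w. if w = 0 then deriv exp 0 else (exp w - exp 0) / (w - 0))"
  define E2 where "E2 = (\<lambda>w. if w = 0 then deriv E 0 else (E w - E 0) / (w - 0))"
  have E: "E holomorphic_on UNIV" unfolding E_def by (rule pole_lemma) (auto intro!: holomorphic_intros)
  then have E2: "E2 holomorphic_on UNIV" unfolding E2_def by (rule pole_lemma) auto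
  have E0: "E 0 = 1" by (simp add: E_def DERIV_imp_deriv[OF DERIV_exp])
  have Ew: "w * E w = exp w - 1" for w
    by (simp add: E_def)
  have dE: "(E has_field_derivative deriv E w) (at w)" for w
    by (rule holomorphic_derivI[OF E]) auto
  have ddE: "(deriv E has_field_derivative deriv (deriv E) w) (at w)" for w
    by (rule holomorphic_derivI[OF holomorphic_deriv[OF E]]) auto
  have *: "E w + w * deriv E w = exp w" for w
  proof -
    have "((\<lambda>w. w * E w) has_field_derivative E w + w * deriv E w) (at w)"
      by (auto intro!: derivative_eq_intros dE)
    moreover have "((\<lambda>w. w * E w) has_field_derivative exp w) (at w)"
      unfolding Ew by (auto intro!: derivative_eq_intros)
    ultimately show ?thesis by (rule DERIV_unique)
  qed
  have "((\<lambda>w. E w + w * deriv E w) has_field_derivative 2 * deriv E 0) (at 0)"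
    by (auto intro!: derivative_eq_intros dE ddE)
  moreover have "((\<lambda>w. E w + w * deriv E w) has_field_derivative 1) (at 0)"
    unfolding * by (auto intro!: derivative_eq_intros)
  ultimately have "2 * deriv E 0 = 1" by (rule DERIV_unique)
  then have dE0: "deriv E 0 = 1 / 2" by (simp add: eq_divide_eq mult.commute)
  have ne: "E w \<noteq> 0" if "w \<in> phi_dom" for w
    using exp_neq_1_phi_dom[OF that] E0 by (cases "w = 0") (auto simp: E_def)
  have "(\<lambda>w. - E2 w / E w) holomorphic_on phi_dom"
    using ne by (auto intro!: holomorphic_intros holomorphic_on_subset[OF E] holomorphic_on_subset[OF E2])
  moreover have "- E2 w / E w = phi w" if "w \<in> phi_dom" for w
  proof (cases "w = 0")
    case True
    then show ?thesis by (simp add: E2_def phi_def E0 dE0)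
  next
    case False
    then have "exp w - 1 \<noteq> 0" using exp_neq_1_phi_dom[OF that] by simp
    then show ?thesis using False by (simp add: E2_def E_def phi_def E0 DERIV_imp_deriv[OF DERIV_exp] field_simps)
  qed
  ultimately show ?thesis by (rule holomorphic_transform)
qed

lemma phi_norm_le:
  assumes "0 < Re w"
  shows "norm (phi w) \<le> 1 / Re w + 1 / norm w"
proof -
  have w: "w \<noteq> 0" using assms by auto
  have "Re w \<le> exp (Re w) - 1" using exp_ge_add_one_self[of "Re w"] by linarith
  also have "\<dots> \<le> norm (exp w - 1)"
    using norm_triangle_ineq2[of "exp w" 1] by (simp add: norm_exp_eq_Re)
  finally have "inverse (norm (exp w - 1)) \<le> inverse (Re w)"
    using assms by (intro le_imp_inverse_le)
  moreover have "norm (phi w) \<le> inverse (norm (exp w - 1)) + inverse (norm w)"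
    using norm_triangle_ineq4[of "inverse (exp w - 1)" "inverse w"] w by (simp add: phi_def norm_inverse)
  ultimately show ?thesis by (simp add: divide_inverse)
qed

definition phi' :: "complex \<Rightarrow> complex" where "phi' = deriv phi"
definition phi'' :: "complex \<Rightarrow> complex" where "phi'' = deriv phi'"

lemma phi_deriv:
  assumes "w \<in> phi_dom"
  shows "(phi has_field_derivative phi' w) (at w)" "(phi' has_field_derivative phi'' w) (at w)"
  unfolding phi'_def phi''_def
  by (rule holomorphic_derivI[OF phi_holomorphic open_phi_dom assms],
      rule holomorphic_derivI[OF holomorphic_deriv[OF phi_holomorphic open_phi_dom] open_phi_dom assms])

text \<open>Cauchy's inequality on the circle of radius |w| / 2. There Re v >= (7/10 - 1/2) |w| and
  |v| >= |w| / 2, so \<open>phi\<close> is at most (5 + 2) / |w|, and 2 * 7 * 4 = 56.\<close>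

lemma phi''_bound_large:
  assumes "w \<in> sector" "w \<noteq> 0"
  shows "norm (phi'' w) \<le> 56 / norm w ^ 3"
proof -
  define r where "r = norm w / 2"
  have r: "0 < r" using assms by (simp add: r_def)
  have Re: "1 / 5 * norm w \<le> Re v \<and> norm w / 2 \<le> norm v" if "v \<in> cball w r" for v
  proof -
    have d: "norm (w - v) \<le> norm w / 2" using that by (simp add: r_def dist_norm)
    have "Re w - Re v \<le> norm w / 2" using d complex_Re_le_cmod[of "w - v"] by simp
    moreover have "norm w \<le> norm (w - v) + norm v" using norm_triangle_ineq[of "w - v" v] by simp
    ultimately show ?thesis using sector_Re_ge[OF assms(1)] d by simp
  qed
  have sub: "cball w r \<subseteq> {v. 0 < Re v}"
  proof
    fix v assume "v \<in> cball w r"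
    then have "1 / 5 * norm w \<le> Re v" using Re by blast
    moreover have "0 < norm w" using assms(2) by simp
    ultimately have "0 < Re v" by linarith
    then show "v \<in> {v. 0 < Re v}" by simp
  qed
  then have sub': "cball w r \<subseteq> phi_dom" by (auto simp: phi_dom_def)
  have "norm ((deriv ^^ 2) phi w) \<le> fact 2 * (7 / norm w) / r ^ 2"
  proof (rule Cauchy_inequality)
    show "phi holomorphic_on ball w r"
      by (rule holomorphic_on_subset[OF phi_holomorphic]) (use sub' in auto)
    show "continuous_on (cball w r) phi"
      by (rule holomorphic_on_imp_continuous_on, rule holomorphic_on_subset[OF phi_holomorphic]) (use sub' in auto)
    show "norm (phi v) \<le> 7 / norm w" if "norm (w - v) = r" for v
    proof -
      have v: "v \<in> cball w r" using that by (simp add: dist_norm)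
      then have "0 < Re v" using sub by auto
      then have "norm (phi v) \<le> 1 / Re v + 1 / norm v" by (rule phi_norm_le)
      also have "\<dots> \<le> 1 / (1 / 5 * norm w) + 1 / (norm w / 2)"
        using Re[OF v] assms(2) \<open>0 < Re v\<close> by (intro add_mono divide_left_mono mult_pos_pos) auto
      also have "\<dots> = 7 / norm w" by (simp add: field_simps)
      finally show ?thesis .
    qed
  qed (use r in auto)
  also have "fact 2 * (7 / norm w) / r ^ 2 = 56 / norm w ^ 3"
    by (simp add: r_def field_simps power2_eq_square power3_eq_cube)
  also have "(deriv ^^ 2) phi w = phi'' w"
    by (simp add: phi''_def phi'_def eval_nat_numeral)
  finally show ?thesis .
qed

text \<open>Quadratic decay, weaker than the cubic one just shown, is the form that telescopes in
  \<open>sum_telescope_le\<close>. In the constant, 4 B serves |w| <= 1 and 224 = 4 * 56 the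
  rest.\<close>

lemma phi''_bound: "\<exists>K>0. \<forall>w\<in>sector. norm (phi'' w) \<le> K / (1 + norm w)\<^sup>2"
proof -
  have "compact (sector \<inter> cball 0 1)"
    using closed_sector by (metis closed_Int_compact compact_cball)
  moreover have "continuous_on (sector \<inter> cball 0 1) phi''"
  proof -
    have "phi'' holomorphic_on phi_dom"
      unfolding phi''_def phi'_def by (intro holomorphic_deriv phi_holomorphic open_phi_dom)
    then have "phi'' holomorphic_on (sector \<inter> cball 0 1)"
      by (rule holomorphic_on_subset) (use sector_subset_phi_dom in auto)
    then show ?thesis by (rule holomorphic_on_imp_continuous_on)
  qed
  ultimately have "bounded (phi'' ` (sector \<inter> cball 0 1))"
    by (intro compact_imp_bounded compact_continuous_image)
  then obtain B where B: "0 < B" "\<And>w. w \<in> sector \<inter> cball 0 1 \<Longrightarrow> norm (phi'' w) \<le> B"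
    unfolding bounded_pos by auto
  show ?thesis
  proof (intro exI conjI ballI)
    show "0 < 4 * B + 224" using B by simp
    fix w assume w: "w \<in> sector"
    show "norm (phi'' w) \<le> (4 * B + 224) / (1 + norm w)\<^sup>2"
    proof (cases "norm w \<le> 1")
      case True
      have "(1 + norm w)\<^sup>2 \<le> 2\<^sup>2" using True by (intro power_mono) auto
      then have "norm (phi'' w) * (1 + norm w)\<^sup>2 \<le> B * 4"
        using B w True by (intro mult_mono) auto
      also have "\<dots> \<le> 4 * B + 224" by simp
      finally show ?thesis
        by (subst pos_le_divide_eq) (intro zero_less_power add_pos_nonneg, auto)
    next
      case False
      then have "w \<noteq> 0" by auto
      have "(1 + norm w)\<^sup>2 \<le> (2 * norm w)\<^sup>2" using False by (intro power_mono) auto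
      also have "\<dots> = 4 * norm w ^ 2" by (simp add: power_mult_distrib)
      also have "\<dots> \<le> 4 * norm w ^ 3"
        using False by (intro mult_left_mono power_increasing) auto
      finally have le: "(1 + norm w)\<^sup>2 \<le> 4 * norm w ^ 3" .
      have "norm (phi'' w) * (1 + norm w)\<^sup>2 \<le> (56 / norm w ^ 3) * (4 * norm w ^ 3)"
        using phi''_bound_large[OF w \<open>w \<noteq> 0\<close>] False le by (intro mult_mono) (auto simp del: times_divide_eq_left)
      also have "\<dots> = 224" using False by auto
      also have "\<dots> \<le> 4 * B + 224" using B by simp
      finally show ?thesis
        by (subst pos_le_divide_eq) (intro zero_less_power add_pos_nonneg, auto)
    qed
  qed
qed

section \<open>The remainder of the logarithm is Lipschitz near 0\<close>

definition partial_rem :: "nat \<Rightarrow> complex \<Rightarrow> complex" where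
  "partial_rem M z = (\<Sum>m=1..M. inverse (of_nat m) * phi (of_nat m * z)) - Ln z / 2"

text \<open>A Riemann sum for the integral of 1 / (1 + x) ^ 2, bounded uniformly in
  \<open>M\<close>: the first term is \<open>y\<close>, and each later one is at most 1 / (1 + (m -
  1) y) - 1 / (1 + m y).\<close>

lemma sum_telescope_le:
  fixes y :: real
  assumes "0 \<le> y"
  shows "(\<Sum>m=1..M. y / (1 + real (m - 1) * y)\<^sup>2) \<le> y + 1"
proof -
  have le: "(\<Sum>m<Suc M. y / (1 + real m * y)\<^sup>2) \<le> y + 1 - 1 / (1 + real M * y)" for M
  proof (induction M)
    case (Suc M)
    define a where "a = real M * y"
    have a: "0 \<le> a" "real (Suc M) * y = a + y" using assms by (simp_all add: a_def algebra_simps)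
    have "y / (1 + (a + y))\<^sup>2 \<le> y / ((1 + a) * (1 + (a + y)))"
      using a assms unfolding power2_eq_square by (intro divide_left_mono mult_mono mult_pos_pos) auto
    also have "\<dots> = 1 / (1 + a) - 1 / (1 + (a + y))"
      using a assms by (simp add: divide_simps)
    finally have "y / (1 + real (Suc M) * y)\<^sup>2 \<le> 1 / (1 + real M * y) - 1 / (1 + real (Suc M) * y)"
      by (simp only: a(2) a_def)
    then show ?case using Suc by (subst sum.lessThan_Suc) linarith
  qed simp
  have "(\<Sum>m=1..M. y / (1 + real (m - 1) * y)\<^sup>2) = (\<Sum>m<M. y / (1 + real m * y)\<^sup>2)"
    by (rule sum.reindex_bij_witness[of _ Suc "\<lambda>k. k - 1"]) auto
  also have "\<dots> \<le> (\<Sum>m<Suc M. y / (1 + real m * y)\<^sup>2)"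
    using assms by (intro sum_mono2) auto
  also have "\<dots> \<le> y + 1 - 1 / (1 + real M * y)" by (rule le)
  also have "\<dots> \<le> y + 1" using assms by simp
  finally show ?thesis .
qed

text \<open>The derivative telescopes up to second derivatives, because \<open>phi' (m z)\<close> is close to the
  difference quotient of \<open>phi\<close> over the segment from \<open>(m - 1) z\<close> to \<open>m z\<close>.\<close>

lemma partial_rem_deriv:
  assumes z: "z \<in> sector" "z \<noteq> 0"
    and K: "0 < K" "\<And>w. w \<in> sector \<Longrightarrow> norm (phi'' w) \<le> K / (1 + norm w)\<^sup>2"
  shows "(partial_rem M has_field_derivative
            ((\<Sum>m=1..M. phi' (of_nat m * z)) - 1 / (2 * z))) (at z)"
    and "norm ((\<Sum>m=1..M. phi' (of_nat m * z)) - 1 / (2 * z))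
      \<le> K * (norm z + 1) + norm (phi (of_nat M * z)) / norm z"
proof -
  have Rez: "0 < Re z" using sector_Re_ge[OF z(1)] z(2) by (metis less_le_trans mult_pos_pos zero_less_norm_iff divide_pos_pos zero_less_numeral)
  have in_sec: "of_nat m * z \<in> sector" for m
    using sector_scale[OF z(1), of "real m"] by simp
  have in_dom: "of_nat m * z \<in> phi_dom" for m
    using in_sec sector_subset_phi_dom by blast
  have "((\<lambda>z. inverse (of_nat m) * phi (of_nat m * z)) has_field_derivative phi' (of_nat m * z)) (at z)"
    if "m \<in> {1..M}" for m
  proof -
    have "((\<lambda>z. phi (of_nat m * z)) has_field_derivative phi' (of_nat m * z) * of_nat m) (at z)"
      by (rule DERIV_chain'[of "\<lambda>z. of_nat m * z"])
         (auto intro!: derivative_eq_intros phi_deriv(1)[OF in_dom])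
    then have "((\<lambda>z. inverse (of_nat m) * phi (of_nat m * z)) has_field_derivative
        inverse (of_nat m) * (phi' (of_nat m * z) * of_nat m)) (at z)"
      by (rule DERIV_cmult)
    moreover have "inverse (of_nat m) * (phi' (of_nat m * z) * of_nat m) = phi' (of_nat m * z)"
      using that by simp
    ultimately show ?thesis by (simp only:)
  qed
  then have "((\<lambda>z. \<Sum>m=1..M. inverse (of_nat m) * phi (of_nat m * z)) has_field_derivative
      (\<Sum>m=1..M. phi' (of_nat m * z))) (at z)"
    by (rule DERIV_sum)
  moreover have "((\<lambda>z. Ln z / 2) has_field_derivative 1 / (2 * z)) (at z)"
    using Rez z(2) by (auto intro!: derivative_eq_intros simp: complex_nonpos_Reals_iff divide_simps)
  ultimately show "(partial_rem M has_field_derivative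
            ((\<Sum>m=1..M. phi' (of_nat m * z)) - 1 / (2 * z))) (at z)"
    unfolding partial_rem_def[abs_def] by (rule DERIV_diff)
  define err where "err m = phi' (of_nat m * z) - (phi (of_nat m * z) - phi (of_nat (m - 1) * z)) / z" for m
  have err: "norm (err m) \<le> K * (norm z / (1 + real (m - 1) * norm z)\<^sup>2)" if m: "m \<in> {1..M}" for m
  proof -
    define a b where "a = of_nat (m - 1) * z" and "b = of_nat m * z"
    have ab: "b - a = z" using m by (simp add: a_def b_def of_nat_diff algebra_simps)
    have seg: "v \<in> sector" "norm a \<le> norm v" if v: "v \<in> closed_segment a b" for v
    proof -
      show "v \<in> sector" using v closed_segment_subset[OF in_sec in_sec convex_sector] by (auto simp: a_def b_def)
      obtain t where t: "0 \<le> t" "t \<le> 1" "v = (1 - t) *\<^sub>R a + t *\<^sub>R b"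
        using v by (auto simp: closed_segment_def)
      have "v = a + t *\<^sub>R (b - a)" by (simp add: t algebra_simps)
      also have "\<dots> = of_real (real (m - 1) + t) * z" 
        unfolding ab by (simp add: a_def scaleR_conv_of_real algebra_simps)
      finally have "norm v = (real (m - 1) + t) * norm z"
        using t(1,2) by (simp only: norm_mult norm_of_real)
      moreover have "norm a = real (m - 1) * norm z" by (simp add: a_def norm_mult)
      ultimately show "norm a \<le> norm v" using t(1) by (simp add: mult_right_mono)
    qed
    define B where "B = K / (1 + norm a)\<^sup>2"
    have p2: "norm (phi'' v) \<le> B" if v: "v \<in> closed_segment a b" for v
    proof -
      have "norm (phi'' v) \<le> K / (1 + norm v)\<^sup>2" using K seg[OF v] by blast
      also have "\<dots> \<le> B" unfolding B_def using K seg[OF v]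
        by (intro divide_left_mono power_mono mult_pos_pos zero_less_power) (auto intro: add_pos_nonneg)
      finally show ?thesis .
    qed
    have B0: "0 \<le> B" using K by (simp add: B_def)
    have p1: "norm (phi' b - phi' v) \<le> B * norm z" if v: "v \<in> closed_segment a b" for v
    proof -
      have "norm (phi' b - phi' v) \<le> B * norm (b - v)"
      proof (rule field_differentiable_bound[OF convex_closed_segment _ p2 ends_in_segment(2) v])
        show "(phi' has_field_derivative phi'' w) (at w within closed_segment a b)"
          if "w \<in> closed_segment a b" for w
          by (rule has_field_derivative_at_within[OF phi_deriv(2)])
             (use seg(1)[OF that] sector_subset_phi_dom in auto)
      qed
      also have "norm (b - v) \<le> norm (b - a)"
        using segment_bound(2)[OF v] by (simp add: norm_minus_commute)
      finally show ?thesis using B0 by (simp add: ab mult_left_mono)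
    qed
    \<comment> \<open>\<open>h\<close> has derivative \<open>phi' b - phi' w\<close>, which is
      already bounded by \<open>B\<close> times |z|. A second use of the mean value bound gives the
      quadratic error, replacing Taylor's formula.\<close>
    define h where "h w = phi' b * w - phi w" for w
    have "norm (h b - h a) \<le> B * norm z * norm (b - a)"
    proof (rule field_differentiable_bound[OF convex_closed_segment _ p1 ends_in_segment(2) ends_in_segment(1)])
      show "(h has_field_derivative phi' b - phi' w) (at w within closed_segment a b)"
        if "w \<in> closed_segment a b" for w
      proof -
        have "(phi has_field_derivative phi' w) (at w within closed_segment a b)"
          by (rule has_field_derivative_at_within[OF phi_deriv(1)])
             (use seg(1)[OF that] sector_subset_phi_dom in auto)
        then show ?thesis unfolding h_def[abs_def] by (auto intro!: derivative_eq_intros)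
      qed
    qed
    moreover have "h b - h a = z * err m"
    proof -
      have "z * ((phi b - phi a) / z) = phi b - phi a" using z(2) by simp
      then have "z * err m = z * phi' b - (phi b - phi a)"
        unfolding err_def a_def[symmetric] b_def[symmetric] right_diff_distrib[of z] by (simp only:)
      also have "\<dots> = (b - a) * phi' b - (phi b - phi a)" by (simp only: ab)
      finally show ?thesis by (simp add: h_def algebra_simps)
    qed
    ultimately have "norm z * norm (err m) \<le> norm z * (B * norm z)"
      by (simp add: norm_mult ab mult_ac)
    then have "norm (err m) \<le> B * norm z" using z(2) by simp
    then show ?thesis by (simp add: B_def a_def norm_mult)
  qed
  have "(\<Sum>m=1..M. phi (of_nat m * z) - phi (of_nat (m - 1) * z)) = phi (of_nat M * z) - phi 0"
    by (induction M) auto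
  \<comment> \<open>The boundary value - phi 0 = 1 / 2 produces exactly the derivative 1 / (2 z) of
    Ln z / 2; this is why that term is subtracted in \<open>partial_rem\<close>.\<close>
  then have tele: "(\<Sum>m=1..M. (phi (of_nat m * z) - phi (of_nat (m - 1) * z)) / z) = phi (of_nat M * z) / z + 1 / (2 * z)"
    using z(2) by (simp add: phi_def[of 0] flip: sum_divide_distrib) (simp add: field_simps)
  have "(\<Sum>m=1..M. phi' (of_nat m * z)) - 1 / (2 * z)
      = (\<Sum>m=1..M. err m) + phi (of_nat M * z) / z"
    using tele by (simp add: err_def sum_subtractf)
  also have "norm \<dots> \<le> norm (\<Sum>m=1..M. err m) + norm (phi (of_nat M * z) / z)"
    by (rule norm_triangle_ineq)
  also have "norm (\<Sum>m=1..M. err m) \<le> (\<Sum>m=1..M. K * (norm z / (1 + real (m - 1) * norm z)\<^sup>2))"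
    by (rule sum_norm_le) (rule err)
  also have "\<dots> = K * (\<Sum>m=1..M. norm z / (1 + real (m - 1) * norm z)\<^sup>2)"
    by (simp add: sum_distrib_left)
  also have "\<dots> \<le> K * (norm z + 1)"
    using K by (intro mult_left_mono sum_telescope_le) auto
  finally show "norm ((\<Sum>m=1..M. phi' (of_nat m * z)) - 1 / (2 * z))
      \<le> K * (norm z + 1) + norm (phi (of_nat M * z)) / norm z"
    by (simp add: norm_divide)
qed

text \<open>The limit of \<open>partial_rem\<close>. Subtracting the poles 1 / (m z) of the Lambert
  terms removes the sum of 1 / (m ^ 2 z), that is pi ^ 2 / (6 z). As \<open>phi (m z)\<close> is
  close to - 1 / 2 while m stays below 1 / |z|, what is left grows like Ln z / 2.\<close>

definition rem :: "complex \<Rightarrow> complex" where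
  "rem z = lam z - of_real (pi\<^sup>2 / 6) / z - Ln z / 2"

lemma partial_rem_tendsto:
  assumes "0 < Re z"
  shows "(\<lambda>M. partial_rem M z) \<longlonglongrightarrow> rem z"
proof -
  have z: "z \<noteq> 0" using assms by auto
  have 1: "(\<lambda>m. inverse (of_nat (Suc m)) * inverse (exp (of_nat (Suc m) * z) - 1)) sums lam z"
    unfolding lam_def using summable_norm_cancel[OF summable_lam(1)[OF assms]] by (rule summable_sums)
  have "(\<lambda>n. of_real (1 / (real n + 1)\<^sup>2) :: complex) sums of_real (pi\<^sup>2 / 6)"
    unfolding sums_of_real_iff using inverse_squares_sums by (simp add: add.commute)
  then have 2: "(\<lambda>n. of_real (1 / (real n + 1)\<^sup>2) / z) sums (of_real (pi\<^sup>2 / 6) / z)"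
    by (rule sums_divide)
  have "(\<lambda>m. inverse (of_nat (Suc m)) * phi (of_nat (Suc m) * z)) sums (lam z - of_real (pi\<^sup>2 / 6) / z)"
  proof -
    have "inverse (of_nat (Suc m)) * phi (of_nat (Suc m) * z)
       = inverse (of_nat (Suc m)) * inverse (exp (of_nat (Suc m) * z) - 1) - of_real (1 / (real m + 1)\<^sup>2) / z" for m
    proof -
      have "of_nat (Suc m) * z \<noteq> 0" using z by (simp del: of_nat_Suc)
      moreover have "(of_real (1 / (real m + 1)\<^sup>2) / z :: complex) = inverse (of_nat (Suc m)) * inverse (of_nat (Suc m) * z)"
        by (simp add: divide_inverse power2_eq_square add.commute)
      ultimately show ?thesis by (simp del: of_nat_Suc add: phi_def right_diff_distrib)
    qed
    then show ?thesis using sums_diff[OF 1 2] by (simp only:)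
  qed
  then have "(\<lambda>M. (\<Sum>m<M. inverse (of_nat (Suc m)) * phi (of_nat (Suc m) * z)) - Ln z / 2) \<longlonglongrightarrow> rem z"
    unfolding rem_def by (intro tendsto_diff tendsto_const) (simp add: sums_def)
  moreover have "(\<Sum>m=1..M. inverse (of_nat m) * phi (of_nat m * z)) = (\<Sum>m<M. inverse (of_nat (Suc m)) * phi (of_nat (Suc m) * z))" for M
    by (rule sum.reindex_bij_witness[of _ Suc "\<lambda>k. k - 1"]) auto
  ultimately show ?thesis by (simp only: partial_rem_def)
qed

lemma rem_lipschitz:
  "\<exists>K>0. \<forall>z\<in>sector. \<forall>z'\<in>sector. 0 < Re z \<longrightarrow> 0 < Re z' \<longrightarrow> norm z \<le> 2 \<longrightarrow> norm z' \<le> 2 \<longrightarrow>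
     norm (rem z - rem z') \<le> K * norm (z - z')"
proof -
  obtain K where K: "0 < K" "\<And>w. w \<in> sector \<Longrightarrow> norm (phi'' w) \<le> K / (1 + norm w)\<^sup>2"
    using phi''_bound by blast
  show ?thesis
  proof (intro exI[of _ "3 * K"] conjI ballI impI)
    show "0 < 3 * K" using K by simp
    fix z z' assume z: "z \<in> sector" "z' \<in> sector" "0 < Re z" "0 < Re z'" "norm z \<le> 2" "norm z' \<le> 2"
    \<comment> \<open>A lower bound for the real part on the convex set \<open>S\<close> makes the
      boundary term phi (M w) / w of the derivative O(1 / M) uniformly. It vanishes as
      \<open>M\<close> grows, so \<open>d\<close> does not enter the Lipschitz constant, and the 3
      is a bound for |w| + 1.\<close>
    define d where "d = min (Re z) (Re z')"
    have d: "0 < d" using z by (simp add: d_def)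
    define S where "S = sector \<inter> cball 0 2 \<inter> {w. d \<le> Re w}"
    have cS: "convex S" unfolding S_def by (intro convex_Int convex_sector convex_cball convex_halfspace_Re_ge)
    have zS: "z \<in> S" "z' \<in> S" using z by (auto simp: S_def d_def)
    have bound: "norm (partial_rem M z - partial_rem M z') \<le> (3 * K + 2 / (real M * d\<^sup>2)) * norm (z - z')"
      if M: "0 < M" for M
    proof (rule field_differentiable_bound[OF cS _ _ zS])
      fix w assume w: "w \<in> S"
      then have w': "w \<in> sector" "w \<noteq> 0" "norm w \<le> 2" "d \<le> Re w" "d \<le> norm w"
        using d complex_Re_le_cmod[of w] by (auto simp: S_def)
      show "(partial_rem M has_field_derivative
            ((\<Sum>m=1..M. phi' (of_nat m * w)) - 1 / (2 * w))) (at w within S)"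
        by (rule has_field_derivative_at_within, rule partial_rem_deriv(1)[OF w'(1,2) K])
      have "norm ((\<Sum>m=1..M. phi' (of_nat m * w)) - 1 / (2 * w))
         \<le> K * (norm w + 1) + norm (phi (of_nat M * w)) / norm w"
        by (rule partial_rem_deriv(2)[OF w'(1,2) K])
      also have "K * (norm w + 1) \<le> K * 3" using K w' by (intro mult_left_mono) auto
      also have "norm (phi (of_nat M * w)) \<le> 1 / Re (of_nat M * w) + 1 / norm (of_nat M * w)"
        using M w' d by (intro phi_norm_le) auto
      also have "\<dots> \<le> 1 / (real M * d) + 1 / (real M * d)"
        using M w' d by (intro add_mono divide_left_mono mult_pos_pos) (auto simp: norm_mult)
      also have "(1 / (real M * d) + 1 / (real M * d)) / norm w \<le> (1 / (real M * d) + 1 / (real M * d)) / d"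
        using M w' d by (intro divide_left_mono mult_pos_pos) auto
      also have "\<dots> = 2 / (real M * d\<^sup>2)" using d M by (simp add: field_simps power2_eq_square)
      finally show "norm ((\<Sum>m=1..M. phi' (of_nat m * w)) - 1 / (2 * w)) \<le> 3 * K + 2 / (real M * d\<^sup>2)"
        by (simp add: divide_right_mono mult.commute)
    qed
    have "(\<lambda>M. norm (partial_rem M z - partial_rem M z')) \<longlonglongrightarrow> norm (rem z - rem z')"
      using z by (intro tendsto_intros partial_rem_tendsto)
    moreover have "(\<lambda>M. (3 * K + 2 / (real M * d\<^sup>2)) * norm (z - z')) \<longlonglongrightarrow> (3 * K + 0) * norm (z - z')"
    proof (intro tendsto_intros)
      have "(\<lambda>M. (2 / d\<^sup>2) / real M) \<longlonglongrightarrow> 0" by (rule lim_const_over_n)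
      then show "(\<lambda>M. 2 / (real M * d\<^sup>2)) \<longlonglongrightarrow> 0" by (simp add: field_simps)
    qed
    ultimately have "norm (rem z - rem z') \<le> (3 * K + 0) * norm (z - z')"
    proof (rule LIMSEQ_le)
      show "\<exists>N. \<forall>n\<ge>N. norm (partial_rem n z - partial_rem n z') \<le> (3 * K + 2 / (real n * d\<^sup>2)) * norm (z - z')"
        using bound by (intro exI[of _ 1]) auto
    qed
    then show "norm (rem z - rem z') \<le> 3 * K * norm (z - z')" by simp
  qed
qed

section \<open>The circle method\<close>

lemma pi_squared_bounds: "9 < pi\<^sup>2" "pi\<^sup>2 < 12"
proof -
  have "3\<^sup>2 < pi\<^sup>2" using pi_gt3 by (intro power_strict_mono) auto
  then show "9 < pi\<^sup>2" by simp
  have "pi\<^sup>2 < (3.2)\<^sup>2" using pi_approx by (intro power_strict_mono) auto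
  then show "pi\<^sup>2 < 12" by (simp add: power2_eq_square)
qed

lemma sqrt_6_le_pi: "sqrt 6 \<le> pi"
  using pi_squared_bounds by (intro real_le_lsqrt) auto

lemma of_real_sector: "0 \<le> s \<Longrightarrow> of_real s \<in> sector"
  by (simp add: sector_def)

text \<open>Makes the limit of \<open>rem\<close> at 0 real, so that its exponential is a positive
  factor of the main term.\<close>

lemma rem_of_real_Reals:
  assumes "0 < s"
  shows "rem (of_real s) \<in> \<real>"
proof -
  have "lam (of_real s) = (\<Sum>m. of_real (inverse (real (Suc m)) * inverse (exp (real (Suc m) * s) - 1)))"
    unfolding lam_def by (intro suminf_cong) (simp flip: exp_of_real)
  also have "\<dots> = of_real (\<Sum>m. inverse (real (Suc m)) * inverse (exp (real (Suc m) * s) - 1))"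
  proof (rule suminf_of_real[symmetric])
    have "summable (\<lambda>m. norm (inverse (of_nat (Suc m)) * inverse (exp (of_nat (Suc m) * complex_of_real s) - 1)))"
      by (rule summable_lam) (use assms in simp)
    also have "(\<lambda>m. norm (inverse (of_nat (Suc m)) * inverse (exp (of_nat (Suc m) * complex_of_real s) - 1)))
      = (\<lambda>m. inverse (real (Suc m)) * inverse (exp (real (Suc m) * s) - 1))"
    proof
      fix m
      have "inverse (of_nat (Suc m)) * inverse (exp (of_nat (Suc m) * complex_of_real s) - 1)
         = of_real (inverse (real (Suc m)) * inverse (exp (real (Suc m) * s) - 1))"
        by (simp flip: exp_of_real)
      then show "norm (inverse (of_nat (Suc m)) * inverse (exp (of_nat (Suc m) * complex_of_real s) - 1))
         = inverse (real (Suc m)) * inverse (exp (real (Suc m) * s) - 1)"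
        using assms by (simp only: norm_of_real) (simp del: of_nat_Suc)
    qed
    finally show "summable (\<lambda>m. inverse (real (Suc m)) * inverse (exp (real (Suc m) * s) - 1))" .
  qed
  finally have "lam (of_real s) \<in> \<real>" by simp
  moreover have "Ln (of_real s) \<in> \<real>" using assms by (simp add: Ln_of_real)
  ultimately show ?thesis unfolding rem_def by auto
qed

text \<open>By the Lipschitz bound \<open>rem\<close> is Cauchy along the points 1 / (k + 1) of the
  sector; passing to the limit in the same bound gives the linear error.\<close>

lemma rem_limit:
  "\<exists>C K. 0 < K \<and> (\<forall>z\<in>sector. 0 < Re z \<longrightarrow> norm z \<le> 2 \<longrightarrow> norm (rem z - of_real C) \<le> K * norm z)"
proof -
  obtain K where K: "0 < K" and lip: "\<And>z z'. z \<in> sector \<Longrightarrow> z' \<in> sector \<Longrightarrow> 0 < Re z \<Longrightarrow> 0 < Re z' \<Longrightarrow>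
     norm z \<le> 2 \<Longrightarrow> norm z' \<le> 2 \<Longrightarrow> norm (rem z - rem z') \<le> K * norm (z - z')"
    using rem_lipschitz by blast
  define x where "x k = complex_of_real (inverse (real (Suc k)))" for k
  have x: "x k \<in> sector" "0 < Re (x k)" "norm (x k) \<le> 2" for k
    unfolding x_def norm_of_real by (auto simp: sector_def divide_simps simp del: of_real_inverse)
  have xlim: "x \<longlonglongrightarrow> 0"
    unfolding x_def using tendsto_of_real[OF LIMSEQ_inverse_real_of_nat, where 'a = complex] by (simp only: of_real_0)
  have "Cauchy (\<lambda>k. rem (x k))"
  proof (rule metric_CauchyI)
    fix e :: real assume e: "0 < e"
    have "Cauchy x" using xlim by (intro LIMSEQ_imp_Cauchy)
    then obtain M where M: "\<And>m n. m \<ge> M \<Longrightarrow> n \<ge> M \<Longrightarrow> dist (x m) (x n) < e / K"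
      using metric_CauchyD[of x "e / K"] e K by auto
    show "\<exists>M. \<forall>m\<ge>M. \<forall>n\<ge>M. dist (rem (x m)) (rem (x n)) < e"
    proof (intro exI[of _ M] allI impI)
      fix m n assume "M \<le> m" "M \<le> n"
      then have "K * norm (x m - x n) < e"
        using M[of m n] K by (simp add: dist_norm field_simps)
      moreover have "norm (rem (x m) - rem (x n)) \<le> K * norm (x m - x n)"
        by (intro lip x)
      ultimately show "dist (rem (x m)) (rem (x n)) < e" by (simp add: dist_norm)
    qed
  qed
  then obtain L where L: "(\<lambda>k. rem (x k)) \<longlonglongrightarrow> L"
    using Cauchy_convergent convergent_def by blast
  have "rem (x k) \<in> \<real>" for k
    unfolding x_def by (rule rem_of_real_Reals) simp
  then have "L \<in> \<real>" by (rule closed_sequentially[OF closed_complex_Reals _ L])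
  then obtain C where C: "L = of_real C" by (auto elim: Reals_cases)
  show ?thesis
  proof (rule exI[of _ C], rule exI[of _ K], intro conjI ballI impI K)
    fix z assume z: "z \<in> sector" "0 < Re z" "norm z \<le> 2"
    have "(\<lambda>k. norm (rem z - rem (x k))) \<longlonglongrightarrow> norm (rem z - L)"
      by (intro tendsto_intros L)
    moreover have "(\<lambda>k. K * norm (z - x k)) \<longlonglongrightarrow> K * norm (z - 0)"
      by (intro tendsto_intros xlim)
    ultimately have "norm (rem z - L) \<le> K * norm (z - 0)"
    proof (rule LIMSEQ_le)
      show "\<exists>N. \<forall>n\<ge>N. norm (rem z - rem (x n)) \<le> K * norm (z - x n)"
        by (intro exI[of _ 0] allI impI lip x z)
    qed
    then show "norm (rem z - of_real C) \<le> K * norm z" by (simp add: C)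
  qed
qed

section \<open>The integrand on the major and on the minor arc\<close>

lemma one_minus_cos_le: "1 - cos y \<le> (y::real)\<^sup>2 / 2"
proof -
  have "(sin (y / 2))\<^sup>2 \<le> (y / 2)\<^sup>2"
    using abs_sin_x_le_abs_x[of "y / 2"] by (simp only: abs_le_square_iff)
  then show ?thesis using cos_double_sin[of "y / 2"] by (simp add: power_divide)
qed

lemma one_minus_cos_ge:
  fixes y :: real
  assumes "0 \<le> y" "y \<le> 1"
  shows "y\<^sup>2 / 4 \<le> 1 - cos y"
proof -
  have "7 / 8 * (y / 2) \<le> sin (y / 2)"
  proof (cases "y = 0")
    case False
    then have "0 < y / 2" using assms by simp
    then obtain \<xi> where xi: "0 < \<xi>" "\<xi> < y / 2" "sin (y / 2) - sin 0 = (y / 2 - 0) * cos \<xi>"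
      using MVT2[of 0 "y / 2" sin cos] DERIV_sin by blast
    have "\<xi>\<^sup>2 \<le> (1 / 2)\<^sup>2" using xi assms by (intro power_mono) auto
    then have "7 / 8 \<le> cos \<xi>" using one_minus_cos_le[of \<xi>] by (simp add: power_divide)
    then have "(y / 2) * (7 / 8) \<le> (y / 2) * cos \<xi>" using assms by (intro mult_left_mono) auto
    then show ?thesis using xi(3) by (simp only: sin_zero diff_0_right)
  qed simp
  then have "(7 / 8 * (y / 2))\<^sup>2 \<le> (sin (y / 2))\<^sup>2"
    using assms by (intro power_mono) auto
  then have "49 * y\<^sup>2 / 256 \<le> (sin (y / 2))\<^sup>2" by (simp add: power_mult_distrib power_divide)
  moreover have "cos y = 1 - 2 * (sin (y / 2))\<^sup>2" using cos_double_sin[of "y / 2"] by simp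
  ultimately show ?thesis using zero_le_power2[of y] by linarith
qed

text \<open>The real part of e ^ (x + i y) differs from 1 only to second order in \<open>y\<close>.
  Taking real parts thus squares the odd terms of the exponent on the major arc, which is what
  brings the relative error down to 1 / X.\<close>

lemma exp_cos_minus_1_le:
  fixes x y :: real
  shows "\<bar>exp x * cos y - 1\<bar> \<le> (\<bar>x\<bar> + y\<^sup>2) * exp (max x 0)"
proof -
  have 1: "\<bar>exp x - 1\<bar> \<le> \<bar>x\<bar> * exp (max x 0)"
  proof (cases "0 \<le> x")
    case True
    have "1 - x \<le> exp (- x)" using exp_ge_add_one_self[of "- x"] by simp
    then have "(1 - x) * exp x \<le> exp (- x) * exp x" by (intro mult_right_mono) auto
    then have "(1 - x) * exp x \<le> 1" by (simp flip: exp_add)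
    then show ?thesis using True by (simp add: algebra_simps max_def)
  next
    case False
    have "exp x \<le> 1" using False by simp
    moreover have "1 + x \<le> exp x" by (rule exp_ge_add_one_self)
    ultimately have "\<bar>exp x - 1\<bar> \<le> \<bar>x\<bar>" using False by linarith
    then show ?thesis using False by (simp add: max_def)
  qed
  have "0 \<le> 1 - cos y" by simp
  have "\<bar>exp x * cos y - 1\<bar> = \<bar>(exp x - 1) - exp x * (1 - cos y)\<bar>" by (simp add: algebra_simps)
  also have "\<dots> \<le> \<bar>exp x - 1\<bar> + exp x * (1 - cos y)"
    using abs_triangle_ineq4[of "exp x - 1" "exp x * (1 - cos y)"] \<open>0 \<le> 1 - cos y\<close> by (simp add: abs_mult)
  also have "exp x * (1 - cos y) \<le> exp (max x 0) * y\<^sup>2"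
  proof (intro mult_mono)
    show "1 - cos y \<le> y\<^sup>2" using one_minus_cos_le[of y] zero_le_power2[of y] by linarith
  qed auto
  finally show ?thesis using 1 by (simp add: algebra_simps)
qed

text \<open>Expand (1 + s / 8) ^ 3 <= e ^ (3 s / 8); 1536 is 3 * 8 ^ 3. The exponent 3/8 is small
  enough to leave some decay at the end of \<open>major_arc\<close>.\<close>

lemma cubic_le_exp:
  fixes s c :: real
  assumes "0 \<le> s" "0 \<le> c"
  shows "s\<^sup>2 + 4 * s + 3 * s ^ 3 + c \<le> (1536 + c) * exp (3 * s / 8)"
proof -
  define u where "u = s / 8"
  have u: "0 \<le> u" "s = 8 * u" using assms by (auto simp: u_def)
  have "(1 + u) ^ 3 \<le> exp u ^ 3" using u by (intro power_mono exp_ge_add_one_self) auto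
  also have "exp u ^ 3 = exp (3 * s / 8)" by (simp add: u flip: exp_of_nat_mult)
  finally have e: "(1 + u) ^ 3 \<le> exp (3 * s / 8)" .
  have "s\<^sup>2 + 4 * s + 3 * s ^ 3 + c \<le> (1536 + c) * (1 + u) ^ 3"
  proof -
    have "0 \<le> c * ((1 + u) ^ 3 - 1)" using u assms by (intro mult_nonneg_nonneg) (auto simp: one_le_power)
    moreover have "64 * u\<^sup>2 + 32 * u + 1536 * u ^ 3 \<le> 1536 * (1 + u) ^ 3"
      using u by (simp add: power3_eq_cube power2_eq_square algebra_simps)
    ultimately show ?thesis by (simp add: u power_mult_distrib algebra_simps)
  qed
  also have "\<dots> \<le> (1536 + c) * exp (3 * s / 8)" using e assms by (intro mult_left_mono) auto
  finally show ?thesis .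
qed


lemma square_sum3_le: "(a + b + c)\<^sup>2 \<le> 3 * (a\<^sup>2 + b\<^sup>2 + (c::real)\<^sup>2)"
proof -
  have "0 \<le> (a - b)\<^sup>2 + (b - c)\<^sup>2 + (a - c)\<^sup>2" by simp
  then show ?thesis by (simp add: power2_eq_square algebra_simps)
qed

text \<open>With z = s (1 + i t) the large terms are X / (1 + i t) + X (1 + i t) = 2 X - X t ^ 2 + X
  t ^ 4 / (1 + t ^ 2) + i X t ^ 3 / (1 + t ^ 2). In terms of u = X t ^ 2, both X t ^ 4 and (X t ^ 3)
  ^ 2 are 1 / X times a power of u, and the contributions of the logarithm and of \<open>rem\<close>
  are of the same kind.\<close>

lemma major_arc:
  fixes s t C K :: real
  assumes K: "0 < K" and rem: "\<And>z. z \<in> sector \<Longrightarrow> 0 < Re z \<Longrightarrow> norm z \<le> 2 \<Longrightarrow> norm (rem z - of_real C) \<le> K * norm z"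
    and s: "0 < s" "s \<le> 1" and t: "\<bar>t\<bar> \<le> 1"
  defines "X \<equiv> pi\<^sup>2 / (6 * s)"
  shows "\<bar>Re (exp (lam (Complex s (s * t)) + of_real (X / s) * Complex s (s * t)))
            - exp (2 * X + C) * sqrt s * exp (- X * t\<^sup>2)\<bar>
     \<le> exp (2 * X + C) * sqrt s * (exp (1 + 4 * K) * (1536 + (4 * K + 48 * K\<^sup>2)) / X * exp (- X * t\<^sup>2 / 8))"
proof -
  define z where "z = Complex s (s * t)"
  define \<rho> where "\<rho> = rem z - of_real C"
  have t2: "t\<^sup>2 \<le> 1" using t by (simp add: abs_square_le_1)
  have X1: "1 \<le> X" unfolding X_def using s pi_squared_bounds by (subst pos_le_divide_eq) auto
  have sX: "s \<le> 2 / X" unfolding X_def using s pi_squared_bounds by (simp add: field_simps)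
  have zs: "z = of_real s * Complex 1 t" by (simp add: z_def complex_eq_iff)
  have z_sec: "z \<in> sector" using s t by (simp add: z_def sector_def abs_mult mult_left_le)
  have Rez: "Re z = s" "z \<noteq> 0" using s by (auto simp: z_def complex_eq_iff)
  have nz: "norm z \<le> 2 * s"
  proof -
    have "s * \<bar>t\<bar> \<le> s * 1" using s t by (intro mult_left_mono) auto
    moreover have "norm z \<le> s + s * \<bar>t\<bar>" using cmod_le[of z] s by (simp add: z_def abs_mult)
    ultimately show ?thesis by linarith
  qed
  have rho: "norm \<rho> \<le> 4 * K / X"
  proof -
    have "norm \<rho> \<le> K * norm z" unfolding \<rho>_def using nz s Rez by (intro rem z_sec) auto
    also have "\<dots> \<le> K * (2 * (2 / X))" using K nz sX by (intro mult_left_mono) auto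
    finally show ?thesis by (simp add: mult.commute)
  qed
  have rhoRI: "\<bar>Re \<rho>\<bar> \<le> 4 * K / X" "\<bar>Im \<rho>\<bar> \<le> 4 * K / X"
    using rho abs_Re_le_cmod[of \<rho>] abs_Im_le_cmod[of \<rho>] by linarith+
  \<comment> \<open>\<open>x\<close> and \<open>y\<close> are the real and imaginary parts of what
    remains of the exponent besides 2 X + C + ln s / 2 - X t ^ 2.\<close>
  define x where "x = X * t ^ 4 / (1 + t\<^sup>2) + ln (1 + t\<^sup>2) / 4 + Re \<rho>"
  define y where "y = X * t ^ 3 / (1 + t\<^sup>2) + arctan t / 2 + Im \<rho>"
  have tp: "0 < 1 + t\<^sup>2" by (simp add: add_pos_nonneg)
  have Ln1: "Re (Ln (Complex 1 t)) = ln (1 + t\<^sup>2) / 2" "Im (Ln (Complex 1 t)) = arctan t"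
  proof -
    have "Complex 1 t \<noteq> 0" by (simp add: complex_eq_iff)
    moreover have "norm (Complex 1 t) = sqrt (1 + t\<^sup>2)" by (simp add: cmod_def)
    ultimately show "Re (Ln (Complex 1 t)) = ln (1 + t\<^sup>2) / 2"
      using tp by (simp add: ln_sqrt)
    show "Im (Ln (Complex 1 t)) = arctan t" by (subst Im_Ln_eq) (auto simp: complex_eq_iff)
  qed
  have Lnz: "Ln z = of_real (ln s) + Ln (Complex 1 t)"
    unfolding zs using s by (subst Ln_times_of_real) (auto simp: complex_eq_iff)
  have inv: "of_real (pi\<^sup>2 / 6) / z = of_real X / Complex 1 t"
    unfolding zs X_def using s by (simp add: field_simps)
  have lin: "of_real (X / s) * z = of_real X * Complex 1 t"
    unfolding zs using s by simp
  define E where "E = lam z + of_real (X / s) * z"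
  have E: "E = of_real X / Complex 1 t + Ln z / 2 + \<rho> + of_real C + of_real X * Complex 1 t"
    unfolding E_def lin inv[symmetric] \<rho>_def rem_def by simp
  have q4: "1 / (1 + t\<^sup>2) = 1 - t\<^sup>2 + t ^ 4 / (1 + t\<^sup>2)"
    using tp by (simp add: field_simps power4_eq_xxxx power2_eq_square)
  have q3: "t / (1 + t\<^sup>2) = t - t ^ 3 / (1 + t\<^sup>2)"
    using tp by (simp add: field_simps power3_eq_cube power2_eq_square)
  have ReE: "Re E = 2 * X + C + ln s / 2 - X * t\<^sup>2 + x"
  proof -
    have "Re E = X * (1 / (1 + t\<^sup>2)) + (ln s + ln (1 + t\<^sup>2) / 2) / 2 + Re \<rho> + C + X"
      unfolding E Lnz by (simp add: Ln1 Re_divide)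
    also have "\<dots> = 2 * X + C + ln s / 2 - X * t\<^sup>2 + x"
      unfolding q4 x_def by (simp add: algebra_simps)
    finally show ?thesis .
  qed
  have ImE: "Im E = y"
  proof -
    have "Im E = - X * (t / (1 + t\<^sup>2)) + arctan t / 2 + Im \<rho> + X * t"
      unfolding E Lnz by (simp add: Ln1 Im_divide)
    also have "\<dots> = y" unfolding q3 y_def by (simp add: algebra_simps)
    finally show ?thesis .
  qed
  define M where "M = exp (2 * X + C) * sqrt s"
  have M0: "0 < M" using s by (simp add: M_def)
  define u where "u = X * t\<^sup>2"
  have u0: "0 \<le> u" using X1 by (simp add: u_def)
  have "exp (ln s / 2) = sqrt s" using s by (simp add: ln_sqrt[symmetric])
  moreover have "2 * X + C + ln s / 2 - X * t\<^sup>2 + x = (2 * X + C) + ln s / 2 + - u + x"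
    by (simp add: u_def)
  ultimately have "Re (exp E) = M * exp (- u) * (exp x * cos y)"
    unfolding Re_exp ReE ImE M_def by (simp only: exp_add mult_ac)
  then have "Re (exp E) - M * exp (- u) = M * exp (- u) * (exp x * cos y - 1)"
    by (simp add: algebra_simps)
  then have "\<bar>Re (exp E) - M * exp (- u)\<bar> = M * exp (- u) * \<bar>exp x * cos y - 1\<bar>"
    using M0 by (simp add: abs_mult)
  also have "\<dots> \<le> M * exp (- u) * ((\<bar>x\<bar> + y\<^sup>2) * exp (max x 0))"
    using M0 by (intro mult_left_mono exp_cos_minus_1_le) auto
  also have "\<dots> \<le> M * exp (- u) * (((u\<^sup>2 + 4 * u + 3 * u ^ 3 + (4 * K + 48 * K\<^sup>2)) / X) * exp (u / 2 + (1 + 4 * K)))"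
  proof (intro mult_left_mono mult_mono)
    have t4: "X * t ^ 4 / (1 + t\<^sup>2) \<le> u\<^sup>2 / X"
    proof -
      have "X * t ^ 4 / (1 + t\<^sup>2) \<le> X * t ^ 4 / 1"
        using X1 tp by (intro divide_left_mono) auto
      also have "\<dots> = u\<^sup>2 / X" using X1 by (simp add: u_def power_mult_distrib power2_eq_square power4_eq_xxxx)
      finally show ?thesis .
    qed
    have lnt: "0 \<le> ln (1 + t\<^sup>2)" "ln (1 + t\<^sup>2) \<le> u / X" "ln (1 + t\<^sup>2) \<le> 1"
      using ln_add_one_self_le_self[of "t\<^sup>2"] t2 X1 by (simp_all add: u_def)
    have p4: "0 \<le> X * t ^ 4 / (1 + t\<^sup>2)" using X1 tp by simp
    have ax: "\<bar>x\<bar> \<le> u\<^sup>2 / X + u / X + 4 * K / X"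
      unfolding x_def using t4 lnt p4 rhoRI(1) by linarith
    \<comment> \<open>Since t ^ 2 / (1 + t ^ 2) <= 1 / 2 for |t| <= 1, the quartic term uses up at
      most half of the Gaussian decay.\<close>
    have "X * t ^ 4 / (1 + t\<^sup>2) \<le> u / 2"
    proof -
      have "X * t ^ 4 / (1 + t\<^sup>2) = u * (t\<^sup>2 / (1 + t\<^sup>2))" by (simp add: u_def power2_eq_square power4_eq_xxxx)
      also have "\<dots> \<le> u * (1 / 2)" using u0 t2 tp by (intro mult_left_mono) (auto simp: field_simps)
      finally show ?thesis by simp
    qed
    moreover have "4 * K / X \<le> 4 * K / 1" using K X1 by (intro divide_left_mono) auto
    ultimately have "x \<le> u / 2 + (1 + 4 * K)"
      unfolding x_def using lnt(3) rhoRI(1) by linarith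
    then show "exp (max x 0) \<le> exp (u / 2 + (1 + 4 * K))" using u0 K by simp
    have "y\<^sup>2 \<le> 3 * ((X * t ^ 3 / (1 + t\<^sup>2))\<^sup>2 + (arctan t / 2)\<^sup>2 + (Im \<rho>)\<^sup>2)"
      unfolding y_def by (rule square_sum3_le)
    also have "(X * t ^ 3 / (1 + t\<^sup>2))\<^sup>2 \<le> u ^ 3 / X"
    proof -
      have "(X * t ^ 3 / (1 + t\<^sup>2))\<^sup>2 = (X * t ^ 3)\<^sup>2 / (1 + t\<^sup>2)\<^sup>2" by (simp add: power_divide)
      also have "\<dots> \<le> (X * t ^ 3)\<^sup>2 / 1" using tp by (intro divide_left_mono) (auto simp: one_le_power)
      also have "\<dots> = u ^ 3 / X"
        using X1 by (simp add: u_def power_mult_distrib power2_eq_square power3_eq_cube)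
      finally show ?thesis .
    qed
    also have "(arctan t / 2)\<^sup>2 \<le> u / X"
    proof -
      have "\<bar>arctan t / 2\<bar> \<le> \<bar>t\<bar>" using abs_arctan_le[of t] by simp
      then have "(arctan t / 2)\<^sup>2 \<le> t\<^sup>2" by (simp only: abs_le_square_iff)
      then show ?thesis using X1 by (simp add: u_def)
    qed
    also have "(Im \<rho>)\<^sup>2 \<le> 16 * K\<^sup>2 / X"
    proof -
      have "(Im \<rho>)\<^sup>2 \<le> (4 * K / X)\<^sup>2" using rhoRI(2) K X1 by (simp add: abs_le_square_iff[symmetric])
      also have "\<dots> = 16 * K\<^sup>2 / X\<^sup>2" by (simp add: power_divide power_mult_distrib)
      also have "\<dots> \<le> 16 * K\<^sup>2 / X" using X1 by (intro divide_left_mono) (auto simp: self_le_power)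
      finally show ?thesis .
    qed
    finally have "y\<^sup>2 \<le> 3 * (u ^ 3 / X + u / X + 16 * K\<^sup>2 / X)" by simp
    then have "\<bar>x\<bar> + y\<^sup>2 \<le> u\<^sup>2 / X + u / X + 4 * K / X + 3 * (u ^ 3 / X + u / X + 16 * K\<^sup>2 / X)"
      using ax by linarith
    also have "\<dots> = (u\<^sup>2 + 4 * u + 3 * u ^ 3 + (4 * K + 48 * K\<^sup>2)) / X"
      by (simp add: add_divide_distrib)
    finally show "\<bar>x\<bar> + y\<^sup>2 \<le> (u\<^sup>2 + 4 * u + 3 * u ^ 3 + (4 * K + 48 * K\<^sup>2)) / X" .
    show "0 \<le> (u\<^sup>2 + 4 * u + 3 * u ^ 3 + (4 * K + 48 * K\<^sup>2)) / X" using u0 X1 K by simp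
  qed (use M0 in auto)
  also have "\<dots> \<le> M * exp (- u) * (((1536 + (4 * K + 48 * K\<^sup>2)) * exp (3 * u / 8) / X) * exp (u / 2 + (1 + 4 * K)))"
    using M0 u0 K X1 by (intro mult_left_mono mult_right_mono divide_right_mono cubic_le_exp) auto
  also have "\<dots> = M * (exp (1 + 4 * K) * (1536 + (4 * K + 48 * K\<^sup>2)) / X * (exp (- u) * exp (3 * u / 8) * exp (u / 2)))"
    by (simp add: exp_add)
  \<comment> \<open>Of the decay e ^ (- u), 3/8 pays for the polynomial in u and 1/2 for the quartic
    term; 1/8 is left for integration.\<close>
  also have "exp (- u) * exp (3 * u / 8) * exp (u / 2) = exp (- u / 8)"
    by (simp flip: exp_add)
  finally show ?thesis unfolding E_def z_def M_def u_def by simp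
qed

text \<open>Compare the Lambert series with its value at theta = 0 term by term. No term is larger
  off the real axis, and the first one alone loses 1 / (40 s), because |e ^ z - 1| ^ 2 = (e ^ s - 1)
  ^ 2 + 2 e ^ s (1 - cos theta).\<close>

lemma minor_arc_lam:
  fixes s \<theta> :: real
  assumes s: "0 < s" "s \<le> 1" and th: "s \<le> \<bar>\<theta>\<bar>" "\<bar>\<theta>\<bar> \<le> pi"
  shows "Re (lam (Complex s \<theta>)) \<le> Re (lam (of_real s)) - 1 / (40 * s)"
proof -
  define z where "z = Complex s \<theta>"
  define f where "f m z = inverse (of_nat (Suc m)) * inverse (exp (of_nat (Suc m) * z) - 1)" for m and z :: complex
  have Rez: "0 < Re z" "0 < Re (complex_of_real s)" using s by (auto simp: z_def)
  have sums: "(\<lambda>m. Re (f m z)) sums Re (lam z)" if "0 < Re z" for z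
    using summable_sums[OF summable_norm_cancel[OF summable_lam(1)[OF that]]]
    unfolding f_def lam_def[symmetric] by (rule sums_Re)
  have freal: "f m (of_real s) = of_real (inverse (real (Suc m)) * inverse (exp (real (Suc m) * s) - 1))" for m
    by (simp add: f_def flip: exp_of_real)
  define d where "d m = Re (f m (of_real s)) - Re (f m z)" for m
  have dsums: "d sums (Re (lam (of_real s)) - Re (lam z))"
    unfolding d_def using Rez by (intro sums_diff sums)
  have fle: "Re (f m z) \<le> inverse (real (Suc m)) * inverse (norm (exp (of_nat (Suc m) * z) - 1))" for m
  proof -
    have "Re (f m z) \<le> norm (f m z)" by (rule complex_Re_le_cmod)
    also have "\<dots> = inverse (real (Suc m)) * inverse (norm (exp (of_nat (Suc m) * z) - 1))"
      unfolding f_def norm_mult norm_inverse norm_of_nat ..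
    finally show ?thesis .
  qed
  have expge: "exp (real (Suc m) * s) - 1 \<le> norm (exp (of_nat (Suc m) * z) - 1)" for m
    using norm_triangle_ineq2[of "exp (of_nat (Suc m) * z)" 1] by (simp add: z_def)
  have exppos: "0 < exp (real (Suc m) * s) - 1" for m using s by (simp del: of_nat_Suc)
  have "0 \<le> d m" for m
  proof -
    have "inverse (norm (exp (of_nat (Suc m) * z) - 1)) \<le> inverse (exp (real (Suc m) * s) - 1)"
      by (intro le_imp_inverse_le expge exppos)
    then have "Re (f m z) \<le> inverse (real (Suc m)) * inverse (exp (real (Suc m) * s) - 1)"
      using fle[of m] by (meson inverse_nonnegative_iff_nonnegative mult_left_mono of_nat_0_le_iff order_trans)
    then show ?thesis by (simp only: d_def freal Re_complex_of_real)
  qed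
  then have "d 0 \<le> suminf d"
    using sum_le_suminf[OF sums_summable[OF dsums], of "{0}"] by simp
  then have d0: "d 0 \<le> Re (lam (of_real s)) - Re (lam z)" using sums_unique[OF dsums] by simp
  define a where "a = exp s - 1"
  have a: "0 < a" "a \<le> 2 * s"
  proof -
    show "0 < a" using s by (simp add: a_def)
    have "exp s \<le> 1 + s + s\<^sup>2" using s by (intro exp_bound) auto
    also have "s\<^sup>2 \<le> s" using s by (simp add: power2_eq_square mult_left_le)
    finally show "a \<le> 2 * s" by (simp add: a_def)
  qed
  have "cos \<bar>\<theta>\<bar> \<le> cos s" using s th by (intro cos_monotone_0_pi_le) auto
  then have cos: "s\<^sup>2 / 4 \<le> 1 - cos \<theta>" using one_minus_cos_ge[of s] s by simp
  have "(norm (exp z - 1))\<^sup>2 = (exp s * cos \<theta> - 1)\<^sup>2 + (exp s * sin \<theta>)\<^sup>2"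
    unfolding cmod_power2 by (simp add: z_def Re_exp Im_exp)
  also have "\<dots> = (exp s)\<^sup>2 * ((sin \<theta>)\<^sup>2 + (cos \<theta>)\<^sup>2) - 2 * exp s * cos \<theta> + 1"
    by (simp add: power2_diff power_mult_distrib algebra_simps del: sin_cos_squared_add sin_cos_squared_add2 sin_cos_squared_add3)
  also have "\<dots> = a\<^sup>2 + 2 * exp s * (1 - cos \<theta>)"
    unfolding sin_cos_squared_add by (simp add: a_def power2_eq_square algebra_simps)
  also have "\<dots> \<ge> a\<^sup>2 + 2 * 1 * (s\<^sup>2 / 4)"
    using cos s by (intro add_left_mono mult_mono) auto
  also have "a\<^sup>2 + 2 * 1 * (s\<^sup>2 / 4) \<ge> a\<^sup>2 + a\<^sup>2 / 8"
  proof -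
    have "a\<^sup>2 \<le> (2 * s)\<^sup>2" using a by (intro power_mono) auto
    then show ?thesis by (simp add: power_mult_distrib)
  qed
  finally have "a\<^sup>2 + a\<^sup>2 / 8 \<le> (norm (exp z - 1))\<^sup>2" by simp
  \<comment> \<open>1.06 ^ 2 < 9 / 8. The gain 1 - 1 / 1.06 = 6 / 106 times 1 / (2 s), from a <= 2
    s, is at least 1 / (40 s).\<close>
  moreover have "(106 / 100 * a)\<^sup>2 \<le> a\<^sup>2 + a\<^sup>2 / 8"
    unfolding power_mult_distrib by (simp add: power2_eq_square)
  ultimately have "(106 / 100 * a)\<^sup>2 \<le> (norm (exp z - 1))\<^sup>2" by linarith
  then have "106 / 100 * a \<le> norm (exp z - 1)"
    by (rule power2_le_imp_le) simp
  then have "inverse (norm (exp z - 1)) \<le> inverse (106 / 100 * a)"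
    using a by (intro le_imp_inverse_le) auto
  also have "\<dots> = inverse a - (6 / 106) * inverse a" using a by (simp add: field_simps)
  finally have "inverse (norm (exp z - 1)) \<le> inverse a - (6 / 106) * inverse a" .
  moreover have "(6 / 106) * inverse (2 * s) \<le> (6 / 106) * inverse a"
    using a s by (intro mult_left_mono le_imp_inverse_le) auto
  ultimately have "inverse (norm (exp z - 1)) \<le> inverse a - (6 / 106) * inverse (2 * s)" by linarith
  moreover have "1 / (40 * s) \<le> (6 / 106) * inverse (2 * s)" using s by (simp add: field_simps)
  moreover have "Re (f 0 (of_real s)) = inverse a" by (simp only: freal a_def Re_complex_of_real) simp
  moreover have "Re (f 0 z) \<le> inverse (norm (exp z - 1))" using fle[of 0] by simp
  ultimately show ?thesis using d0 by (simp add: d_def z_def)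
qed

lemma minor_arc:
  fixes s \<theta> C K :: real
  assumes K: "0 < K" and rem: "\<And>z. z \<in> sector \<Longrightarrow> 0 < Re z \<Longrightarrow> norm z \<le> 2 \<Longrightarrow> norm (rem z - of_real C) \<le> K * norm z"
    and s: "0 < s" "s \<le> 1" and th: "s \<le> \<bar>\<theta>\<bar>" "\<bar>\<theta>\<bar> \<le> pi"
  defines "X \<equiv> pi\<^sup>2 / (6 * s)"
  shows "norm (exp (lam (Complex s \<theta>) + of_real (X / s) * Complex s \<theta>))
     \<le> exp (2 * X + C) * sqrt s * (exp K * exp (- X / 80))"
proof -
  have "Re (rem (of_real s)) - C \<le> norm (rem (of_real s) - of_real C)"
    using complex_Re_le_cmod[of "rem (of_real s) - of_real C"] by simp
  also have "\<dots> \<le> K * norm (complex_of_real s)"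
    using s by (intro rem of_real_sector) auto
  also have "\<dots> \<le> K * 1" using s K by (intro mult_left_mono) auto
  finally have rems: "Re (rem (of_real s)) \<le> C + K" by simp
  have lams: "lam (of_real s) = of_real (X + ln s / 2) + rem (of_real s)"
    using s unfolding rem_def X_def by (simp add: Ln_of_real)
  have X: "X / 80 \<le> 1 / (40 * s)" unfolding X_def using s pi_squared_bounds by (simp add: field_simps)
  have "Re (lam (Complex s \<theta>)) + X \<le> Re (lam (of_real s)) - 1 / (40 * s) + X"
    using minor_arc_lam[OF s th] by simp
  also have "\<dots> \<le> 2 * X + C + ln s / 2 + K - X / 80"
    unfolding lams using rems X by simp
  finally have "exp (Re (lam (Complex s \<theta>)) + X) \<le> exp (2 * X + C + ln s / 2 + K - X / 80)" by simp
  also have "\<dots> = exp (2 * X + C) * exp (ln s / 2) * (exp K * exp (- X / 80))"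
    by (simp flip: exp_add)
  also have "exp (ln s / 2) = sqrt s" using s by (simp add: ln_sqrt[symmetric])
  finally show ?thesis using s by simp
qed

section \<open>Cauchy's coefficient integral and its main term\<close>

lemma has_integral_gaussian:
  fixes b :: real
  assumes "0 < b"
  shows "((\<lambda>x. exp (- b * x\<^sup>2)) has_integral sqrt (pi / b)) UNIV"
proof -
  define \<sigma> where "\<sigma> = sqrt (1 / (2 * b))"
  have sig: "0 < \<sigma>" "\<sigma>\<^sup>2 = 1 / (2 * b)" using assms by (auto simp: \<sigma>_def)
  have "((\<lambda>x. normal_density 0 \<sigma> x) has_integral 1) UNIV"
    using has_integral_integral_lborel[OF integrable_normal_density[OF sig(1), of 0]] sig
    by simp
  then have "((\<lambda>x. sqrt (pi / b) * normal_density 0 \<sigma> x) has_integral (sqrt (pi / b) * 1)) UNIV"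
    by (rule has_integral_mult_right)
  moreover have "sqrt (pi / b) * normal_density 0 \<sigma> x = exp (- b * x\<^sup>2)" for x
  proof -
    have "2 * pi * \<sigma>\<^sup>2 = pi / b" unfolding sig by simp
    moreover have "- (x - 0)\<^sup>2 / (2 * \<sigma>\<^sup>2) = - b * x\<^sup>2" unfolding sig using assms by (simp add: field_simps)
    moreover have "sqrt (pi / b) \<noteq> 0" using assms by simp
    ultimately show ?thesis unfolding normal_density_def by (simp only: times_divide_eq_left times_divide_eq_right) simp
  qed
  ultimately show ?thesis by simp
qed

lemma has_integral_exp_int:
  fixes k :: int
  shows "((\<lambda>\<theta>. exp (\<i> * of_int k * of_real \<theta>)) has_integral (if k = 0 then of_real (2 * pi) else 0)) {-pi..pi}"
proof (cases "k = 0")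
  case True
  then show ?thesis using has_integral_const_real[of "1 :: complex" "- pi" pi] by (simp add: scaleR_conv_of_real)
next
  case False
  define c where "c = \<i> * of_int k"
  have c: "c \<noteq> 0" using False by (simp add: c_def)
  have "((\<lambda>\<theta>. exp (c * of_real \<theta>)) has_integral (exp (c * of_real pi) / c - exp (c * of_real (- pi)) / c)) {-pi..pi}"
  proof (rule fundamental_theorem_of_calculus)
    show "((\<lambda>\<theta>. exp (c * of_real \<theta>) / c) has_vector_derivative exp (c * of_real x)) (at x within {-pi..pi})" for x
    proof -
      have "((\<lambda>w. exp (c * w) / c) has_field_derivative exp (c * of_real x)) (at (of_real x))"
        using c by (auto intro!: derivative_eq_intros)
      then show ?thesis
        by (rule has_vector_derivative_real_field[THEN has_vector_derivative_at_within])
    qed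
  qed simp
  moreover have "exp (c * of_real pi) = exp (c * of_real (- pi))"
  proof -
    have "exp (c * of_real pi) = exp (c * of_real (- pi) + of_int (2 * k) * of_real pi * \<i>)"
      by (simp add: c_def algebra_simps)
    also have "\<dots> = exp (c * of_real (- pi))"
      by (simp add: exp_eq)
    finally show ?thesis .
  qed
  ultimately show ?thesis using False by (simp add: c_def)
qed

text \<open>Cauchy's formula on the circle |q| = e ^ (- s), obtained by integrating the uniformly
  convergent series term by term.\<close>

lemma partition_count_integral:
  assumes s: "0 < s"
  shows "((\<lambda>\<theta>. exp (lam (Complex s \<theta>) + of_nat n * Complex s \<theta>)) has_integral of_real (2 * pi * partition_count n)) {-pi..pi}"
proof -
  define f where "f N \<theta> = (\<Sum>k<N. of_nat (partition_count k) * exp (- Complex s \<theta>) ^ k * exp (of_nat n * Complex s \<theta>))" for N \<theta>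
  define g where "g \<theta> = exp (lam (Complex s \<theta>) + of_nat n * Complex s \<theta>)" for \<theta>
  have cplx: "Complex s \<theta> = of_real s + \<i> * of_real \<theta>" for \<theta> by (simp add: complex_eq_iff)
  have gsum: "g \<theta> = (\<Sum>k. of_nat (partition_count k) * exp (- Complex s \<theta>) ^ k * exp (of_nat n * Complex s \<theta>))" for \<theta>
  proof -
    have "norm (exp (- Complex s \<theta>)) < 1" using s by simp
    then have "summable (\<lambda>k. of_nat (partition_count k) * exp (- Complex s \<theta>) ^ k)"
      by (rule summable_norm_cancel[OF summable_norm_partition_count])
    then show ?thesis
      using partition_count_gf_eq_exp_lam[of "Complex s \<theta>"] s
      by (simp add: g_def exp_add suminf_mult2[symmetric])
  qed
  have "uniform_limit {-pi..pi} f g sequentially"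
    unfolding f_def[abs_def] gsum[abs_def]
  proof (rule Weierstrass_m_test)
    show "norm (of_nat (partition_count k) * exp (- Complex s \<theta>) ^ k * exp (of_nat n * Complex s \<theta>))
      \<le> partition_count k * exp (- s) ^ k * exp (n * s)" for k \<theta>
      by (simp add: norm_mult norm_power)
    show "summable (\<lambda>k. partition_count k * exp (- s) ^ k * exp (n * s))"
      using s by (intro summable_mult2 summable_partition_count) auto
  qed
  moreover have "continuous_on {-pi..pi} (f N)" for N
    unfolding f_def[abs_def] cplx by (intro continuous_intros)
  ultimately obtain I J where IJ: "\<And>N. (f N has_integral I N) {-pi..pi}" "(g has_integral J) {-pi..pi}" "I \<longlonglongrightarrow> J"
    by (rule uniform_limit_integral[where F = sequentially]) auto
  have tm: "of_nat (partition_count k) * exp (- Complex s \<theta>) ^ k * exp (of_nat n * Complex s \<theta>)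
    = of_real (partition_count k * exp ((real n - real k) * s)) * exp (\<i> * of_int (int n - int k) * of_real \<theta>)" for k \<theta>
  proof -
    have "exp (- Complex s \<theta>) ^ k * exp (of_nat n * Complex s \<theta>) = exp (of_nat k * (- Complex s \<theta>) + of_nat n * Complex s \<theta>)"
      by (simp only: exp_of_nat_mult exp_add)
    also have "of_nat k * (- Complex s \<theta>) + of_nat n * Complex s \<theta>
       = of_real ((real n - real k) * s) + \<i> * of_int (int n - int k) * of_real \<theta>"
      unfolding cplx by (simp add: algebra_simps)
    also have "exp \<dots> = of_real (exp ((real n - real k) * s)) * exp (\<i> * of_int (int n - int k) * of_real \<theta>)"
      by (simp only: exp_add exp_of_real)
    finally show ?thesis by (simp add: mult.assoc)
  qed
  have "I N = of_real (2 * pi * partition_count n)" if N: "n < N" for N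
  proof -
    have "(f N has_integral (\<Sum>k<N. of_real (partition_count k * exp ((real n - real k) * s)) * (if int n - int k = 0 then of_real (2 * pi) else 0))) {-pi..pi}"
      unfolding f_def[abs_def] tm
      by (intro has_integral_sum has_integral_mult_right has_integral_exp_int) auto
    also have "(\<Sum>k<N. of_real (partition_count k * exp ((real n - real k) * s)) * (if int n - int k = 0 then of_real (2 * pi) else 0))
       = (\<Sum>k\<in>{n}. of_real (partition_count k * exp ((real n - real k) * s)) * of_real (2 * pi) :: complex)"
      by (rule sum.mono_neutral_cong_right) (use N in auto)
    finally show ?thesis using has_integral_unique[OF IJ(1)] by (simp add: mult.commute)
  qed
  then have "eventually (\<lambda>N. I N = of_real (2 * pi * partition_count n)) sequentially"
    using eventually_gt_at_top[of n] by (rule eventually_mono[rotated])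
  then have "I \<longlonglongrightarrow> of_real (2 * pi * partition_count n)" by (rule tendsto_eventually)
  then have "J = of_real (2 * pi * partition_count n)" using IJ(3) LIMSEQ_unique by blast
  then show ?thesis using IJ(2) by (simp add: g_def[abs_def])
qed

text \<open>Integrand and Gaussian are extended to the whole line and compared pointwise, so that
  completing the Gaussian integral is no separate step. The dominating \<open>H\<close> is a wider
  Gaussian, from the major arc, plus a tiny constant on [-pi, pi], from the minor one.\<close>

lemma partition_count_approx:
  fixes n :: nat and C K :: real
  assumes K: "0 < K" and rem: "\<And>z. z \<in> sector \<Longrightarrow> 0 < Re z \<Longrightarrow> norm z \<le> 2 \<Longrightarrow> norm (rem z - of_real C) \<le> K * norm z"
    and s: "0 < s" "s \<le> 1"
  defines "X \<equiv> pi\<^sup>2 / (6 * s)"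
  assumes n: "real n = X / s"
  defines "M \<equiv> exp (2 * X + C) * sqrt s"
    and "K1 \<equiv> exp (1 + 4 * K) * (1536 + (4 * K + 48 * K\<^sup>2)) + 2"
    and "b \<equiv> X / s\<^sup>2"
  shows "\<bar>2 * pi * partition_count n - M * sqrt (pi / b)\<bar>
     \<le> M * (K1 / X * sqrt (8 * pi / b) + 2 * pi * (exp K * exp (- X / 80)))"
proof -
  define g where "g \<theta> = (if \<theta> \<in> {-pi..pi} then Re (exp (lam (Complex s \<theta>) + of_real (X / s) * Complex s \<theta>)) else 0)" for \<theta>
  have X: "0 < X" using s by (simp add: X_def)
  have b: "0 < b" using s X by (simp add: b_def)
  have M: "0 < M" using s by (simp add: M_def)
  have "complex_of_real (X / s) = of_nat n" using n by (metis of_real_of_nat_eq)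
  then have "((\<lambda>\<theta>. Re (exp (lam (Complex s \<theta>) + of_real (X / s) * Complex s \<theta>))) has_integral (2 * pi * partition_count n)) {-pi..pi}"
    using has_integral_linear[OF partition_count_integral[OF s(1), of n] bounded_linear_Re]
    by (simp add: o_def)
  then have g: "(g has_integral (2 * pi * partition_count n)) UNIV"
    unfolding g_def[abs_def] by (subst has_integral_restrict_UNIV)
  define D where "D \<theta> = g \<theta> - M * exp (- b * \<theta>\<^sup>2)" for \<theta>
  have D: "(D has_integral (2 * pi * partition_count n - M * sqrt (pi / b))) UNIV"
    unfolding D_def[abs_def] using b
    by (intro has_integral_diff g has_integral_mult_right has_integral_gaussian)
  define H where "H \<theta> = M * (K1 / X * exp (- (b / 8) * \<theta>\<^sup>2) + (if \<theta> \<in> {-pi..pi} then exp K * exp (- X / 80) else 0))" for \<theta>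
  have H: "(H has_integral (M * (K1 / X * sqrt (pi / (b / 8)) + 2 * pi * (exp K * exp (- X / 80))))) UNIV"
  proof -
    have "((\<lambda>\<theta>. exp K * exp (- X / 80)) has_integral 2 * pi * (exp K * exp (- X / 80))) {-pi..pi}"
      using has_integral_const_real[of "exp K * exp (- X / 80)" "- pi" pi] by simp
    then have "((\<lambda>\<theta>. if \<theta> \<in> {-pi..pi} then exp K * exp (- X / 80) else 0) has_integral 2 * pi * (exp K * exp (- X / 80))) UNIV"
      by (subst has_integral_restrict_UNIV)
    then show ?thesis
      unfolding H_def[abs_def] using b
      by (intro has_integral_mult_right has_integral_add has_integral_gaussian) auto
  qed
  have K1: "0 \<le> K1 - 2" using K by (simp add: K1_def)
  have DH: "\<bar>D \<theta>\<bar> \<le> H \<theta>" for \<theta>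
  proof (cases "\<bar>\<theta>\<bar> \<le> s")
    case True
    define t where "t = \<theta> / s"
    have t: "\<bar>t\<bar> \<le> 1" "\<theta> = s * t" using s True by (auto simp: t_def)
    have th: "\<theta> \<in> {-pi..pi}" using True s pi_gt3 by auto
    have bt: "b * \<theta>\<^sup>2 = X * t\<^sup>2" using s by (simp add: b_def t(2) power_mult_distrib)
    have "\<bar>D \<theta>\<bar> = \<bar>Re (exp (lam (Complex s (s * t)) + of_real (X / s) * Complex s (s * t))) - M * exp (- X * t\<^sup>2)\<bar>"
      using th bt by (simp add: D_def g_def t(2)[symmetric])
    also have "\<dots> \<le> M * (exp (1 + 4 * K) * (1536 + (4 * K + 48 * K\<^sup>2)) / X * exp (- X * t\<^sup>2 / 8))"
      unfolding M_def X_def using major_arc[OF K rem s t(1)] by simp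
    also have "\<dots> \<le> M * (K1 / X * exp (- X * t\<^sup>2 / 8) + exp K * exp (- X / 80))"
      using M X by (intro mult_left_mono add_increasing2 mult_right_mono divide_right_mono) (auto simp: K1_def)
    also have "\<dots> = H \<theta>"
    proof -
      have "- X * t\<^sup>2 / 8 = - (b / 8) * \<theta>\<^sup>2" using bt by simp
      then show ?thesis using th unfolding H_def by simp
    qed
    finally show ?thesis .
  next
    case False
    have gb: "\<bar>g \<theta>\<bar> \<le> M * (if \<theta> \<in> {-pi..pi} then exp K * exp (- X / 80) else 0)"
    proof (cases "\<theta> \<in> {-pi..pi}")
      case True
      then have "\<bar>g \<theta>\<bar> \<le> norm (exp (lam (Complex s \<theta>) + of_real (X / s) * Complex s \<theta>))"
        unfolding g_def by (simp only: if_True abs_Re_le_cmod)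
      also have "\<dots> \<le> M * (exp K * exp (- X / 80))"
        unfolding M_def X_def by (rule minor_arc[OF K rem s]) (use True False in auto)
      finally show ?thesis using True by simp
    next
      case out: False
      then have "g \<theta> = 0" by (simp only: g_def if_False)
      then show ?thesis using out by (simp only: if_False)
    qed
    have "s\<^sup>2 \<le> \<theta>\<^sup>2" using False s by (subst abs_le_square_iff[symmetric]) simp
    then have "b * s\<^sup>2 \<le> b * \<theta>\<^sup>2" using b by (intro mult_left_mono) auto
    then have bt: "X \<le> b * \<theta>\<^sup>2" using s by (simp add: b_def)
    have "exp (- b * \<theta>\<^sup>2) \<le> exp (- (b / 8) * \<theta>\<^sup>2) * exp (- (X / 2))"
      using bt X by (simp flip: exp_add)
    \<comment> \<open>The Gaussian beyond the major arc is absorbed by the wider one at the price of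
      the factor 2 / X, for which the summand 2 of \<open>K1\<close> is reserved.\<close>
    also have "exp (- (X / 2)) \<le> 2 / X"
    proof -
      have "X / 2 \<le> exp (X / 2)" using exp_ge_add_one_self[of "X / 2"] by linarith
      then have "inverse (exp (X / 2)) \<le> inverse (X / 2)" using X by (intro le_imp_inverse_le) auto
      then show ?thesis by (simp add: exp_minus)
    qed
    also have "2 / X \<le> K1 / X" using X K1 by (intro divide_right_mono) auto
    finally have "exp (- b * \<theta>\<^sup>2) \<le> K1 / X * exp (- (b / 8) * \<theta>\<^sup>2)" by (simp add: mult.commute)
    then have "M * exp (- b * \<theta>\<^sup>2) \<le> M * (K1 / X * exp (- (b / 8) * \<theta>\<^sup>2))"
      using M by (intro mult_left_mono) auto
    moreover have "\<bar>D \<theta>\<bar> \<le> \<bar>g \<theta>\<bar> + M * exp (- b * \<theta>\<^sup>2)"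
      using M abs_triangle_ineq4[of "g \<theta>" "M * exp (- b * \<theta>\<^sup>2)"] by (simp add: D_def abs_mult)
    ultimately show ?thesis using gb unfolding H_def distrib_left by linarith
  qed
  have "2 * pi * partition_count n - M * sqrt (pi / b) \<le> M * (K1 / X * sqrt (pi / (b / 8)) + 2 * pi * (exp K * exp (- X / 80)))"
    by (rule has_integral_le[OF D H]) (use DH abs_le_D1 in blast)
  moreover have "- (2 * pi * partition_count n - M * sqrt (pi / b)) \<le> M * (K1 / X * sqrt (pi / (b / 8)) + 2 * pi * (exp K * exp (- X / 80)))"
    by (rule has_integral_le[OF has_integral_neg[OF D] H]) (use DH abs_le_D2 in blast)
  ultimately show ?thesis by (simp add: mult.commute)
qed


theorem partition_count_asymp:
  "\<exists>A K. 0 < A \<and> 0 < K \<and> (\<forall>n\<ge>2.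
     \<bar>partition_count n - A / real n * exp (2 * pi * sqrt (real n) / sqrt 6)\<bar>
       \<le> K / sqrt (real n) * (A / real n * exp (2 * pi * sqrt (real n) / sqrt 6)))"
proof -
  obtain C K where K: "0 < K"
    and rem: "\<And>z. z \<in> sector \<Longrightarrow> 0 < Re z \<Longrightarrow> norm z \<le> 2 \<Longrightarrow> norm (rem z - of_real C) \<le> K * norm z"
    using rem_limit by blast
  define K1 where "K1 = exp (1 + 4 * K) * (1536 + (4 * K + 48 * K\<^sup>2)) + 2"
  define A where "A = exp C * sqrt (6 / pi) * (pi\<^sup>2 / 6) / (2 * pi)"
  define K2 where "K2 = 3 * K1 + 2 * pi * exp K * 240 ^ 3"
  have K1: "0 < K1" using K by (auto simp: K1_def intro!: add_nonneg_pos mult_nonneg_nonneg add_nonneg_nonneg)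
  have A: "0 < A" by (simp add: A_def)
  have K2: "0 < K2" using K1 by (auto simp: K2_def intro!: add_pos_pos)
  show ?thesis
  proof (rule exI[of _ A], rule exI[of _ K2], intro conjI A K2 allI impI)
    fix n :: nat assume n: "2 \<le> n"
    \<comment> \<open>The saddle point: \<open>s\<close> minimises pi ^ 2 / (6 s) + n s, which means
      n = X / s. It is at most 1 because n >= 2 and pi ^ 2 < 12.\<close>
    define s where "s = pi / sqrt (6 * real n)"
    have s2: "s\<^sup>2 = pi\<^sup>2 / (6 * real n)" using n by (simp add: s_def power_divide)
    have s0: "0 < s" using n by (simp add: s_def)
    have "s\<^sup>2 \<le> 1\<^sup>2" unfolding s2 using n pi_squared_bounds by (simp add: divide_le_eq)
    then have s1: "s \<le> 1" by (rule power2_le_imp_le) simp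
    define X where "X = pi\<^sup>2 / (6 * s)"
    have nX: "real n = X / s"
    proof -
      have "X / s = pi\<^sup>2 / (6 * s\<^sup>2)" by (simp add: X_def power2_eq_square)
      also have "\<dots> = real n" unfolding s2 using n by simp
      finally show ?thesis by simp
    qed
    have X_eq: "X = pi * sqrt (real n) / sqrt 6"
    proof -
      have "X = real n * s" using nX s0 by simp
      also have "\<dots> = pi * (real n / sqrt (real n)) / sqrt 6" by (simp add: s_def real_sqrt_mult mult_ac)
      also have "real n / sqrt (real n) = sqrt (real n)" by (simp add: real_div_sqrt)
      finally show ?thesis .
    qed
    have X1: "1 \<le> X" unfolding X_def using s0 s1 pi_squared_bounds by (subst pos_le_divide_eq) auto
    define M where "M = exp (2 * X + C) * sqrt s"
    define b where "b = X / s\<^sup>2"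
    define G where "G = M * sqrt (pi / b)"
    have b0: "0 < b" using s0 X1 by (simp add: b_def)
    have main: "\<bar>2 * pi * partition_count n - G\<bar>
       \<le> M * (K1 / X * sqrt (8 * pi / b) + 2 * pi * (exp K * exp (- X / 80)))"
      unfolding G_def M_def b_def K1_def X_def
      by (rule partition_count_approx[OF K rem s0 s1]) (use nX X_def in auto)
    have G_eq: "G = 2 * pi * (A / real n * exp (2 * pi * sqrt (real n) / sqrt 6))"
    proof -
      have "s * (pi / b) = 6 / pi * (s\<^sup>2)\<^sup>2"
        using s0 unfolding b_def X_def by (simp add: field_simps power2_eq_square)
      then have "sqrt s * sqrt (pi / b) = sqrt (6 / pi) * s\<^sup>2"
        by (metis abs_power2 real_sqrt_abs real_sqrt_mult)
      then have "G = exp (2 * X + C) * (sqrt (6 / pi) * s\<^sup>2)"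
        by (simp add: G_def M_def mult.assoc)
      also have "\<dots> = 2 * pi * (A / real n * exp (2 * X))"
        unfolding s2 exp_add by (simp add: A_def)
      also have "2 * X = 2 * pi * sqrt (real n) / sqrt 6" by (simp add: X_eq)
      finally show ?thesis .
    qed
    have M0: "0 < M" using s0 by (simp add: M_def)
    have G0: "0 < G" using M0 b0 by (simp add: G_def)
    \<comment> \<open>The minor arc was measured against \<open>M\<close>, not against the main term
      \<open>G\<close>; the loss is only a power of \<open>X\<close>.\<close>
    have MG: "M \<le> G * X\<^sup>2"
    proof -
      have sX: "s = pi\<^sup>2 / (6 * X)" using s0 unfolding X_def by (simp add: field_simps)
      have "b = 36 / (pi\<^sup>2 * pi\<^sup>2) * X ^ 3"
        using X1 unfolding b_def sX by (simp add: field_simps power2_eq_square power3_eq_cube)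
      also have "36 / (pi\<^sup>2 * pi\<^sup>2) \<le> 1"
      proof -
        have "9 * 9 \<le> pi\<^sup>2 * pi\<^sup>2" using pi_squared_bounds by (intro mult_mono) auto
        then show ?thesis by (subst divide_le_eq_1_pos) auto
      qed
      finally have "b \<le> 1 * X ^ 3" using X1 by (simp add: mult_right_mono)
      also have "X ^ 3 \<le> X ^ 4" using X1 by (intro power_increasing) auto
      finally have "b \<le> (X\<^sup>2)\<^sup>2" by simp
      also have "\<dots> \<le> pi * (X\<^sup>2)\<^sup>2" using pi_gt3 by (simp add: mult_right_mono[of 1 pi, simplified])
      finally have "1 \<le> (pi / b) * (X\<^sup>2)\<^sup>2" using b0 by (simp add: field_simps)
      then have "sqrt 1 \<le> sqrt ((pi / b) * (X\<^sup>2)\<^sup>2)" by (subst real_sqrt_le_iff)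
      then have "1 \<le> sqrt (pi / b) * X\<^sup>2" 
        by (simp only: real_sqrt_mult real_sqrt_abs abs_power2 real_sqrt_one)
      then have "M * 1 \<le> M * (sqrt (pi / b) * X\<^sup>2)" using M0 by (intro mult_left_mono) auto
      then show ?thesis by (simp add: G_def mult.assoc)
    qed
    have 1: "M * (K1 / X * sqrt (8 * pi / b)) \<le> G * (3 * K1 / X)"
    proof -
      have "sqrt (8 * pi / b) = sqrt 8 * sqrt (pi / b)" by (simp flip: real_sqrt_mult)
      then have "M * (K1 / X * sqrt (8 * pi / b)) = G * (K1 / X) * sqrt 8"
        by (simp add: G_def)
      also have "sqrt 8 \<le> 3" by (rule real_le_lsqrt) auto
      then have "G * (K1 / X) * sqrt 8 \<le> G * (K1 / X) * 3"
        using G0 K1 X1 by (intro mult_left_mono) auto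
      finally show ?thesis by (simp add: mult_ac)
    qed
    \<comment> \<open>From the cube of X / 240 <= e ^ (X / 240): two of the three powers of
      \<open>X\<close> pay for \<open>MG\<close>, the third is the error 1 / X.\<close>
    have 2: "M * (2 * pi * (exp K * exp (- X / 80))) \<le> G * (2 * pi * exp K * 240 ^ 3 / X)"
    proof -
      have "X / 240 \<le> exp (X / 240)" using exp_ge_add_one_self[of "X / 240"] by linarith
      then have "(X / 240) ^ 3 \<le> exp (X / 240) ^ 3" using X1 by (intro power_mono) auto
      also have "exp (X / 240) ^ 3 = exp (X / 80)" by (simp flip: exp_of_nat_mult)
      finally have "inverse (exp (X / 80)) \<le> inverse ((X / 240) ^ 3)"
        using X1 by (intro le_imp_inverse_le) auto
      then have e: "exp (- X / 80) \<le> 240 ^ 3 / X ^ 3" by (simp add: exp_minus power_divide)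
      have "M * (2 * pi * (exp K * exp (- X / 80))) \<le> (G * X\<^sup>2) * (2 * pi * (exp K * (240 ^ 3 / X ^ 3)))"
        using MG e M0 G0 by (intro mult_mono mult_left_mono) auto
      also have "\<dots> = G * (2 * pi * exp K * 240 ^ 3 / X)"
        using X1 by (simp add: field_simps power2_eq_square power3_eq_cube)
      finally show ?thesis .
    qed
    have "\<bar>2 * pi * partition_count n - G\<bar> \<le> G * (3 * K1 / X) + G * (2 * pi * exp K * 240 ^ 3 / X)"
      using main 1 2 unfolding distrib_left by linarith
    also have "\<dots> = K2 / X * G" using X1 by (simp add: K2_def field_simps)
    also have "\<dots> \<le> K2 / sqrt (real n) * G"
    proof -
      have "sqrt (real n) * sqrt 6 \<le> sqrt (real n) * pi" using sqrt_6_le_pi by (intro mult_left_mono) auto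
      then have "sqrt (real n) \<le> X" unfolding X_eq by (simp add: field_simps)
      then show ?thesis using K2 G0 n X1 by (intro mult_right_mono divide_left_mono) auto
    qed
    finally have fin: "\<bar>2 * pi * partition_count n - G\<bar> \<le> K2 / sqrt (real n) * G" .
    define P where "P = A / real n * exp (2 * pi * sqrt (real n) / sqrt 6)"
    have "2 * pi * \<bar>partition_count n - P\<bar> = \<bar>2 * pi * partition_count n - G\<bar>"
      unfolding G_eq P_def[symmetric] by (simp add: abs_mult flip: right_diff_distrib)
    also have "\<dots> \<le> 2 * pi * (K2 / sqrt (real n) * P)"
      using fin by (simp add: G_eq P_def mult_ac)
    finally show "\<bar>partition_count n - A / real n * exp (2 * pi * sqrt (real n) / sqrt 6)\<bar>
       \<le> K2 / sqrt (real n) * (A / real n * exp (2 * pi * sqrt (real n) / sqrt 6))"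
      unfolding P_def[symmetric] by (subst (asm) mult_le_cancel_left_pos) auto
  qed
qed

section \<open>Ratios of partition numbers\<close>

lemma eventually_real_ge: "\<forall>\<^sub>F N :: nat in sequentially. c \<le> real N"
  using filterlim_real_sequentially unfolding filterlim_at_top by blast

lemma abs_ln_one_plus_le:
  fixes e :: real
  assumes "\<bar>e\<bar> \<le> 1 / 2"
  shows "\<bar>ln (1 + e)\<bar> \<le> 2 * \<bar>e\<bar>"
proof -
  have "\<bar>ln (1 + e) - e\<bar> \<le> 2 * e\<^sup>2" using assms by (rule abs_ln_one_plus_x_minus_x_bound)
  also have "e\<^sup>2 = \<bar>e\<bar> * \<bar>e\<bar>" by (simp add: power2_eq_square)
  also have "2 * (\<bar>e\<bar> * \<bar>e\<bar>) \<le> 2 * (\<bar>e\<bar> * (1 / 2))" using assms by (intro mult_left_mono) auto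
  finally show ?thesis by linarith
qed

text \<open>For r = sqrt N and q = sqrt (N - x) one has r - q = x / (2 r) + (r - q) ^ 2 / (2 r)
  exactly, and r - q <= x / r.\<close>

lemma sqrt_diff_bounds:
  fixes N x :: real
  assumes "0 < N" "0 \<le> x" "x \<le> N"
  shows "x / (2 * sqrt N) \<le> sqrt N - sqrt (N - x)"
    and "sqrt N - sqrt (N - x) \<le> x / (2 * sqrt N) + x\<^sup>2 / (2 * (N * sqrt N))"
proof -
  define r q where "r = sqrt N" and "q = sqrt (N - x)"
  have r: "0 < r" "0 \<le> q" "q \<le> r" "r\<^sup>2 = N" "q\<^sup>2 = N - x" using assms by (auto simp: r_def q_def)
  have x: "x = (r - q) * (r + q)" using r by (simp add: power2_eq_square algebra_simps)
  have "(r - q) * (r + q) \<le> (r - q) * (2 * r)" using r by (intro mult_left_mono) auto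
  then show le: "x / (2 * sqrt N) \<le> sqrt N - sqrt (N - x)"
    unfolding r_def[symmetric] q_def[symmetric] using r x by (subst pos_divide_le_eq) auto
  have "r - q \<le> x / r"
  proof -
    have "(r - q) * r \<le> (r - q) * (r + q)" using r by (intro mult_left_mono) auto
    then show ?thesis using r x by (subst pos_le_divide_eq) auto
  qed
  then have "(r - q)\<^sup>2 \<le> (x / r)\<^sup>2" using r by (intro power_mono) auto
  then have *: "(r - q)\<^sup>2 / (2 * r) \<le> x\<^sup>2 / (2 * (N * r))"
  proof -
    have "(r - q)\<^sup>2 / (2 * r) \<le> (x / r)\<^sup>2 / (2 * r)"
      using \<open>(r - q)\<^sup>2 \<le> (x / r)\<^sup>2\<close> r by (intro divide_right_mono) auto
    also have "\<dots> = x\<^sup>2 / (2 * (N * r))" unfolding r(4)[symmetric] by (simp add: power_divide mult_ac)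
    finally show ?thesis .
  qed
  have "r - q = x / (2 * r) + (r - q)\<^sup>2 / (2 * r)"
    using r(1) unfolding x by (simp add: field_simps power2_eq_square)
  then show "sqrt N - sqrt (N - x) \<le> x / (2 * sqrt N) + x\<^sup>2 / (2 * (N * sqrt N))"
    unfolding r_def[symmetric] q_def[symmetric] using * by linarith
qed

lemma partition_count_pos: "0 < partition_count n"
proof -
  have "replicate n 1 \<in> bounded_partitions n n"
    by (auto simp: bounded_partitions_def sum_list_replicate)
  then have "0 < card (bounded_partitions n n)"
    using finite_bounded_partitions by (metis card_gt_0_iff empty_iff)
  then show ?thesis by (simp add: card_bounded_partitions_eq)
qed

text \<open>In the difference of logarithms \<open>A\<close> cancels. The three error terms come
  from the relative error of the asymptotic formula, from its factor 1 / n, and from the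
  second-order term of the square root.\<close>

lemma partition_count_ln_ratio:
  "\<exists>C>(0 :: real). \<forall>\<^sub>F N :: nat in sequentially. \<forall>x::nat. 2 * x \<le> N \<longrightarrow>
     \<bar>ln (partition_count (N - x)) - ln (partition_count N) + pi / sqrt (6 * real N) * x\<bar>
       \<le> C * (1 / sqrt N + x / N + (real x)\<^sup>2 / (N * sqrt N))"
  (is "\<exists>C>_. \<forall>\<^sub>F N in _. ?P C N")
proof -
  obtain A K where A: "0 < A" and K: "0 < K"
    and asy: "\<And>n. 2 \<le> n \<Longrightarrow> \<bar>partition_count n - A / real n * exp (2 * pi * sqrt (real n) / sqrt 6)\<bar>
       \<le> K / sqrt (real n) * (A / real n * exp (2 * pi * sqrt (real n) / sqrt 6))"
    using partition_count_asymp by blast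
  define c where "c = 2 * pi / sqrt 6"
  have c0: "0 < c" by (simp add: c_def)
  have lnp: "\<bar>ln (partition_count n) - (ln A - ln n + c * sqrt n)\<bar> \<le> 2 * (K / sqrt n)"
    if n: "2 \<le> n" "4 * K\<^sup>2 \<le> n" for n
  proof -
    define G where "G = A / real n * exp (2 * pi * sqrt (real n) / sqrt 6)"
    have G: "0 < G" using A n by (simp add: G_def)
    define e where "e = partition_count n / G - 1"
    have "e * G = partition_count n - G" using G by (simp add: e_def field_simps)
    then have "\<bar>e\<bar> * G \<le> K / sqrt n * G" using asy[OF n(1)] G unfolding G_def[symmetric] by (metis abs_mult abs_of_pos)
    then have e1: "\<bar>e\<bar> \<le> K / sqrt n" by (rule mult_right_le_imp_le) (rule G)
    have "2 * K \<le> sqrt n"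
      by (rule real_le_rsqrt) (use n in \<open>simp add: power_mult_distrib\<close>)
    then have "K / sqrt n \<le> 1 / 2" using n by (simp add: field_simps)
    then have e: "\<bar>ln (1 + e)\<bar> \<le> 2 * \<bar>e\<bar>" using e1 by (intro abs_ln_one_plus_le) linarith
    have "partition_count n = G * (1 + e)" using G by (simp add: e_def)
    moreover have "0 < 1 + e" using G partition_count_pos[of n] by (simp add: e_def)
    ultimately have "ln (partition_count n) = ln G + ln (1 + e)" using G by (simp add: ln_mult)
    moreover have "ln G = ln A - ln n + c * sqrt n"
      unfolding G_def using A n by (simp add: ln_mult ln_div c_def)
    ultimately show ?thesis using e e1 by linarith
  qed
  define C where "C = 2 * K + 4 * K + 2 + c"
  \<comment> \<open>\<open>lnp\<close> wants 4 K ^ 2 as a lower bound and is also applied at N - x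
    >= N / 2, hence 8 K ^ 2.\<close>
  have "\<forall>\<^sub>F N :: nat in sequentially. (4 :: nat) \<le> N \<and> 8 * K\<^sup>2 \<le> N"
    by (intro eventually_conj eventually_ge_at_top eventually_real_ge)
  then have "\<forall>\<^sub>F N in sequentially. ?P C N"
  proof (rule eventually_mono, intro allI impI)
    fix N x :: nat assume N: "4 \<le> N \<and> 8 * K\<^sup>2 \<le> N" and x: "2 * x \<le> N"
    define n where "n = N - x"
    have n: "real n = real N - real x" using x by (simp add: n_def)
    have n2: "2 \<le> n" "4 * K\<^sup>2 \<le> n" using N x n by auto
    have l1: "\<bar>ln (partition_count n) - (ln A - ln n + c * sqrt n)\<bar> \<le> 2 * (K / sqrt n)" by (rule lnp[OF n2])
    have l2: "\<bar>ln (partition_count N) - (ln A - ln N + c * sqrt N)\<bar> \<le> 2 * (K / sqrt N)"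
      by (rule lnp) (use N zero_le_power2[of K] in linarith)+
    have "K / sqrt n \<le> 2 * (K / sqrt N)"
    proof -
      have "sqrt N \<le> sqrt (4 * n)" using n x by (intro real_sqrt_le_mono) auto
      then have "sqrt N \<le> 2 * sqrt n" by (simp add: real_sqrt_mult)
      then have "K * sqrt N \<le> K * (2 * sqrt n)" using K by (intro mult_left_mono) auto
      then show ?thesis using n2 N by (simp add: field_simps)
    qed
    moreover have "\<bar>ln N - ln n\<bar> \<le> 2 * (x / N)"
    proof -
      have "ln n = ln N + ln (1 + - (x / N))"
      proof -
        have "N * (1 + - (x / N)) = real N - real x" using N by (simp add: right_diff_distrib)
        then have "real n = N * (1 + - (x / N))" using n by simp
        moreover have "0 < 1 + - (real x / N)" using N x by (simp add: field_simps)
        moreover have "0 < real N" using N by simp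
        ultimately show ?thesis by (simp only: ln_mult_pos)
      qed
      moreover have "\<bar>ln (1 + - (real x / N))\<bar> \<le> 2 * \<bar>- (real x / N)\<bar>"
        using N x by (intro abs_ln_one_plus_le) (simp add: field_simps)
      ultimately show ?thesis by simp
    qed
    moreover have "\<bar>c * sqrt n - c * sqrt N + pi / sqrt (6 * real N) * x\<bar> \<le> c * ((real x)\<^sup>2 / (N * sqrt N))"
    proof -
      have b: "x / (2 * sqrt N) \<le> sqrt N - sqrt n" "sqrt N - sqrt n \<le> x / (2 * sqrt N) + (real x)\<^sup>2 / (2 * (N * sqrt N))"
        using sqrt_diff_bounds[of "real N" "real x"] N x unfolding n by auto
      have "pi / sqrt (6 * real N) * x = c * (x / (2 * sqrt N))" by (simp add: c_def real_sqrt_mult)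
      then have "c * sqrt n - c * sqrt N + pi / sqrt (6 * real N) * x = c * (x / (2 * sqrt N) - (sqrt N - sqrt n))"
        by (simp add: algebra_simps)
      also have "\<bar>\<dots>\<bar> \<le> c * ((real x)\<^sup>2 / (2 * (N * sqrt N)))"
        unfolding abs_mult using b c0 by (intro mult_mono) auto
      also have "\<dots> \<le> c * ((real x)\<^sup>2 / (N * sqrt N))"
        using c0 N by (intro mult_left_mono divide_left_mono) auto
      finally show ?thesis .
    qed
    ultimately have "\<bar>ln (partition_count n) - ln (partition_count N) + pi / sqrt (6 * real N) * x\<bar>
      \<le> (2 * K + 4 * K) * (1 / sqrt N) + 2 * (x / N) + c * ((real x)\<^sup>2 / (N * sqrt N))"
      using l1 l2 by (simp add: distrib_right)
    also have "\<dots> \<le> C * (1 / sqrt N) + C * (x / N) + C * ((real x)\<^sup>2 / (N * sqrt N))"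
      using K c0 by (intro add_mono mult_right_mono) (auto simp: C_def)
    finally show "\<bar>ln (partition_count (N - x)) - ln (partition_count N) + pi / sqrt (6 * real N) * x\<bar>
       \<le> C * (1 / sqrt N + x / N + (real x)\<^sup>2 / (N * sqrt N))"
      by (simp only: n_def distrib_left)
  qed
  moreover have "0 < C" using K c0 by (simp add: C_def)
  ultimately show ?thesis by (intro exI[of _ C] conjI)
qed

text \<open>A crude bound for all \<open>x\<close>, for use where the exponential beats any power.
  Concavity of the square root gives the exact rate, and the factor \<open>N\<close> is the lost
  quotient of the factors 1 / n.\<close>

lemma pz_ratio_le:
  "\<exists>C>(0 :: real). \<forall>\<^sub>F N :: nat in sequentially. \<forall>x::nat.
     pz (int N - int x) / partition_count N \<le> C * N * exp (- (pi / sqrt (6 * real N) * x))"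
  (is "\<exists>C>_. \<forall>\<^sub>F N in _. ?P C N")
proof -
  obtain A K where A: "0 < A" and K: "0 < K"
    and asy: "\<And>n. 2 \<le> n \<Longrightarrow> \<bar>partition_count n - A / real n * exp (2 * pi * sqrt (real n) / sqrt 6)\<bar>
       \<le> K / sqrt (real n) * (A / real n * exp (2 * pi * sqrt (real n) / sqrt 6))"
    using partition_count_asymp by blast
  define c where "c = 2 * pi / sqrt 6"
  have c0: "0 < c" by (simp add: c_def)
  \<comment> \<open>The last two summands cover n = 0 and n = 1, where the asymptotic formula says
    nothing.\<close>
  define B where "B = A * (1 + K) + partition_count 0 + partition_count 1"
  have B: "0 < B" using A K by (auto simp: B_def intro!: add_pos_nonneg)
  have up: "partition_count n \<le> B * exp (c * sqrt n)" for n
  proof (cases "2 \<le> n")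
    case True
    define G where "G = A / real n * exp (2 * pi * sqrt (real n) / sqrt 6)"
    have G: "0 < G" "G \<le> A * exp (c * sqrt n)"
      using A True by (auto simp: G_def c_def divide_simps)
    have "K / sqrt n \<le> K / 1" using K True by (intro divide_left_mono) auto
    then have "K / sqrt n * G \<le> K * G" using G by (intro mult_right_mono) auto
    then have "partition_count n \<le> (1 + K) * G"
      using asy[OF True] unfolding G_def[symmetric] by (simp add: algebra_simps)
    also have "\<dots> \<le> (1 + K) * (A * exp (c * sqrt n))" using G K by (intro mult_left_mono) auto
    also have "\<dots> \<le> B * exp (c * sqrt n)" by (simp add: B_def algebra_simps)
    finally show ?thesis .
  next
    case False
    then have "partition_count n \<le> B * 1" using A K by (cases "n = 0") (auto simp: B_def numeral_2_eq_2 less_Suc_eq not_le)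
    also have "\<dots> \<le> B * exp (c * sqrt n)" using B c0 by (intro mult_left_mono) auto
    finally show ?thesis .
  qed
  define C where "C = B * (2 / A)"
  have "\<forall>\<^sub>F N :: nat in sequentially. (2 :: nat) \<le> N \<and> 4 * K\<^sup>2 \<le> N"
    by (intro eventually_conj eventually_ge_at_top eventually_real_ge)
  then have "\<forall>\<^sub>F N in sequentially. ?P C N"
  proof (eventually_elim, intro allI)
    fix N x :: nat assume N: "2 \<le> N \<and> 4 * K\<^sup>2 \<le> N"
    show "pz (int N - int x) / partition_count N \<le> C * N * exp (- (pi / sqrt (6 * real N) * x))"
    proof (cases "x \<le> N")
      case True
      define G where "G = A / real N * exp (2 * pi * sqrt (real N) / sqrt 6)"
      have G: "0 < G" using A N by (simp add: G_def)
      have "2 * K \<le> sqrt N"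
        by (rule real_le_rsqrt) (use N in \<open>simp add: power_mult_distrib\<close>)
      then have "K / sqrt N \<le> 1 / 2" using N by (simp add: field_simps)
      then have "K / sqrt N * G \<le> 1 / 2 * G" using G by (intro mult_right_mono) auto
      then have lo: "G / 2 \<le> partition_count N" using asy[of N] N unfolding G_def[symmetric] by linarith
      have "nat (int N - int x) = N - x" by linarith
      then have "pz (int N - int x) = partition_count (N - x)" using True by (simp add: pz_def)
      also have "\<dots> \<le> B * exp (c * sqrt (real N - real x))" using up[of "N - x"] True by (simp add: of_nat_diff)
      also have "\<dots> \<le> B * exp (c * sqrt N - pi / sqrt (6 * real N) * x)"
      proof -
        have "x / (2 * sqrt N) \<le> sqrt N - sqrt (real N - real x)"
          using sqrt_diff_bounds(1)[of "real N" "real x"] N True by simp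
        then have "c * (x / (2 * sqrt N)) \<le> c * (sqrt N - sqrt (real N - real x))" using c0 by (intro mult_left_mono) auto
        moreover have "pi / sqrt (6 * real N) * x = c * (x / (2 * sqrt N))" by (simp add: c_def real_sqrt_mult)
        ultimately show ?thesis using B by (simp add: algebra_simps)
      qed
      also have "\<dots> = C * N * exp (- (pi / sqrt (6 * real N) * x)) * (G / 2)"
      proof -
        have "G = A / real N * exp (c * sqrt N)" by (simp add: G_def c_def)
        moreover have "exp (c * sqrt N - pi / sqrt (6 * real N) * x) = exp (c * sqrt N) * exp (- (pi / sqrt (6 * real N) * x))"
          by (simp flip: exp_add)
        ultimately show ?thesis using A N by (simp add: C_def)
      qed
      also have "\<dots> \<le> C * N * exp (- (pi / sqrt (6 * real N) * x)) * partition_count N"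
        using lo A B by (intro mult_left_mono) (auto simp: C_def)
      finally show ?thesis using partition_count_pos[of N] by (subst pos_divide_le_eq) auto
    next
      case False
      then show ?thesis using A B by (simp add: pz_def C_def)
    qed
  qed
  moreover have "0 < C" using A B by (simp add: C_def)
  ultimately show ?thesis by (intro exI[of _ C] conjI)
qed

lemma pz_nonneg: "0 \<le> pz x"
  by (simp add: pz_def)

lemma abs_exp_minus_1_le:
  fixes y :: real
  assumes "\<bar>y\<bar> \<le> 1"
  shows "\<bar>exp y - 1\<bar> \<le> 3 * \<bar>y\<bar>"
proof -
  have "\<bar>exp y * cos 0 - 1\<bar> \<le> (\<bar>y\<bar> + 0\<^sup>2) * exp (max y 0)" by (rule exp_cos_minus_1_le)
  also have "\<dots> \<le> \<bar>y\<bar> * exp 1" using assms by (auto intro!: mult_left_mono)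
  also have "\<dots> \<le> \<bar>y\<bar> * 3" using exp_le by (intro mult_left_mono) auto
  finally show ?thesis by simp
qed

text \<open>Split at x = N ^ (11/20). Below, the largest error of the logarithm is x ^ 2 / N ^ (3/2)
  <= N ^ (- 2/5); above, ratio and exponential are both at most of order N e ^ (- N ^
  (1/20)).\<close>

lemma pz_ratio_approx:
  "\<exists>C>(0 :: real). \<forall>\<^sub>F N :: nat in sequentially. \<forall>x::nat.
     \<bar>pz (int N - int x) / partition_count N - exp (- (pi / sqrt (6 * real N) * x))\<bar> \<le> C * N powr (- 2 / 5)"
  (is "\<exists>C>_. \<forall>\<^sub>F N in _. ?P C N")
proof -
  obtain C1 :: real where C1: "0 < C1" and ev1: "\<forall>\<^sub>F N :: nat in sequentially. \<forall>x::nat. 2 * x \<le> N \<longrightarrow>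
     \<bar>ln (partition_count (N - x)) - ln (partition_count N) + pi / sqrt (6 * real N) * x\<bar>
       \<le> C1 * (1 / sqrt N + x / N + (real x)\<^sup>2 / (N * sqrt N))"
    using partition_count_ln_ratio by (elim exE conjE) (rule that)
  obtain C2 :: real where C2: "0 < C2" and ev2: "\<forall>\<^sub>F N :: nat in sequentially. \<forall>x::nat.
     pz (int N - int x) / partition_count N \<le> C2 * N * exp (- (pi / sqrt (6 * real N) * x))"
    using pz_ratio_le by (elim exE conjE) (rule that)
  define C where "C = 9 * C1 + C2 + 1"
  have e1: "\<forall>\<^sub>F N :: nat in sequentially. 2 * (real N powr (11 / 20)) \<le> N" by real_asymp
  have e2: "\<forall>\<^sub>F N :: nat in sequentially. 3 * C1 * real N powr (- 2 / 5) \<le> 1" by real_asymp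
  have e3: "\<forall>\<^sub>F N :: nat in sequentially. 1 / sqrt N \<le> real N powr (- 2 / 5)" by real_asymp
  have e4: "\<forall>\<^sub>F N :: nat in sequentially. real N powr (11 / 20) / N \<le> real N powr (- 2 / 5)" by real_asymp
  have e5: "\<forall>\<^sub>F N :: nat in sequentially. N * exp (- (real N powr (1 / 20))) \<le> real N powr (- 2 / 5)" by real_asymp
  have "\<forall>\<^sub>F N in sequentially. ?P C N"
    using ev1 ev2 e1 e2 e3 e4 e5 eventually_ge_at_top[of 1]
  proof eventually_elim
    case (elim N)
    show ?case
    proof
      fix x :: nat
      define T where "T = real N powr (- 2 / 5)"
      have T: "0 < T" using elim by (simp add: T_def)
      define E where "E = exp (- (pi / sqrt (6 * real N) * x))"
      define r where "r = pz (int N - int x) / partition_count N"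
      have pp: "0 < real (partition_count N)" using partition_count_pos by simp
      show "\<bar>r - E\<bar> \<le> C * N powr (- 2 / 5)"
      proof (cases "real x \<le> real N powr (11 / 20)")
        case True
        then have x2: "2 * x \<le> N" using elim by linarith
        then have "nat (int N - int x) = N - x" by linarith
        then have r: "r = partition_count (N - x) / partition_count N" using x2 by (simp add: r_def pz_def)
        define y where "y = ln (partition_count (N - x)) - ln (partition_count N) + pi / sqrt (6 * real N) * x"
        have "x / N \<le> T" using True elim divide_right_mono[OF True, of "real N"] unfolding T_def by linarith
        moreover have "(real x)\<^sup>2 / (N * sqrt N) \<le> T"
        proof -
          have "(real x)\<^sup>2 \<le> (real N powr (11 / 20))\<^sup>2" using True by (intro power_mono) auto
          also have "\<dots> = real N powr (11 / 10)" using elim by (simp flip: powr_numeral add: powr_powr)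
          finally have "(real x)\<^sup>2 / (N * sqrt N) \<le> real N powr (11 / 10) / (N * sqrt N)"
            by (intro divide_right_mono) auto
          also have "\<dots> = real N powr (11 / 10) / real N powr (3 / 2)"
            using elim by (simp add: powr_half_sqrt[symmetric] powr_mult_base)
          also have "\<dots> = T" by (simp add: T_def flip: powr_diff)
          finally show ?thesis .
        qed
        moreover have "1 / sqrt N \<le> T" using elim by (simp add: T_def)
        ultimately have "1 / sqrt N + x / N + (real x)\<^sup>2 / (N * sqrt N) \<le> 3 * T" by linarith
        then have "C1 * (1 / sqrt N + x / N + (real x)\<^sup>2 / (N * sqrt N)) \<le> C1 * (3 * T)"
          using C1 by (intro mult_left_mono) auto
        moreover have "\<bar>y\<bar> \<le> C1 * (1 / sqrt N + x / N + (real x)\<^sup>2 / (N * sqrt N))"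
          unfolding y_def using elim(1) x2 by blast
        ultimately have y: "\<bar>y\<bar> \<le> 3 * C1 * T" by (simp add: mult_ac)
        then have "\<bar>y\<bar> \<le> 1" using elim by (simp add: T_def)
        then have ey: "\<bar>exp y - 1\<bar> \<le> 3 * \<bar>y\<bar>" by (rule abs_exp_minus_1_le)
        have "exp y = r / E"
          using partition_count_pos[of N] partition_count_pos[of "N - x"]
          by (simp add: y_def r E_def exp_add exp_diff exp_minus field_simps)
        then have "r - E = E * (exp y - 1)" by (simp add: E_def right_diff_distrib)
        then have "\<bar>r - E\<bar> = E * \<bar>exp y - 1\<bar>" by (simp add: abs_mult E_def)
        also have "\<dots> \<le> 1 * (3 * (3 * C1 * T))"
          using ey y by (intro mult_mono) (auto simp: E_def)
        also have "\<dots> \<le> C * T" using T C2 by (simp add: C_def algebra_simps)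
        finally show ?thesis by (simp add: T_def)
      next
        case False
        have "real N powr (1 / 20) \<le> pi / sqrt (6 * real N) * x"
        proof -
          have "real N powr (1 / 20) = 1 / sqrt N * real N powr (11 / 20)"
            using elim by (simp add: powr_half_sqrt[symmetric] flip: powr_minus_divide powr_add)
          also have "\<dots> \<le> pi / sqrt (6 * real N) * x"
          proof (rule mult_mono)
            show "1 / sqrt N \<le> pi / sqrt (6 * real N)"
              using sqrt_6_le_pi elim by (simp add: real_sqrt_mult field_simps)
          qed (use False in auto)
          finally show ?thesis .
        qed
        then have E: "E \<le> exp (- (real N powr (1 / 20)))" by (simp add: E_def)
        then have "N * E \<le> N * exp (- (real N powr (1 / 20)))" by (intro mult_left_mono) auto
        then have NE: "N * E \<le> T" using elim unfolding T_def by linarith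
        have "r \<le> C2 * (N * E)" using elim(2) by (simp add: r_def E_def mult.assoc)
        also have "\<dots> \<le> C2 * T" using NE C2 by (intro mult_left_mono) auto
        finally have "r \<le> C2 * T" .
        moreover have "E \<le> T"
        proof -
          have "1 * E \<le> N * E" using elim by (intro mult_right_mono) (auto simp: E_def)
          then show ?thesis using NE by linarith
        qed
        moreover have "0 \<le> r" "0 \<le> E" using pz_nonneg pp by (auto simp: r_def E_def)
        moreover have "0 \<le> 9 * C1 * T" "0 \<le> C2 * T" using C1 C2 T by simp_all
        ultimately have "\<bar>r - E\<bar> \<le> 9 * C1 * T + C2 * T + 1 * T" by linarith
        then have "\<bar>r - E\<bar> \<le> C * T" by (simp only: C_def distrib_right)
        then show ?thesis by (simp add: T_def)
      qed
    qed
  qed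
  moreover have "0 < C" using C1 C2 by (simp add: C_def)
  ultimately show ?thesis by (intro exI[of _ C] conjI)
qed

section \<open>Strongly concave compositions of given rank\<close>

lemma F_conc_eq: "F_conc \<alpha> = (1 + exp (- \<alpha>)) / (1 + exp (- \<alpha>) + (exp (- \<alpha>))\<^sup>2)"
  by (simp add: F_conc_def power2_eq_square flip: exp_add)

text \<open>Each pair of consecutive terms is compared with \<open>F\<close> times the telescoping difference
  \<open>u ^ (3 * k) * w (3 * k) - u ^ (3 * k + 3) * w (3 * k + 3)\<close>. This is exact for constant \<open>w\<close>, and
  for \<open>u\<close> close to \<open>1\<close> also exact to first order in the differences of \<open>w\<close>.\<close>

lemma false_theta_approx:
  fixes a u F :: real
  assumes a: "0 \<le> a" and u: "0 < u" "u \<le> 1"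
  defines "w \<equiv> \<lambda>j::nat. exp (- a * (2 * real j * (real j + 1) / 3))"
    and "F \<equiv> (1 + u) / (1 + u + u\<^sup>2)"
  shows "\<bar>(\<Sum>k<K. u ^ (3 * k) * w (3 * k) - u ^ (3 * k + 2) * w (3 * k + 2)) - F\<bar>
     \<le> w (3 * K) + 16 * a * K + 64 * a\<^sup>2 * K ^ 3"
proof -
  define d where "d j = w j - w (Suc j)" for j
  define g where "g j = 1 - exp (- a * (4 * (real j + 1) / 3))" for j
  have w01: "0 < w j" "w j \<le> 1" for j using a by (auto simp: w_def)
  have wS: "w (Suc j) = w j * exp (- a * (4 * (real j + 1) / 3))" for j
    unfolding w_def exp_add[symmetric] by (simp add: field_simps)
  have d_eq: "d j = w j * g j" for j by (simp add: d_def g_def wS right_diff_distrib)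
  have g0: "0 \<le> g j" for j using a by (simp add: g_def)
  have gle: "g j \<le> a * (4 * (real j + 1) / 3)" for j
    using exp_ge_add_one_self[of "- a * (4 * (real j + 1) / 3)"] by (simp add: g_def)
  have gdiff: "\<bar>g (Suc j) - g j\<bar> \<le> 2 * a" for j
  proof -
    define y where "y = exp (- a * (4 * (real j + 1) / 3))"
    have y: "0 < y" "y \<le> 1" using a by (auto simp: y_def)
    have "exp (- a * (4 * (real (Suc j) + 1) / 3)) = y * exp (- (4 * a / 3))"
      unfolding y_def exp_add[symmetric] by (simp add: field_simps)
    then have "g (Suc j) - g j = y * (1 - exp (- (4 * a / 3)))" by (simp add: g_def y_def right_diff_distrib)
    moreover have "0 \<le> 1 - exp (- (4 * a / 3))" using a by simp
    moreover have "1 - exp (- (4 * a / 3)) \<le> 2 * a" using exp_ge_add_one_self[of "- (4 * a / 3)"] a by linarith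
    moreover have "y * (1 - exp (- (4 * a / 3))) \<le> 1 * (1 - exp (- (4 * a / 3)))" using a y by (intro mult_right_mono) auto
    ultimately show ?thesis using y by simp
  qed
  \<comment> \<open>Bounds the change of the differences of \<open>w\<close>: the product of two
    values of \<open>g\<close>, each at most 4 a K, plus the increment 2 a of
    \<open>g\<close>.\<close>
  define \<eta> where "\<eta> = 16 * a\<^sup>2 * (real K)\<^sup>2 + 2 * a"
  have gK: "g j \<le> 4 * a * K" if "j < 3 * K" for j
  proof -
    have "g j \<le> a * (4 * (real j + 1) / 3)" by (rule gle)
    also have "\<dots> \<le> a * (4 * K)" using that a by (intro mult_left_mono) auto
    finally show ?thesis by simp
  qed
  have ddiff: "\<bar>d (Suc j) - d j\<bar> \<le> \<eta>" if j: "Suc j < 3 * K" for j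
  proof -
    have "d (Suc j) - d j = - (w j * g j) * g (Suc j) + w j * (g (Suc j) - g j)"
    proof -
      have ws: "w (Suc j) = w j - w j * g j" using d_eq[of j] by (simp add: d_def)
      show ?thesis unfolding d_eq[of "Suc j"] d_eq[of j] ws by (simp add: algebra_simps)
    qed
    also have "\<bar>\<dots>\<bar> \<le> \<bar>- (w j * g j) * g (Suc j)\<bar> + \<bar>w j * (g (Suc j) - g j)\<bar>"
      by (rule abs_triangle_ineq)
    also have "\<bar>- (w j * g j) * g (Suc j)\<bar> \<le> 1 * (4 * a * K) * (4 * a * K)"
      unfolding abs_mult abs_minus_cancel using w01[of j] g0[of j] g0[of "Suc j"] gK[of j] gK[of "Suc j"] j a
      by (intro mult_mono) auto
    also have "\<bar>w j * (g (Suc j) - g j)\<bar> \<le> 1 * (2 * a)"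
      unfolding abs_mult using w01[of j] gdiff[of j] by (intro mult_mono) auto
    finally show ?thesis by (simp add: \<eta>_def power2_eq_square mult_ac)
  qed
  have den: "0 < 1 + u + u\<^sup>2" using u by (simp add: add_pos_pos)
  have F: "0 \<le> F" "F \<le> 1" using u den by (auto simp: F_def)
  \<comment> \<open>The defining equation of \<open>F\<close>: with it the zeroth order of
    \<open>D k\<close> vanishes.\<close>
  have F1: "1 - F - u\<^sup>2 + F * u ^ 3 = 0"
    unfolding F_def using den by (simp add: field_simps power2_eq_square power3_eq_cube)
  \<comment> \<open>The coefficient of the first difference \<open>d0\<close> is of order 1 - u, so
    after multiplication by u ^ (3 k) it telescopes over \<open>k\<close> instead of costing a
    factor \<open>K\<close>.\<close>
  have F2: "0 \<le> 2 * u\<^sup>2 - 3 * F * u ^ 3" "2 * u\<^sup>2 - 3 * F * u ^ 3 \<le> 2 * (1 - u)"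
  proof -
    have eq: "2 * u\<^sup>2 - 3 * F * u ^ 3 = u\<^sup>2 * ((1 - u) * ((2 + u) / (1 + u + u\<^sup>2)))"
      unfolding F_def using den by (simp add: field_simps power2_eq_square power3_eq_cube)
    have q: "0 \<le> (2 + u) / (1 + u + u\<^sup>2)" "(2 + u) / (1 + u + u\<^sup>2) \<le> 2" using u den by (auto simp: divide_le_eq)
    show "0 \<le> 2 * u\<^sup>2 - 3 * F * u ^ 3" unfolding eq using u q by (intro mult_nonneg_nonneg) auto
    have "u\<^sup>2 * ((1 - u) * ((2 + u) / (1 + u + u\<^sup>2))) \<le> 1 * ((1 - u) * 2)"
      using u q by (intro mult_mono mult_nonneg_nonneg) (auto simp: power_le_one)
    then show "2 * u\<^sup>2 - 3 * F * u ^ 3 \<le> 2 * (1 - u)" unfolding eq by simp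
  qed
  define D where "D k = (u ^ (3 * k) * w (3 * k) - u ^ (3 * k + 2) * w (3 * k + 2))
     - F * (u ^ (3 * k) * w (3 * k) - u ^ (3 * Suc k) * w (3 * Suc k))" for k
  have Dle: "\<bar>D k\<bar> \<le> 8 * a * K * (u ^ (3 * k) - u ^ (3 * Suc k)) + 4 * \<eta>" if k: "k < K" for k
  proof -
    define d0 e1 e2 where "d0 = d (3 * k)" and "e1 = d (3 * k + 1) - d0" and "e2 = d (3 * k + 2) - d0"
    have e1: "\<bar>e1\<bar> \<le> \<eta>" using ddiff[of "3 * k"] k by (simp add: e1_def d0_def)
    have e2: "\<bar>e2\<bar> \<le> 2 * \<eta>"
      using ddiff[of "3 * k + 1"] e1 k by (simp add: e2_def e1_def)
    have d0: "0 \<le> d0" "d0 \<le> 4 * a * K"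
    proof -
      show "0 \<le> d0" using w01[of "3 * k"] g0 by (simp add: d0_def d_eq)
      have "d0 \<le> 1 * (4 * a * K)" unfolding d0_def d_eq
        using w01[of "3 * k"] g0[of "3 * k"] gK[of "3 * k"] k by (intro mult_mono) auto
      then show "d0 \<le> 4 * a * K" by simp
    qed
    define W where "W = w (3 * k)"
    have w2: "w (3 * k + 2) = W - (2 * d0 + e1)"
      by (simp add: W_def d0_def e1_def d_def)
    have w3: "w (3 * Suc k) = W - (3 * d0 + e1 + e2)"
      by (simp add: W_def d0_def e1_def e2_def d_def numeral_3_eq_3)
    have "D k = u ^ (3 * k) * (W * (1 - F - u\<^sup>2 + F * u ^ 3) + ((2 * u\<^sup>2 - 3 * F * u ^ 3) * d0 + (u\<^sup>2 * e1 - F * u ^ 3 * (e1 + e2))))"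
      unfolding D_def w2 w3 W_def[symmetric] by (simp add: power_add power2_eq_square algebra_simps)
    also have "\<dots> = u ^ (3 * k) * ((2 * u\<^sup>2 - 3 * F * u ^ 3) * d0) + u ^ (3 * k) * (u\<^sup>2 * e1 - F * u ^ 3 * (e1 + e2))"
      unfolding F1 by (simp add: distrib_left)
    also have "\<bar>\<dots>\<bar> \<le> \<bar>u ^ (3 * k) * ((2 * u\<^sup>2 - 3 * F * u ^ 3) * d0)\<bar> + \<bar>u ^ (3 * k) * (u\<^sup>2 * e1 - F * u ^ 3 * (e1 + e2))\<bar>"
      by (rule abs_triangle_ineq)
    also have "\<bar>u ^ (3 * k) * ((2 * u\<^sup>2 - 3 * F * u ^ 3) * d0)\<bar> \<le> 8 * a * K * (u ^ (3 * k) - u ^ (3 * Suc k))"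
    proof -
      have "\<bar>u ^ (3 * k) * ((2 * u\<^sup>2 - 3 * F * u ^ 3) * d0)\<bar> = u ^ (3 * k) * ((2 * u\<^sup>2 - 3 * F * u ^ 3) * d0)"
        using u F2 d0 by (simp add: abs_mult)
      also have "\<dots> \<le> u ^ (3 * k) * ((2 * (1 - u)) * (4 * a * K))"
        using u F2 d0 by (intro mult_left_mono mult_mono) auto
      also have "\<dots> \<le> u ^ (3 * k) * ((2 * (1 - u ^ 3)) * (4 * a * K))"
      proof -
        have "u ^ 3 \<le> u ^ 1" using u by (intro power_decreasing) auto
        then show ?thesis using u a by (intro mult_left_mono mult_right_mono) auto
      qed
      also have "\<dots> = 8 * a * K * (u ^ (3 * k) - u ^ (3 * Suc k))" by (simp add: power_add algebra_simps)
      finally show ?thesis .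
    qed
    also have "\<bar>u ^ (3 * k) * (u\<^sup>2 * e1 - F * u ^ 3 * (e1 + e2))\<bar> \<le> 1 * (4 * \<eta>)"
    proof (subst abs_mult, intro mult_mono)
      have "\<bar>u\<^sup>2 * e1 - F * u ^ 3 * (e1 + e2)\<bar> \<le> \<bar>u\<^sup>2 * e1\<bar> + \<bar>F * u ^ 3 * (e1 + e2)\<bar>" by (rule abs_triangle_ineq4)
      also have "\<bar>u\<^sup>2 * e1\<bar> \<le> 1 * \<eta>" unfolding abs_mult using u e1 by (intro mult_mono) (auto simp: power_le_one)
      also have "\<bar>F * u ^ 3 * (e1 + e2)\<bar> \<le> (1 * 1) * (3 * \<eta>)"
        unfolding abs_mult using u e1 e2 F by (intro mult_mono) (auto simp: power_le_one)
      finally show "\<bar>u\<^sup>2 * e1 - F * u ^ 3 * (e1 + e2)\<bar> \<le> 4 * \<eta>" by simp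
      show "\<bar>u ^ (3 * k)\<bar> \<le> 1" using u by (simp add: power_le_one)
    qed auto
    finally show ?thesis by simp
  qed
  have tel: "(\<Sum>k<K. f k - f (Suc k)) = f 0 - f K" for f :: "nat \<Rightarrow> real"
    by (rule sum_lessThan_telescope')
  have "(\<Sum>k<K. u ^ (3 * k) * w (3 * k) - u ^ (3 * k + 2) * w (3 * k + 2)) - F * (1 - u ^ (3 * K) * w (3 * K)) = (\<Sum>k<K. D k)"
    using tel[of "\<lambda>k. u ^ (3 * k) * w (3 * k)"]
    by (simp add: D_def sum_subtractf sum_distrib_left[symmetric] w_def)
  then have "\<bar>(\<Sum>k<K. u ^ (3 * k) * w (3 * k) - u ^ (3 * k + 2) * w (3 * k + 2)) - F * (1 - u ^ (3 * K) * w (3 * K))\<bar>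
     \<le> (\<Sum>k<K. \<bar>D k\<bar>)" by (simp add: sum_abs)
  also have "\<dots> \<le> (\<Sum>k<K. 8 * a * K * (u ^ (3 * k) - u ^ (3 * Suc k)) + 4 * \<eta>)"
    by (intro sum_mono Dle) auto
  also have "\<dots> = 8 * a * K * (1 - u ^ (3 * K)) + K * (4 * \<eta>)"
    using tel[of "\<lambda>k. u ^ (3 * k)"] by (simp add: sum.distrib sum_distrib_left[symmetric] del: mult_Suc_right)
  also have "\<dots> \<le> 8 * a * K * 1 + K * (4 * \<eta>)"
    using a u by (intro add_right_mono mult_left_mono) auto
  also have "\<dots> = 16 * a * K + 64 * a\<^sup>2 * K ^ 3"
    by (simp add: \<eta>_def power2_eq_square power3_eq_cube algebra_simps)
  finally have 1: "\<bar>(\<Sum>k<K. u ^ (3 * k) * w (3 * k) - u ^ (3 * k + 2) * w (3 * k + 2)) - F * (1 - u ^ (3 * K) * w (3 * K))\<bar>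
     \<le> 16 * a * K + 64 * a\<^sup>2 * K ^ 3" .
  have "F * (u ^ (3 * K) * w (3 * K)) \<le> 1 * (1 * w (3 * K))"
    using F u w01[of "3 * K"] by (intro mult_mono) (auto simp: power_le_one)
  moreover have "0 \<le> F * (u ^ (3 * K) * w (3 * K))" using F u w01[of "3 * K"] by simp
  ultimately have "\<bar>F * (1 - u ^ (3 * K) * w (3 * K)) - F\<bar> \<le> w (3 * K)" by (simp add: right_diff_distrib)
  then show ?thesis using 1 by linarith
qed


text \<open>The lower bound, attained at 0, is what turns absolute errors into relative ones
  uniformly in the rank.\<close>

lemma F_conc_bounds:
  assumes "0 \<le> \<alpha>"
  shows "2 / 3 \<le> F_conc \<alpha>" "F_conc \<alpha> \<le> 1"
proof -
  define u where "u = exp (- \<alpha>)"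
  have u: "0 < u" "u \<le> 1" using assms by (auto simp: u_def)
  have den: "0 < 1 + u + u\<^sup>2" using u by (simp add: add_pos_pos)
  have "u\<^sup>2 \<le> u" using u by (simp add: power2_eq_square mult_left_le)
  then show "2 / 3 \<le> F_conc \<alpha>" "F_conc \<alpha> \<le> 1"
    unfolding F_conc_eq u_def[symmetric] using den u by (auto simp: divide_simps)
qed

text \<open>With K of order N ^ (11/40), the replaced ratios cost K N ^ (- 2/5) = N ^ (- 1/8), the
  false theta sum costs a K = N ^ (- 9/40) and a ^ 2 K ^ 3 = N ^ (- 7/40), and the terms beyond K
  are smaller than any power.\<close>

lemma Vd_rank_abs_error:
  "\<exists>C>(0 :: real). \<forall>\<^sub>F N :: nat in sequentially. \<forall>l :: int.
     \<bar>real (Vd_rank l (N + nat \<bar>l\<bar> * (nat \<bar>l\<bar> + 1) div 2)) / partition_count N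
        - F_conc (pi * \<bar>real_of_int l\<bar> / sqrt (6 * real N))\<bar> \<le> C * N powr (- 1 / 10)"
  (is "\<exists>C>_. \<forall>\<^sub>F N in _. ?P C N")
proof -
  obtain C1 :: real where C1: "0 < C1" and ev1: "\<forall>\<^sub>F N :: nat in sequentially. \<forall>x::nat.
     \<bar>pz (int N - int x) / partition_count N - exp (- (pi / sqrt (6 * real N) * x))\<bar> \<le> C1 * N powr (- 2 / 5)"
    using pz_ratio_approx by (elim exE conjE) (rule that)
  obtain C2 :: real where C2: "0 < C2" and ev2: "\<forall>\<^sub>F N :: nat in sequentially. \<forall>x::nat.
     pz (int N - int x) / partition_count N \<le> C2 * N * exp (- (pi / sqrt (6 * real N) * x))"
    using pz_ratio_le by (elim exE conjE) (rule that)
  \<comment> \<open>\<open>4 * C1\<close> for the replaced ratios, \<open>2 * C2\<close> for the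
    tail, and 1 + 64 + 2048 for the three terms of \<open>false_theta_approx\<close>.\<close>
  define C where "C = 4 * C1 + 2 * C2 + 1 + 64 + 2048"
  have e1: "\<forall>\<^sub>F N :: nat in sequentially. real N powr (11 / 40) * real N powr (- 2 / 5) \<le> real N powr (- 1 / 10)" by real_asymp
  have e2: "\<forall>\<^sub>F N :: nat in sequentially. (real N + 1) * (N * exp (- (real N powr (1 / 20)))) \<le> real N powr (- 1 / 10)" by real_asymp
  have e3: "\<forall>\<^sub>F N :: nat in sequentially. exp (- (real N powr (1 / 20))) \<le> real N powr (- 1 / 10)" by real_asymp
  have e4: "\<forall>\<^sub>F N :: nat in sequentially. real N powr (11 / 40) / sqrt N \<le> real N powr (- 1 / 10)" by real_asymp
  have e5: "\<forall>\<^sub>F N :: nat in sequentially. (real N powr (11 / 40)) ^ 3 / N \<le> real N powr (- 1 / 10)" by real_asymp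
  have "\<forall>\<^sub>F N in sequentially. ?P C N"
    using ev1 ev2 e1 e2 e3 e4 e5 eventually_ge_at_top[of "1 :: nat"]
  proof eventually_elim
    case (elim N)
    show ?case
    proof
      fix l :: int
      define L where "L = nat \<bar>l\<bar>"
      define a where "a = pi / sqrt (6 * real N)"
      define T where "T = real N powr (- 1 / 10)"
      define p where "p = real (partition_count N)"
      define V where "V = real (Vd_rank l (N + L * (L + 1) div 2))"
      \<comment> \<open>Just above N ^ (1/4), so that a * Y ^ 2 is at least N ^ (1/20) and the
        dropped terms decay faster than any power.\<close>
      define Y where "Y = real N powr (11 / 40)"
      define K where "K = nat \<lfloor>Y\<rfloor> + 1"
      define x y where "x k = 3 * k * L + 6 * k\<^sup>2 + 2 * k" and "y k = (3 * k + 2) * L + 6 * k\<^sup>2 + 10 * k + 4" for k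
      define r where "r j = pz (int N - int j) / p" for j
      define u where "u = exp (- (a * L))"
      define w where "w = (\<lambda>j::nat. exp (- a * (2 * real j * (real j + 1) / 3)))"
      define F where "F = (1 + u) / (1 + u + u\<^sup>2)"
      have N1: "1 \<le> real N" using elim by simp
      have p0: "0 < p" using partition_count_pos by (simp add: p_def)
      have T0: "0 < T" using elim by (simp add: T_def)
      have Y1: "1 \<le> Y" using N1 by (simp add: Y_def ge_one_powr_ge_zero)
      have YN: "Y \<le> N" using N1 powr_mono[of "11 / 40" 1 "real N"] by (simp add: Y_def)
      have K: "Y \<le> K" "K \<le> 2 * Y" "K \<le> N + 1"
      proof -
        have fl: "real (nat \<lfloor>Y\<rfloor>) = of_int \<lfloor>Y\<rfloor>" using Y1 by simp
        show "Y \<le> K" unfolding K_def using fl by simp linarith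
        show "K \<le> 2 * Y" unfolding K_def using fl Y1 by simp linarith
        have "real (nat \<lfloor>Y\<rfloor>) \<le> N" using fl YN by linarith
        then show "K \<le> N + 1" by (simp add: K_def)
      qed
      have a: "1 / sqrt N \<le> a" "a \<le> 2 / sqrt N" "0 < a"
      proof -
        show "1 / sqrt N \<le> a" using N1 sqrt_6_le_pi by (simp add: a_def real_sqrt_mult field_simps)
        have "2 \<le> sqrt 6" by (rule real_le_rsqrt) simp
        then have "pi \<le> 2 * sqrt 6" using pi_less_4 by linarith
        then show "a \<le> 2 / sqrt N" using N1 by (simp add: a_def real_sqrt_mult field_simps)
        show "0 < a" using N1 by (simp add: a_def)
      qed
      have big: "exp (- (a * z)) \<le> exp (- (real N powr (1 / 20)))" if "Y\<^sup>2 \<le> z" for z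
      proof -
        have "real N powr (1 / 20) = 1 / sqrt N * Y\<^sup>2"
        proof -
          have "Y\<^sup>2 = real N powr (11 / 20)" using N1 by (simp add: Y_def powr_powr flip: powr_numeral)
          moreover have "1 / sqrt N = real N powr (- (1 / 2))" using N1 by (simp add: powr_minus_divide powr_half_sqrt)
          ultimately show ?thesis by (simp flip: powr_add)
        qed
        also have "\<dots> \<le> a * z" using a that by (intro mult_mono) auto
        finally show ?thesis by simp
      qed
      have V: "V / p = (\<Sum>k<N + 1. r (x k) - r (y k))"
        unfolding V_def L_def Vd_rank_eq_sum[of N "N + 1" l, OF less_add_one] r_def x_def y_def
        by (simp only: sum_divide_distrib diff_divide_distrib)
      have r0: "0 \<le> r j" for j using pz_nonneg p0 by (simp add: r_def)
      have r1: "\<bar>r j - exp (- (a * j))\<bar> \<le> C1 * N powr (- 2 / 5)" for j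
        using elim(1) unfolding r_def p_def a_def by blast
      have r2: "r j \<le> C2 * N * exp (- (a * j))" for j
        using elim(2) unfolding r_def p_def a_def by blast
      have split: "V / p = (\<Sum>k<K. r (x k) - r (y k)) + (\<Sum>k\<in>{K..<N + 1}. r (x k) - r (y k))"
        unfolding V using K(3) by (metis lessThan_atLeast0 le0 sum.atLeastLessThan_concat)
      have tail: "\<bar>\<Sum>k\<in>{K..<N + 1}. r (x k) - r (y k)\<bar> \<le> 2 * C2 * T"
      proof -
        define B where "B = C2 * N * exp (- (real N powr (1 / 20)))"
        have B0: "0 \<le> B" using C2 by (simp add: B_def)
        have "\<bar>r (x k) - r (y k)\<bar> \<le> B" if k: "k \<in> {K..<N + 1}" for k
        proof -
          have "Y\<^sup>2 \<le> (real k)\<^sup>2" using K(1) Y1 k by (intro power_mono) auto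
          moreover have "k\<^sup>2 \<le> x k" "k\<^sup>2 \<le> y k" unfolding x_def y_def by linarith+
          then have "(real k)\<^sup>2 \<le> x k" "(real k)\<^sup>2 \<le> y k" by (metis of_nat_le_iff of_nat_power)+
          ultimately have "Y\<^sup>2 \<le> x k" "Y\<^sup>2 \<le> y k" by linarith+
          then have "exp (- (a * x k)) \<le> exp (- (real N powr (1 / 20)))" "exp (- (a * y k)) \<le> exp (- (real N powr (1 / 20)))"
            using big by blast+
          then have "C2 * N * exp (- (a * x k)) \<le> B" "C2 * N * exp (- (a * y k)) \<le> B"
            unfolding B_def using C2 by (auto intro!: mult_left_mono)
          then show ?thesis using r0[of "x k"] r0[of "y k"] r2[of "x k"] r2[of "y k"] by linarith
        qed
        then have "\<bar>\<Sum>k\<in>{K..<N + 1}. r (x k) - r (y k)\<bar> \<le> (\<Sum>k\<in>{K..<N + 1}. B)"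
          by (intro order_trans[OF sum_abs] sum_mono)
        also have "\<dots> = real (N + 1 - K) * B" by simp
        also have "\<dots> \<le> (real N + 1) * B" using B0 K by (intro mult_right_mono) auto
        also have "\<dots> = C2 * ((real N + 1) * (N * exp (- (real N powr (1 / 20)))))" by (simp add: B_def mult_ac)
        also have "\<dots> \<le> C2 * T" using elim(4) C2 by (intro mult_left_mono) (auto simp: T_def)
        also have "\<dots> \<le> 2 * C2 * T" using C2 T0 by simp
        finally show ?thesis .
      qed
      have head: "\<bar>(\<Sum>k<K. r (x k) - r (y k)) - (\<Sum>k<K. exp (- (a * x k)) - exp (- (a * y k)))\<bar> \<le> 4 * C1 * T"
      proof -
        have "\<bar>(\<Sum>k<K. r (x k) - r (y k)) - (\<Sum>k<K. exp (- (a * x k)) - exp (- (a * y k)))\<bar>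
          = \<bar>\<Sum>k<K. (r (x k) - exp (- (a * x k))) - (r (y k) - exp (- (a * y k)))\<bar>"
          unfolding sum_subtractf by (rule arg_cong[of _ _ abs]) simp
        also have "\<dots> \<le> (\<Sum>k<K. 2 * (C1 * N powr (- 2 / 5)))"
        proof (intro order_trans[OF sum_abs] sum_mono)
          fix k
          show "\<bar>(r (x k) - exp (- (a * x k))) - (r (y k) - exp (- (a * y k)))\<bar> \<le> 2 * (C1 * N powr (- 2 / 5))"
            using r1[of "x k"] r1[of "y k"] by linarith
        qed
        also have "\<dots> = real K * (2 * (C1 * N powr (- 2 / 5)))" by simp
        also have "\<dots> \<le> (2 * Y) * (2 * (C1 * N powr (- 2 / 5)))" using K C1 by (intro mult_right_mono) auto
        also have "\<dots> = 4 * C1 * (Y * N powr (- 2 / 5))" by simp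
        also have "\<dots> \<le> 4 * C1 * T" using elim(3) C1 by (intro mult_left_mono) (auto simp: T_def Y_def)
        finally show ?thesis .
      qed
      have ex: "exp (- (a * x k)) = u ^ (3 * k) * w (3 * k)" "exp (- (a * y k)) = u ^ (3 * k + 2) * w (3 * k + 2)" for k
        unfolding u_def w_def exp_of_nat_mult[symmetric] exp_add[symmetric] x_def y_def
        by (simp_all add: algebra_simps power2_eq_square)
      have u: "0 < u" "u \<le> 1" using a(3) by (auto simp: u_def)
      have theta: "\<bar>(\<Sum>k<K. exp (- (a * x k)) - exp (- (a * y k))) - F\<bar> \<le> (1 + 64 + 2048) * T"
      proof -
        have "\<bar>(\<Sum>k<K. exp (- (a * x k)) - exp (- (a * y k))) - F\<bar> \<le> w (3 * K) + 16 * a * K + 64 * a\<^sup>2 * K ^ 3"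
          unfolding ex w_def F_def using a(3) u by (intro false_theta_approx) auto
        also have "w (3 * K) \<le> 1 * T"
        proof -
          have "Y\<^sup>2 \<le> (real K)\<^sup>2" using K(1) Y1 by (intro power_mono) auto
          moreover have "2 * real (3 * K) * (real (3 * K) + 1) / 3 = 6 * (real K)\<^sup>2 + 2 * real K"
            by (simp add: power2_eq_square algebra_simps)
          ultimately have "Y\<^sup>2 \<le> 2 * real (3 * K) * (real (3 * K) + 1) / 3"
            using zero_le_power2[of "real K"] by linarith
          from big[OF this] show ?thesis using elim(5) unfolding w_def T_def mult_minus_left by linarith
        qed
        also have "16 * a * K \<le> 64 * T"
        proof -
          have "a * K \<le> (2 / sqrt N) * (2 * Y)" using a K Y1 by (intro mult_mono) auto
          also have "\<dots> = 4 * (Y / sqrt N)" by simp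
          also have "\<dots> \<le> 4 * T" using elim(6) by (simp add: Y_def T_def)
          finally show ?thesis by simp
        qed
        also have "64 * a\<^sup>2 * K ^ 3 \<le> 2048 * T"
        proof -
          have k3: "real K ^ 3 \<le> (2 * Y) ^ 3" by (rule power_mono) (use K in auto)
          have a2: "a\<^sup>2 \<le> (2 / sqrt N)\<^sup>2" by (rule power_mono) (use a in auto)
          have "a\<^sup>2 * real K ^ 3 \<le> (2 / sqrt N)\<^sup>2 * (2 * Y) ^ 3" by (rule mult_mono[OF a2 k3]) auto
          also have "\<dots> = 32 * (Y ^ 3 / N)" by (simp add: power_divide power_mult_distrib)
          also have "\<dots> \<le> 32 * T" using elim(7) by (simp add: Y_def T_def)
          finally show ?thesis by simp
        qed
        finally show ?thesis by simp
      qed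
      have Feq: "F_conc (pi * \<bar>real_of_int l\<bar> / sqrt (6 * real N)) = F"
        unfolding F_conc_eq F_def u_def a_def L_def by simp
      have "\<bar>V / p - F\<bar> \<le> C * T"
        using split tail head theta unfolding C_def distrib_right by linarith
      then show "\<bar>real (Vd_rank l (N + nat \<bar>l\<bar> * (nat \<bar>l\<bar> + 1) div 2)) / partition_count N
        - F_conc (pi * \<bar>real_of_int l\<bar> / sqrt (6 * real N))\<bar> \<le> C * N powr (- 1 / 10)"
        unfolding Feq V_def p_def T_def L_def .
    qed
  qed
  moreover have "0 < C" using C1 C2 by (simp add: C_def)
  ultimately show ?thesis by (intro exI[of _ C] conjI)
qed

lemma Vd_rank_rel_error:
  "\<exists>C>(0 :: real). \<forall>\<^sub>F N :: nat in sequentially. \<forall>l :: int.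
     \<bar>real (Vd_rank l (N + nat \<bar>l\<bar> * (nat \<bar>l\<bar> + 1) div 2))
        / (partition_count N * F_conc (pi * \<bar>real_of_int l\<bar> / sqrt (6 * real N))) - 1\<bar> \<le> C * N powr (- 1 / 10)"
proof -
  obtain C :: real where C: "0 < C" and ev: "\<forall>\<^sub>F N :: nat in sequentially. \<forall>l :: int.
     \<bar>real (Vd_rank l (N + nat \<bar>l\<bar> * (nat \<bar>l\<bar> + 1) div 2)) / partition_count N
        - F_conc (pi * \<bar>real_of_int l\<bar> / sqrt (6 * real N))\<bar> \<le> C * N powr (- 1 / 10)"
    using Vd_rank_abs_error by (elim exE conjE) (rule that)
  have "\<forall>\<^sub>F N :: nat in sequentially. \<forall>l :: int.
     \<bar>real (Vd_rank l (N + nat \<bar>l\<bar> * (nat \<bar>l\<bar> + 1) div 2))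
        / (partition_count N * F_conc (pi * \<bar>real_of_int l\<bar> / sqrt (6 * real N))) - 1\<bar> \<le> 2 * C * N powr (- 1 / 10)"
    using ev
  proof (eventually_elim, intro allI)
    fix N :: nat and l :: int
    assume A: "\<forall>l :: int. \<bar>real (Vd_rank l (N + nat \<bar>l\<bar> * (nat \<bar>l\<bar> + 1) div 2)) / partition_count N
        - F_conc (pi * \<bar>real_of_int l\<bar> / sqrt (6 * real N))\<bar> \<le> C * N powr (- 1 / 10)"
    define v f where "v = real (Vd_rank l (N + nat \<bar>l\<bar> * (nat \<bar>l\<bar> + 1) div 2)) / partition_count N"
      and "f = F_conc (pi * \<bar>real_of_int l\<bar> / sqrt (6 * real N))"
    have f: "2 / 3 \<le> f" unfolding f_def by (rule F_conc_bounds) simp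
    have "v / f - 1 = (v - f) / f" using f by (simp add: diff_divide_distrib)
    then have "\<bar>v / f - 1\<bar> = \<bar>v - f\<bar> / f" using f by (simp only: abs_divide)
    also have "\<dots> \<le> (C * N powr (- 1 / 10)) / (1 / 2)"
      using A f C unfolding v_def f_def by (intro frac_le) auto
    finally show "\<bar>real (Vd_rank l (N + nat \<bar>l\<bar> * (nat \<bar>l\<bar> + 1) div 2))
        / (partition_count N * F_conc (pi * \<bar>real_of_int l\<bar> / sqrt (6 * real N))) - 1\<bar> \<le> 2 * C * N powr (- 1 / 10)"
      unfolding v_def f_def by (simp add: divide_divide_eq_left)
  qed
  then show ?thesis using C by (intro exI[of _ "2 * C"] conjI) auto
qed

section \<open>The distribution of the rank\<close>

lemma tendsto_eq_eventually:
  assumes "(f \<longlongrightarrow> l) F" "eventually (\<lambda>x. f x = g x) F" "l = l'"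
  shows "(g \<longlongrightarrow> l') F"
  using Lim_transform_eventually[OF assms(1,2)] assms(3) by simp

lemma sum_symmetric_int:
  fixes g :: "nat \<Rightarrow> real"
  shows "(\<Sum>m=-int M..int M. g (nat \<bar>m\<bar>)) = 2 * (\<Sum>k\<le>M. g k) - g 0"
proof (induction M)
  case (Suc M)
  have "{-int (Suc M)..int (Suc M)} = insert (int (Suc M)) (insert (- int (Suc M)) {-int M..int M})"
    by auto
  then show ?case using Suc by (simp add: nat_add_distrib)
qed simp

text \<open>On the half line the summand decreases from 1, so sum and integral differ by at most 1.
  Outside [-M, M] half of the exponent is bounded by its value at \<open>M\<close> and the other
  half is integrated.\<close>

lemma gaussian_sum_approx:
  fixes t :: real and M :: nat
  assumes t: "0 < t"
  shows "\<bar>(\<Sum>m=-int M..int M. exp (- pi * (real_of_int m)\<^sup>2 / t)) - sqrt t\<bar>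
     \<le> 1 + sqrt (2 * t) * exp (- pi * (real M)\<^sup>2 / (2 * t))"
proof -
  define b where "b = pi / t"
  have b: "0 < b" using t by (simp add: b_def)
  define f where "f x = exp (- b * x\<^sup>2)" for x :: real
  have contf: "continuous_on A f" for A unfolding f_def by (intro continuous_intros)
  interpret antimono_fun_sum_integral_diff f
  proof
    show "f y \<le> f x" if "0 \<le> x" "x \<le> y" for x y
      using that b by (simp add: f_def power_mono)
  qed (use contf in \<open>auto simp: f_def\<close>)
  define I where "I = integral {0..real M} f"
  have lo: "0 \<le> (\<Sum>k\<le>M. f (real k)) - I"
    using sum_integral_diff_series_nonneg[of M] by (simp add: sum_integral_diff_series_def I_def)
  have hi: "(\<Sum>k\<le>M. f (real k)) - I \<le> 1"
    using sum_integral_diff_series_antimono[of 0 M] by (simp add: sum_integral_diff_series_def I_def f_def)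
  have sum: "(\<Sum>m=-int M..int M. exp (- pi * (real_of_int m)\<^sup>2 / t)) = 2 * (\<Sum>k\<le>M. f (real k)) - 1"
  proof -
    have "exp (- pi * (real_of_int m)\<^sup>2 / t) = f (real (nat \<bar>m\<bar>))" for m by (simp add: f_def b_def)
    then show ?thesis using sum_symmetric_int[of "\<lambda>k. f (real k)" M] by (simp add: f_def)
  qed
  have fI: "(f has_integral I) {0..real M}"
    unfolding I_def using integrable_continuous_real[OF contf] by (rule integrable_integral)
  have "((\<lambda>x. f (- x)) has_integral I) {- real M..- 0}"
    using fI by (subst has_integral_reflect_real)
  moreover have "(\<lambda>x. f (- x)) = f" by (rule ext) (simp add: f_def)
  ultimately have "(f has_integral I) {- real M..0}" by (simp only: minus_zero)
  then have "(f has_integral (I + I)) {- real M..real M}"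
    using fI by (rule has_integral_combine[rotated 2]) auto
  then have fr: "((\<lambda>x. if x \<in> {- real M..real M} then f x else 0) has_integral (I + I)) UNIV"
    by (subst has_integral_restrict_UNIV)
  have "pi / b = t" using t by (simp add: b_def)
  then have fu: "(f has_integral sqrt t) UNIV" using has_integral_gaussian[OF b] by (simp add: f_def[abs_def])
  have "pi / (b / 2) = 2 * t" using t by (simp add: b_def)
  then have gu: "((\<lambda>x. exp (- (b * (real M)\<^sup>2 / 2)) * exp (- (b / 2) * x\<^sup>2)) has_integral (exp (- (b * (real M)\<^sup>2 / 2)) * sqrt (2 * t))) UNIV"
    using has_integral_gaussian[of "b / 2"] b by (intro has_integral_mult_right) simp
  have "I + I \<le> sqrt t"
    by (rule has_integral_le[OF fr fu]) (simp add: f_def)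
  moreover have "sqrt t - (I + I) \<le> exp (- (b * (real M)\<^sup>2 / 2)) * sqrt (2 * t)"
  proof (rule has_integral_le[OF has_integral_diff[OF fu fr] gu])
    fix x :: real
    show "f x - (if x \<in> {- real M..real M} then f x else 0) \<le> exp (- (b * (real M)\<^sup>2 / 2)) * exp (- (b / 2) * x\<^sup>2)"
    proof (cases "x \<in> {- real M..real M}")
      case False
      then have "\<bar>real M\<bar> \<le> \<bar>x\<bar>" by auto
      then have "(real M)\<^sup>2 \<le> x\<^sup>2" by (simp only: abs_le_square_iff)
      then have "b * (real M)\<^sup>2 \<le> b * x\<^sup>2" using b by (intro mult_left_mono) auto
      then show ?thesis using False by (simp add: f_def flip: exp_add)
    qed simp
  qed
  moreover have "exp (- (b * (real M)\<^sup>2 / 2)) * sqrt (2 * t) = sqrt (2 * t) * exp (- pi * (real M)\<^sup>2 / (2 * t))"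
    by (simp add: b_def mult.commute)
  ultimately show ?thesis unfolding sum using lo hi by linarith
qed

section \<open>Upper bounds valid for all ranks\<close>

lemma geo_nth_nonneg:
  assumes "0 < k"
  shows "0 \<le> fps_nth (geo k) n"
proof (induction n rule: less_induct)
  case (less n)
  have "geo k = 1 + fps_X ^ k * geo k"
    using geo_mult[OF assms] by (simp add: algebra_simps)
  then have "fps_nth (geo k) n = fps_nth (1 + fps_X ^ k * geo k) n" by simp
  also have "\<dots> = (if n = 0 then 1 else 0) + (if n < k then 0 else fps_nth (geo k) (n - k))"
    by (simp add: fps_X_power_mult_nth)
  also have "\<dots> \<ge> 0" using less[of "n - k"] assms by auto
  finally show ?case .
qed

lemma fps_mult_nth_nonneg:
  assumes "\<And>n. (0 :: real) \<le> fps_nth f n" "\<And>n. 0 \<le> fps_nth g n"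
  shows "0 \<le> fps_nth (f * g) n"
  unfolding fps_mult_nth using assms by (intro sum_nonneg mult_nonneg_nonneg) auto

text \<open>In \<open>aco_rec\<close> the subtracted \<open>bco\<close> is a coefficient of a series
  with nonnegative coefficients. This bound also serves ranks so large that N - l (l + 1) / 2 is
  small, where the asymptotics give nothing.\<close>

lemma aco_le: "aco l N \<le> partition_count N"
proof -
  have "0 \<le> fps_nth (bterm m r) n" for m r n
    unfolding bterm_def
    by (intro fps_mult_nth_nonneg geo_nth_nonneg) (auto simp: iq_nth fps_X_power_nth)
  then have "0 \<le> bco m n" for m n unfolding bco_def by (intro sum_nonneg)
  then show ?thesis unfolding aco_rec by simp
qed

text \<open>The right arm has at least \<open>l\<close> distinct positive entries, so it alone
  weighs at least l (l + 1) / 2.\<close>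

lemma Vd_rank_eq_0:
  assumes "n < l * (l + 1) div 2"
  shows "Vd_rank (int l) n = 0"
proof -
  have False if "(L, c, R) \<in> concave_triples n" "triple_rank (L, c, R) = int l" for L c R
  proof -
    define r where "r = length R"
    have lr: "l \<le> r" using that by (simp add: triple_rank_def r_def)
    have "l * (l + 1) div 2 \<le> r * (r + 1) div 2"
      using lr by (intro div_le_mono mult_le_mono) auto
    moreover have "sum_list R \<le> n" using that by (simp add: concave_triples_def)
    ultimately have "fps_nth (incr_fps r c) (sum_list R) = 0"
      unfolding incr_fps_eq using assms by (intro fps_X_power_mult_nth_less) linarith
    moreover have "R \<in> incr_lists r c (sum_list R)"
      using that by (simp add: concave_triples_def incr_lists_def r_def)
    ultimately show False
      using finite_incr_lists[of r c "sum_list R"] by (auto simp: incr_fps_def)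
  qed
  then have "{t \<in> concave_triples n. triple_rank t = int l} = {}" by (metis (mono_tags, lifting) empty_Collect_eq prod_cases3)
  then show ?thesis by (simp only: Vd_rank_eq_card card.empty)
qed

lemma Vd_rank_ratio_le:
  "\<exists>C>(0 :: real). \<forall>\<^sub>F N :: nat in sequentially. \<forall>m :: int.
     real (Vd_rank m N) / partition_count N \<le> C * N * exp (- (pi / sqrt (6 * real N) * ((real_of_int m)\<^sup>2 / 2)))"
  (is "\<exists>C>_. \<forall>\<^sub>F N in _. ?P C N")
proof -
  obtain C :: real where C: "0 < C" and ev: "\<forall>\<^sub>F N :: nat in sequentially. \<forall>x::nat.
     pz (int N - int x) / partition_count N \<le> C * N * exp (- (pi / sqrt (6 * real N) * x))"
    using pz_ratio_le by (elim exE conjE) (rule that)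
  have "\<forall>\<^sub>F N in sequentially. ?P C N"
    using ev
  proof (eventually_elim, intro allI)
    fix N :: nat and m :: int
    assume A: "\<forall>x::nat. pz (int N - int x) / partition_count N \<le> C * N * exp (- (pi / sqrt (6 * real N) * x))"
    define l where "l = nat \<bar>m\<bar>"
    define x where "x = l * (l + 1) div 2"
    have rx: "real x = real l * (real l + 1) / 2" unfolding x_def by (subst real_of_nat_div) (auto simp: algebra_simps)
    have "(real_of_int m)\<^sup>2 = (real l)\<^sup>2" by (simp add: l_def)
    then have mx: "(real_of_int m)\<^sup>2 / 2 \<le> real x" unfolding rx by (simp add: power2_eq_square algebra_simps)
    have V: "Vd_rank m N = Vd_rank (int l) N" unfolding l_def by (rule Vd_rank_abs)
    show "real (Vd_rank m N) / partition_count N \<le> C * N * exp (- (pi / sqrt (6 * real N) * ((real_of_int m)\<^sup>2 / 2)))"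
    proof (cases "N < x")
      case True
      then have "Vd_rank m N = 0" unfolding V by (intro Vd_rank_eq_0) (simp add: x_def)
      then show ?thesis using C by simp
    next
      case False
      then have "real (Vd_rank m N) = aco l (N - x)" unfolding V using Vd_rank_eq_aco[of l "N - x"] by (simp add: x_def)
      also have "\<dots> \<le> partition_count (N - x)" by (rule aco_le)
      also have "real (partition_count (N - x)) = pz (int N - int x)" using False by (simp add: pz_def nat_diff_distrib')
      finally have "real (Vd_rank m N) / partition_count N \<le> pz (int N - int x) / partition_count N"
        by (intro divide_right_mono) auto
      also have "\<dots> \<le> C * N * exp (- (pi / sqrt (6 * real N) * x))" using A by blast
      also have "\<dots> \<le> C * N * exp (- (pi / sqrt (6 * real N) * ((real_of_int m)\<^sup>2 / 2)))"
      proof (rule mult_left_mono)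
        have "pi / sqrt (6 * real N) * ((real_of_int m)\<^sup>2 / 2) \<le> pi / sqrt (6 * real N) * x"
          using mx by (rule mult_left_mono) simp
        then show "exp (- (pi / sqrt (6 * real N) * x)) \<le> exp (- (pi / sqrt (6 * real N) * ((real_of_int m)\<^sup>2 / 2)))"
          by (subst exp_le_cancel_iff) linarith
      qed (use C in auto)
      finally show ?thesis .
    qed
  qed
  then show ?thesis using C by (intro exI[of _ C] conjI)
qed

section \<open>The Gaussian law for the rank\<close>

definition rank_ratio :: "nat \<Rightarrow> int \<Rightarrow> real" where
  "rank_ratio N m = real (Vd_rank m N) / (partition_count N * exp (- pi * (real_of_int m)\<^sup>2 / sqrt (24 * real N)))"

text \<open>Apply the uniform estimate at N' = N - x with x = |m| (|m| + 1) / 2. The limit 2/3 is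
  F(0), as m / sqrt N tends to 0. Then ln (p N' / p N) = - a x + o(1), since x ^ 2 / N ^ (3/2) tends
  to 0, and a x exceeds the Gaussian exponent pi m ^ 2 / sqrt (24 N) only by pi |m| / sqrt (24 N),
  which tends to 0.\<close>

lemma rank_ratio_tendsto:
  fixes m :: "nat \<Rightarrow> int"
  assumes m: "(\<lambda>N. real_of_int (m N)) \<in> o(\<lambda>N. real N powr (3 / 8))"
  shows "(\<lambda>N. rank_ratio N (m N)) \<longlonglongrightarrow> 2 / 3"
proof -
  define l where "l N = nat \<bar>m N\<bar>" for N
  define h where "h N = real (l N) / real N powr (3 / 8)" for N
  define x where "x N = l N * (l N + 1) div 2" for N
  have rx: "real (x N) = real (l N) * (real (l N) + 1) / 2" for N unfolding x_def by (subst real_of_nat_div) (auto simp: algebra_simps)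
  have rl: "real (l N) = \<bar>real_of_int (m N)\<bar>" for N by (simp add: l_def)
  have h: "h \<longlonglongrightarrow> 0"
  proof -
    have "(\<lambda>N. \<bar>real_of_int (m N) / real N powr (3 / 8)\<bar>) \<longlonglongrightarrow> 0"
      using smalloD_tendsto[OF m] by (rule tendsto_rabs_zero)
    then show ?thesis by (simp add: h_def[abs_def] rl abs_divide)
  qed
  have lh: "\<forall>\<^sub>F N in sequentially. real (l N) = h N * real N powr (3 / 8)"
    using eventually_gt_at_top[of 0] by eventually_elim (simp add: h_def)
  have lsqrt: "(\<lambda>N. real (l N) / sqrt N) \<longlonglongrightarrow> 0"
  proof -
    have "(\<lambda>N. h N * (real N powr (3 / 8) / sqrt N)) \<longlonglongrightarrow> 0 * 0"
      by (intro tendsto_mult h) real_asymp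
    moreover have "\<forall>\<^sub>F N in sequentially. h N * (real N powr (3 / 8) / sqrt N) = real (l N) / sqrt N"
      using lh by eventually_elim simp
    ultimately show ?thesis by (rule tendsto_eq_eventually) simp
  qed
  have x34: "(\<lambda>N. real (x N) / real N powr (3 / 4)) \<longlonglongrightarrow> 0"
  proof -
    have "(\<lambda>N. (h N * h N + h N * (1 / real N powr (3 / 8))) / 2) \<longlonglongrightarrow> (0 * 0 + 0 * 0) / 2"
      by (intro tendsto_divide tendsto_add tendsto_mult h tendsto_const) (real_asymp | simp)+
    moreover have "\<forall>\<^sub>F N in sequentially. (h N * h N + h N * (1 / real N powr (3 / 8))) / 2 = real (x N) / real N powr (3 / 4)"
      using eventually_gt_at_top[of 0]
    proof eventually_elim
      case (elim N)
      have "real N powr (3 / 4) = real N powr (3 / 8) * real N powr (3 / 8)" by (simp flip: powr_add)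
      then show ?case using elim by (simp add: rx h_def field_simps)
    qed
    ultimately show ?thesis by (rule tendsto_eq_eventually) simp
  qed
  have xN: "(\<lambda>N. real (x N) / N) \<longlonglongrightarrow> 0"
  proof -
    have "(\<lambda>N. real (x N) / real N powr (3 / 4) * (real N powr (3 / 4) / N)) \<longlonglongrightarrow> 0 * 0"
      by (intro tendsto_mult x34) real_asymp
    moreover have "\<forall>\<^sub>F N in sequentially. real (x N) / real N powr (3 / 4) * (real N powr (3 / 4) / N) = real (x N) / N"
      using eventually_gt_at_top[of 0] by eventually_elim simp
    ultimately show ?thesis by (rule tendsto_eq_eventually) simp
  qed
  have x2: "(\<lambda>N. (real (x N))\<^sup>2 / (N * sqrt N)) \<longlonglongrightarrow> 0"
  proof -
    have "(\<lambda>N. (real (x N) / real N powr (3 / 4))\<^sup>2) \<longlonglongrightarrow> 0\<^sup>2" by (intro tendsto_power x34)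
    moreover have "\<forall>\<^sub>F N in sequentially. (real (x N) / real N powr (3 / 4))\<^sup>2 = (real (x N))\<^sup>2 / (N * sqrt N)"
      using eventually_gt_at_top[of 0]
    proof eventually_elim
      case (elim N)
      have "(real N powr (3 / 4))\<^sup>2 = real N powr (3 / 2)" using elim by (simp add: powr_powr flip: powr_numeral)
      also have "\<dots> = N * sqrt N" using elim by (simp add: powr_half_sqrt[symmetric] powr_mult_base)
      finally show ?case by (simp add: power_divide)
    qed
    ultimately show ?thesis by (rule tendsto_eq_eventually) simp
  qed
  have ev2x: "\<forall>\<^sub>F N in sequentially. 2 * x N \<le> N"
  proof -
    have "\<forall>\<^sub>F N in sequentially. real (x N) / N < 1 / 2" using xN by (rule order_tendstoD) simp
    then show ?thesis using eventually_gt_at_top[of 0] by eventually_elim (simp add: field_simps)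
  qed
  define N' where "N' N = N - x N" for N
  have evN': "\<forall>\<^sub>F N in sequentially. real N / 2 \<le> real (N' N) \<and> N = N' N + x N"
    using ev2x by eventually_elim (auto simp: N'_def)
  have N'lim: "filterlim N' at_top sequentially"
  proof (rule filterlim_at_top_mono)
    show "filterlim (\<lambda>N::nat. N div 2) at_top sequentially"
      by (rule filterlim_at_top_div_const_nat) simp
    show "\<forall>\<^sub>F N in sequentially. N div 2 \<le> N' N" using ev2x by eventually_elim (simp add: N'_def)
  qed
  define F where "F N = F_conc (pi * \<bar>real_of_int (m N)\<bar> / sqrt (6 * real (N' N)))" for N
  have q1: "(\<lambda>N. real (Vd_rank (m N) N) / (partition_count (N' N) * F N)) \<longlonglongrightarrow> 1"
  proof -
    obtain C :: real where C: "0 < C" and ev: "\<forall>\<^sub>F N :: nat in sequentially. \<forall>l :: int.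
       \<bar>real (Vd_rank l (N + nat \<bar>l\<bar> * (nat \<bar>l\<bar> + 1) div 2))
          / (partition_count N * F_conc (pi * \<bar>real_of_int l\<bar> / sqrt (6 * real N))) - 1\<bar> \<le> C * N powr (- 1 / 10)"
      using Vd_rank_rel_error by (elim exE conjE) (rule that)
    have "(\<lambda>N::nat. C * real N powr (- 1 / 10)) \<longlonglongrightarrow> C * 0" by (intro tendsto_mult tendsto_const) real_asymp
    then have "(\<lambda>N. C * real (N' N) powr (- 1 / 10)) \<longlonglongrightarrow> C * 0" by (rule filterlim_compose[OF _ N'lim])
    then have lim0: "(\<lambda>N. C * real (N' N) powr (- 1 / 10)) \<longlonglongrightarrow> 0" by simp
    have "\<forall>\<^sub>F N in sequentially. norm (real (Vd_rank (m N) N) / (partition_count (N' N) * F N) - 1) \<le> C * real (N' N) powr (- 1 / 10)"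
      using eventually_compose_filterlim[OF ev N'lim] evN'
    proof eventually_elim
      case (elim N)
      have "N' N + nat \<bar>m N\<bar> * (nat \<bar>m N\<bar> + 1) div 2 = N" using elim(2) by (simp add: x_def l_def)
      then show ?case using elim(1)[rule_format, of "m N"] by (simp add: F_def)
    qed
    then have "(\<lambda>N. real (Vd_rank (m N) N) / (partition_count (N' N) * F N) - 1) \<longlonglongrightarrow> 0"
      using lim0 by (rule Lim_null_comparison)
    then show ?thesis by (simp add: LIM_zero_iff)
  qed
  have q2: "F \<longlonglongrightarrow> 2 / 3"
  proof -
    have "(\<lambda>N. pi * \<bar>real_of_int (m N)\<bar> / sqrt (6 * real (N' N))) \<longlonglongrightarrow> 0"
    proof (rule Lim_null_comparison)
      show "(\<lambda>N. pi * (real (l N) / sqrt N)) \<longlonglongrightarrow> 0" using tendsto_mult_right_zero[OF lsqrt] by simp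
      show "\<forall>\<^sub>F N in sequentially. norm (pi * \<bar>real_of_int (m N)\<bar> / sqrt (6 * real (N' N))) \<le> pi * (real (l N) / sqrt N)"
        using evN' eventually_gt_at_top[of 0]
      proof eventually_elim
        case (elim N)
        have "sqrt N \<le> sqrt (6 * real (N' N))" using elim by (intro real_sqrt_le_mono) simp
        then have "real (l N) / sqrt (6 * real (N' N)) \<le> real (l N) / sqrt N"
          using elim by (intro divide_left_mono) auto
        then have "pi * (real (l N) / sqrt (6 * real (N' N))) \<le> pi * (real (l N) / sqrt N)" by (intro mult_left_mono) auto
        then show ?case by (simp add: rl)
      qed
    qed
    moreover have "isCont F_conc 0"
      unfolding F_conc_def by (intro continuous_intros) (simp add: add_pos_pos)
    ultimately have "(\<lambda>N. F_conc (pi * \<bar>real_of_int (m N)\<bar> / sqrt (6 * real (N' N)))) \<longlonglongrightarrow> F_conc 0"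
      by (rule isCont_tendsto_compose[rotated])
    then show ?thesis by (simp add: F_def[abs_def] F_conc_def)
  qed
  define y where "y N = ln (partition_count (N' N)) - ln (partition_count N) + pi / sqrt (6 * real N) * x N" for N
  have y0: "y \<longlonglongrightarrow> 0"
  proof -
    obtain C :: real where C: "0 < C" and ev: "\<forall>\<^sub>F N :: nat in sequentially. \<forall>x::nat. 2 * x \<le> N \<longrightarrow>
     \<bar>ln (partition_count (N - x)) - ln (partition_count N) + pi / sqrt (6 * real N) * x\<bar>
       \<le> C * (1 / sqrt N + x / N + (real x)\<^sup>2 / (N * sqrt N))"
      using partition_count_ln_ratio by (elim exE conjE) (rule that)
    have "(\<lambda>N. C * (1 / sqrt N + x N / N + (real (x N))\<^sup>2 / (N * sqrt N))) \<longlonglongrightarrow> C * (0 + 0 + 0)"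
      by (intro tendsto_mult tendsto_const tendsto_add xN x2) real_asymp
    then have lim0: "(\<lambda>N. C * (1 / sqrt N + x N / N + (real (x N))\<^sup>2 / (N * sqrt N))) \<longlonglongrightarrow> 0" by simp
    have "\<forall>\<^sub>F N in sequentially. norm (y N) \<le> C * (1 / sqrt N + x N / N + (real (x N))\<^sup>2 / (N * sqrt N))"
      using ev ev2x by eventually_elim (simp add: y_def N'_def)
    then show ?thesis using lim0 by (rule Lim_null_comparison)
  qed
  have q3: "(\<lambda>N. exp (y N - pi * (real (l N) / sqrt N) / sqrt 24)) \<longlonglongrightarrow> exp (0 - pi * 0 / sqrt 24)"
    by (intro tendsto_intros y0 lsqrt) simp
  have "(\<lambda>N. real (Vd_rank (m N) N) / (partition_count (N' N) * F N) * F N * exp (y N - pi * (real (l N) / sqrt N) / sqrt 24))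
     \<longlonglongrightarrow> 1 * (2 / 3) * exp (0 - pi * 0 / sqrt 24)"
    by (intro tendsto_mult q1 q2 q3)
  moreover have "\<forall>\<^sub>F N in sequentially. real (Vd_rank (m N) N) / (partition_count (N' N) * F N) * F N * exp (y N - pi * (real (l N) / sqrt N) / sqrt 24)
     = rank_ratio N (m N)"
    using eventually_gt_at_top[of 0]
  proof eventually_elim
    case (elim N)
    have F0: "0 < F N" using F_conc_bounds(1)[of "pi * \<bar>real_of_int (m N)\<bar> / sqrt (6 * real (N' N))"] by (simp add: F_def)
    have "pi / sqrt (6 * real N) * x N = pi * (real_of_int (m N))\<^sup>2 / sqrt (24 * real N) + pi * (real (l N) / sqrt N) / sqrt 24"
    proof -
      have s24: "sqrt (24 * real N) = 2 * sqrt (6 * real N)" "sqrt 24 = 2 * sqrt 6"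
        using real_sqrt_mult[of 4 "6 * real N"] real_sqrt_mult[of 4 6] by simp_all
      have m2: "(real_of_int (m N))\<^sup>2 = (real (l N))\<^sup>2" by (simp add: rl)
      show ?thesis unfolding rx s24 m2 using elim by (simp add: real_sqrt_mult field_simps power2_eq_square)
    qed
    then have "y N - pi * (real (l N) / sqrt N) / sqrt 24
       = ln (partition_count (N' N)) - ln (partition_count N) - (- pi * (real_of_int (m N))\<^sup>2 / sqrt (24 * real N))"
      by (simp add: y_def)
    also have "exp \<dots> = partition_count (N' N) / partition_count N / exp (- pi * (real_of_int (m N))\<^sup>2 / sqrt (24 * real N))"
      using partition_count_pos by (simp only: exp_diff) simp
    finally show ?case using F0 partition_count_pos[of "N' N"] by (simp add: rank_ratio_def)
  qed
  ultimately show ?thesis by (rule tendsto_eq_eventually) simp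
qed


text \<open>The cut at |m| = N ^ (3/10) lies between the width N ^ (1/4) of the Gaussian, so the
  dropped part is negligible, and N ^ (3/8), so that \<open>rank_ratio_tendsto\<close> covers the
  kept part.\<close>

lemma Vd_asymp: "(\<lambda>N. real (Vd N) / (partition_count N * (24 * real N) powr (1 / 4))) \<longlonglongrightarrow> 2 / 3"
proof -
  define M where "M N = nat \<lfloor>real N powr (3 / 10)\<rfloor>" for N
  define S where "S N = {- int (M N)..int (M N)}" for N
  define q where "q N = (24 * real N) powr (1 / 4)" for N
  define e where "e N m = exp (- pi * (real_of_int m)\<^sup>2 / sqrt (24 * real N))" for N and m :: int
  define G where "G N = (\<Sum>m\<in>S N. e N m)" for N
  have Mle: "real (M N) \<le> real N powr (3 / 10)" "real N powr (3 / 10) \<le> real (M N) + 1" for N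
  proof -
    have fl: "real (M N) = of_int \<lfloor>real N powr (3 / 10)\<rfloor>" by (simp add: M_def)
    show "real (M N) \<le> real N powr (3 / 10)" "real N powr (3 / 10) \<le> real (M N) + 1"
      unfolding fl by linarith+
  qed
  have MN: "M N \<le> N" for N
  proof (cases "N = 0")
    case False
    then have "real N powr (3 / 10) \<le> real N powr 1" by (intro powr_mono) auto
    then have "real (M N) \<le> real N" using Mle(1)[of N] False by simp
    then show ?thesis by simp
  qed (simp add: M_def)
  \<comment> \<open>\<open>rank_ratio_tendsto\<close> speaks of one rank for each \<open>N\<close>.
    Applied to a worst rank in \<open>S N\<close> it becomes uniform over
    \<open>S N\<close>.\<close>
  have "\<exists>m\<in>S N. \<forall>m'\<in>S N. \<bar>rank_ratio N m' - 2 / 3\<bar> \<le> \<bar>rank_ratio N m - 2 / 3\<bar>" for N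
  proof -
    define A where "A = (\<lambda>m. \<bar>rank_ratio N m - 2 / 3\<bar>) ` S N"
    have A: "finite A" "A \<noteq> {}" by (auto simp: A_def S_def)
    have "Max A \<in> A" using A by (rule Max_in)
    moreover have "\<forall>a\<in>A. \<exists>m\<in>S N. a = \<bar>rank_ratio N m - 2 / 3\<bar>" by (auto simp: A_def)
    ultimately obtain m where "m \<in> S N" "Max A = \<bar>rank_ratio N m - 2 / 3\<bar>" by blast
    moreover have "\<bar>rank_ratio N m' - 2 / 3\<bar> \<le> Max A" if "m' \<in> S N" for m'
      using A that by (intro Max_ge) (auto simp: A_def)
    ultimately show ?thesis by metis
  qed
  then obtain m where m: "\<And>N. m N \<in> S N"
    and mmax: "\<And>N m'. m' \<in> S N \<Longrightarrow> \<bar>rank_ratio N m' - 2 / 3\<bar> \<le> \<bar>rank_ratio N (m N) - 2 / 3\<bar>"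
    by metis
  define \<delta> where "\<delta> N = \<bar>rank_ratio N (m N) - 2 / 3\<bar>" for N
  have "(\<lambda>N. real_of_int (m N)) \<in> O(\<lambda>N. real N powr (3 / 10))"
  proof (rule bigoI[of _ 1], rule always_eventually, rule allI)
    fix N
    have "\<bar>real_of_int (m N)\<bar> \<le> real (M N)" using m[of N] by (auto simp: S_def)
    then show "norm (real_of_int (m N)) \<le> 1 * norm (real N powr (3 / 10))" using Mle(1)[of N] by simp
  qed
  also have "(\<lambda>N. real N powr (3 / 10)) \<in> o(\<lambda>N. real N powr (3 / 8))" by real_asymp
  finally have "(\<lambda>N. rank_ratio N (m N)) \<longlonglongrightarrow> 2 / 3" by (rule rank_ratio_tendsto)
  then have delta: "\<delta> \<longlonglongrightarrow> 0" unfolding \<delta>_def by (intro tendsto_rabs_zero) (simp add: LIM_zero)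
  have q: "filterlim q at_top sequentially" unfolding q_def by real_asymp
  have Glim: "(\<lambda>N. G N / q N) \<longlonglongrightarrow> 1"
  proof -
    have "\<forall>\<^sub>F N in sequentially. norm (G N / q N - 1) \<le> 1 / q N + 2 * exp (- (real N powr (1 / 10) / 20))"
    proof -
      have ev: "\<forall>\<^sub>F N :: nat in sequentially. real N powr (3 / 10) / 2 + 1 \<le> real N powr (3 / 10)" by real_asymp
      show ?thesis using ev eventually_gt_at_top[of 0]
      proof eventually_elim
        case (elim N)
        define t where "t = sqrt (24 * real N)"
        have t: "0 < t" using elim by (simp add: t_def)
        have tq: "sqrt t = q N" using elim unfolding t_def q_def by (simp add: powr_powr flip: powr_half_sqrt)
        have q0: "0 < q N" using elim by (simp add: q_def)
        have M2: "real N powr (3 / 10) / 2 \<le> real (M N)" using elim(1) Mle(2)[of N] by linarith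
        have t5: "t \<le> 5 * sqrt N"
        proof -
          have "sqrt 24 \<le> 5" by (rule real_le_lsqrt) auto
          then show ?thesis unfolding t_def real_sqrt_mult by (intro mult_right_mono) auto
        qed
        have "real N powr (1 / 10) / 20 \<le> pi * (real (M N))\<^sup>2 / (2 * t)"
        proof -
          have "real N powr (1 / 10) = (real N powr (3 / 10))\<^sup>2 / sqrt N"
            using elim by (simp add: powr_powr flip: powr_half_sqrt powr_numeral powr_diff)
          then have "real N powr (1 / 10) / 20 = 2 * (real N powr (3 / 10) / 2)\<^sup>2 / (2 * (5 * sqrt N))"
            by (simp add: power_divide)
          also have "\<dots> \<le> pi * (real (M N))\<^sup>2 / (2 * t)"
          proof (rule frac_le)
            have "(real N powr (3 / 10) / 2)\<^sup>2 \<le> (real (M N))\<^sup>2" using M2 by (intro power_mono) auto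
            then show "2 * (real N powr (3 / 10) / 2)\<^sup>2 \<le> pi * (real (M N))\<^sup>2"
              using pi_gt3 by (intro mult_mono) auto
          qed (use t t5 in auto)
          finally show ?thesis .
        qed
        then have ex: "exp (- pi * (real (M N))\<^sup>2 / (2 * t)) \<le> exp (- (real N powr (1 / 10) / 20))" by simp
        have "\<bar>G N - q N\<bar> \<le> 1 + sqrt (2 * t) * exp (- pi * (real (M N))\<^sup>2 / (2 * t))"
          unfolding G_def S_def e_def t_def[symmetric] tq[symmetric] by (rule gaussian_sum_approx[OF t])
        also have "sqrt (2 * t) \<le> 2 * q N"
        proof -
          have "sqrt 2 \<le> 2" by (rule real_le_lsqrt) auto
          then show ?thesis unfolding real_sqrt_mult tq using q0 by (intro mult_right_mono) auto
        qed
        also have "1 + 2 * q N * exp (- pi * (real (M N))\<^sup>2 / (2 * t)) \<le> 1 + 2 * q N * exp (- (real N powr (1 / 10) / 20))"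
          using ex q0 by (intro add_left_mono mult_left_mono) auto
        finally have "\<bar>G N - q N\<bar> \<le> 1 + 2 * q N * exp (- (real N powr (1 / 10) / 20))"
          by (simp add: mult_right_mono)
        then have "\<bar>G N - q N\<bar> / q N \<le> (1 + 2 * q N * exp (- (real N powr (1 / 10) / 20))) / q N"
          using q0 by (intro divide_right_mono) auto
        moreover have "G N / q N - 1 = (G N - q N) / q N" using q0 by (simp add: diff_divide_distrib)
        ultimately show ?case using q0 by (simp add: abs_divide add_divide_distrib)
      qed
    qed
    moreover have "(\<lambda>N. 1 / q N + 2 * exp (- (real N powr (1 / 10) / 20))) \<longlonglongrightarrow> 0"
      unfolding q_def by real_asymp
    ultimately have "(\<lambda>N. G N / q N - 1) \<longlonglongrightarrow> 0" by (rule Lim_null_comparison)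
    then show ?thesis by (simp add: LIM_zero_iff)
  qed
  obtain C :: real where C: "0 < C" and evC: "\<forall>\<^sub>F N :: nat in sequentially. \<forall>m :: int.
     real (Vd_rank m N) / partition_count N \<le> C * N * exp (- (pi / sqrt (6 * real N) * ((real_of_int m)\<^sup>2 / 2)))"
    using Vd_rank_ratio_le by (elim exE conjE) (rule that)
  define H where "H N = (\<Sum>m\<in>S N. real (Vd_rank m N) / partition_count N)" for N
  define T where "T N = (\<Sum>m\<in>{-int N..int N} - S N. real (Vd_rank m N) / partition_count N)" for N
  have VHT: "real (Vd N) / partition_count N = H N + T N" for N
  proof -
    have "S N \<subseteq> {-int N..int N}" using MN[of N] by (auto simp: S_def)
    then have "(\<Sum>m=-int N..int N. real (Vd_rank m N) / partition_count N) = T N + H N"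
      unfolding T_def H_def by (intro sum.subset_diff) auto
    then show ?thesis by (simp add: Vd_eq_sum sum_divide_distrib)
  qed
  have Tlim: "T \<longlonglongrightarrow> 0"
  proof (rule Lim_null_comparison)
    show "(\<lambda>N::nat. (2 * real N + 1) * (C * N * exp (- (real N powr (1 / 10) / 2)))) \<longlonglongrightarrow> 0" by real_asymp
    show "\<forall>\<^sub>F N in sequentially. norm (T N) \<le> (2 * real N + 1) * (C * N * exp (- (real N powr (1 / 10) / 2)))"
      using evC eventually_gt_at_top[of 0]
    proof eventually_elim
      case (elim N)
      define B where "B = C * N * exp (- (real N powr (1 / 10) / 2))"
      have B0: "0 \<le> B" using C by (simp add: B_def)
      have le: "real (Vd_rank m N) / partition_count N \<le> B" if m: "m \<in> {-int N..int N} - S N" for m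
      proof -
        have "int (M N) + 1 \<le> \<bar>m\<bar>" using m by (auto simp: S_def)
        then have "real (M N) + 1 \<le> \<bar>real_of_int m\<bar>" by linarith
        then have "real N powr (3 / 10) \<le> \<bar>real_of_int m\<bar>" using Mle(2)[of N] by linarith
        then have m2: "(real N powr (3 / 10))\<^sup>2 \<le> (real_of_int m)\<^sup>2" using power_mono[of "real N powr (3 / 10)" "\<bar>real_of_int m\<bar>" 2] by simp
        have a: "1 / sqrt N \<le> pi / sqrt (6 * real N)" using elim sqrt_6_le_pi by (simp add: real_sqrt_mult field_simps)
        have "real N powr (1 / 10) = (real N powr (3 / 10))\<^sup>2 / sqrt N"
          using elim by (simp add: powr_powr flip: powr_half_sqrt powr_numeral powr_diff)
        then have "real N powr (1 / 10) / 2 = 1 / sqrt N * ((real N powr (3 / 10))\<^sup>2 / 2)" by simp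
        also have "\<dots> \<le> pi / sqrt (6 * real N) * ((real_of_int m)\<^sup>2 / 2)"
          using a m2 by (intro mult_mono) auto
        finally have "exp (- (pi / sqrt (6 * real N) * ((real_of_int m)\<^sup>2 / 2))) \<le> exp (- (real N powr (1 / 10) / 2))" by simp
        then have "C * N * exp (- (pi / sqrt (6 * real N) * ((real_of_int m)\<^sup>2 / 2))) \<le> B"
          unfolding B_def using C by (intro mult_left_mono) auto
        moreover have "real (Vd_rank m N) / partition_count N \<le> C * N * exp (- (pi / sqrt (6 * real N) * ((real_of_int m)\<^sup>2 / 2)))"
          using elim(1) by blast
        ultimately show ?thesis by linarith
      qed
      have "T N \<le> (\<Sum>m\<in>{-int N..int N} - S N. B)" unfolding T_def by (intro sum_mono le)
      also have "\<dots> \<le> (\<Sum>m\<in>{-int N..int N}. B)" using B0 by (intro sum_mono2) auto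
      also have "\<dots> = (2 * real N + 1) * B" by (simp add: nat_add_distrib)
      finally have "T N \<le> (2 * real N + 1) * B" .
      moreover have "0 \<le> T N" unfolding T_def by (intro sum_nonneg) auto
      ultimately show ?case by (simp add: B_def)
    qed
  qed
  have HG: "(\<lambda>N. H N / q N - 2 / 3 * (G N / q N)) \<longlonglongrightarrow> 0"
  proof (rule Lim_null_comparison)
    show "(\<lambda>N. \<delta> N * (G N / q N)) \<longlonglongrightarrow> 0"
      using tendsto_mult[OF delta Glim] by simp
    show "\<forall>\<^sub>F N in sequentially. norm (H N / q N - 2 / 3 * (G N / q N)) \<le> \<delta> N * (G N / q N)"
      using eventually_gt_at_top[of 0]
    proof eventually_elim
      case (elim N)
      have q0: "0 < q N" using elim by (simp add: q_def)
      have "real (Vd_rank m N) / partition_count N = rank_ratio N m * e N m" for m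
        by (simp add: rank_ratio_def e_def)
      then have "H N - 2 / 3 * G N = (\<Sum>m\<in>S N. (rank_ratio N m - 2 / 3) * e N m)"
        by (simp add: H_def G_def left_diff_distrib sum_subtractf sum_distrib_left)
      also have "\<bar>\<dots>\<bar> \<le> (\<Sum>m\<in>S N. \<delta> N * e N m)"
      proof (intro order_trans[OF sum_abs] sum_mono)
        fix m' assume "m' \<in> S N"
        then show "\<bar>(rank_ratio N m' - 2 / 3) * e N m'\<bar> \<le> \<delta> N * e N m'"
          unfolding abs_mult \<delta>_def by (intro mult_mono mmax) (auto simp: e_def)
      qed
      also have "\<dots> = \<delta> N * G N" by (simp add: G_def sum_distrib_left)
      finally have "\<bar>H N - 2 / 3 * G N\<bar> / q N \<le> \<delta> N * G N / q N"
        using q0 by (intro divide_right_mono) auto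
      moreover have "H N / q N - 2 / 3 * (G N / q N) = (H N - 2 / 3 * G N) / q N"
        by (simp add: diff_divide_distrib)
      ultimately show ?case using q0 by (simp only: real_norm_def abs_divide) simp
    qed
  qed
  have Tq: "(\<lambda>N. T N * (1 / q N)) \<longlonglongrightarrow> 0 * 0"
    by (intro tendsto_mult Tlim) (unfold q_def, real_asymp)
  have "(\<lambda>N. (H N / q N - 2 / 3 * (G N / q N)) + 2 / 3 * (G N / q N) + T N * (1 / q N)) \<longlonglongrightarrow> 0 + 2 / 3 * 1 + 0 * 0"
    by (intro tendsto_add HG tendsto_mult[OF tendsto_const Glim] Tq)
  moreover have "(H N / q N - 2 / 3 * (G N / q N)) + 2 / 3 * (G N / q N) + T N * (1 / q N)
     = real (Vd N) / (partition_count N * q N)" for N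
  proof -
    have "real (Vd N) / (partition_count N * q N) = (real (Vd N) / partition_count N) / q N" by simp
    also have "\<dots> = (H N + T N) / q N" by (simp only: VHT)
    finally show ?thesis by (simp add: add_divide_distrib)
  qed
  ultimately show ?thesis by (simp add: q_def)
qed

text \<open>Both counts are normalised by p N, and both limits are 2/3, so neither p nor
  \<open>F\<close> survives in the quotient.\<close>

lemma Vd_rank_div_Vd_asymp_equiv:
  fixes m :: "nat \<Rightarrow> int"
  assumes "(\<lambda>N. real_of_int (m N)) \<in> o(\<lambda>N. real N powr (3 / 8))"
  shows "(\<lambda>N. real (Vd_rank (m N) N) / real (Vd N)) \<sim>[at_top]
    (\<lambda>N. 1 / (24 * real N) powr (1 / 4) * exp (- pi * (real_of_int (m N))\<^sup>2 / sqrt (24 * real N)))"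
proof (rule asymp_equivI')
  have "(\<lambda>N. rank_ratio N (m N) / (real (Vd N) / (partition_count N * (24 * real N) powr (1 / 4)))) \<longlonglongrightarrow> (2 / 3) / (2 / 3)"
    by (intro tendsto_divide rank_ratio_tendsto assms Vd_asymp) simp
  moreover have "\<forall>\<^sub>F N in sequentially. rank_ratio N (m N) / (real (Vd N) / (partition_count N * (24 * real N) powr (1 / 4)))
     = real (Vd_rank (m N) N) / real (Vd N) /
       (1 / (24 * real N) powr (1 / 4) * exp (- pi * (real_of_int (m N))\<^sup>2 / sqrt (24 * real N)))"
    using eventually_gt_at_top[of 0]
  proof eventually_elim
    case (elim N)
    define E where "E = exp (- pi * (real_of_int (m N))\<^sup>2 / sqrt (24 * real N))"
    define q where "q = (24 * real N) powr (1 / 4)"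
    have "0 < E" "0 < q" "0 < real (partition_count N)" using elim partition_count_pos by (auto simp: E_def q_def)
    then show ?case unfolding rank_ratio_def E_def[symmetric] q_def[symmetric] by (simp add: field_simps)
  qed
  ultimately show "(\<lambda>N. real (Vd_rank (m N) N) / real (Vd N) /
       (1 / (24 * real N) powr (1 / 4) * exp (- pi * (real_of_int (m N))\<^sup>2 / sqrt (24 * real N)))) \<longlonglongrightarrow> 1"
    by (rule tendsto_eq_eventually) simp
qed

theorem theorem1:
  shows "(\<exists>C N0. \<forall>N::nat. N \<ge> N0 \<longrightarrow> (\<forall>l::int.
            \<bar>real (Vd_rank l (N + nat \<bar>l\<bar> * (nat \<bar>l\<bar> + 1) div 2))
              / (real (partition_count N) * F_conc (pi * \<bar>real_of_int l\<bar> / sqrt (6 * real N))) - 1\<bar>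
            \<le> C * real N powr (-1/10)))
       \<and> (\<forall>m :: nat \<Rightarrow> int.
            (\<lambda>N. real_of_int (m N)) \<in> o(\<lambda>N. real N powr (3/8)) \<longrightarrow>
            (\<lambda>N. real (Vd_rank (m N) N) / real (Vd N)) \<sim>[at_top]
            (\<lambda>N. 1 / (24 * real N) powr (1/4) * exp (- pi * (real_of_int (m N))\<^sup>2 / sqrt (24 * real N))))"
proof (intro conjI allI impI)
  obtain C :: real where "\<forall>\<^sub>F N :: nat in sequentially. \<forall>l :: int.
     \<bar>real (Vd_rank l (N + nat \<bar>l\<bar> * (nat \<bar>l\<bar> + 1) div 2))
        / (real (partition_count N) * F_conc (pi * \<bar>real_of_int l\<bar> / sqrt (6 * real N))) - 1\<bar>
       \<le> C * real N powr (-1/10)"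
    using Vd_rank_rel_error by (elim exE conjE) (rule that)
  then obtain N0 where "\<forall>N\<ge>N0. \<forall>l :: int.
     \<bar>real (Vd_rank l (N + nat \<bar>l\<bar> * (nat \<bar>l\<bar> + 1) div 2))
        / (real (partition_count N) * F_conc (pi * \<bar>real_of_int l\<bar> / sqrt (6 * real N))) - 1\<bar>
       \<le> C * real N powr (-1/10)"
    unfolding eventually_sequentially by (elim exE) (rule that)
  then show "\<exists>C N0. \<forall>N::nat. N \<ge> N0 \<longrightarrow> (\<forall>l::int.
            \<bar>real (Vd_rank l (N + nat \<bar>l\<bar> * (nat \<bar>l\<bar> + 1) div 2))
              / (real (partition_count N) * F_conc (pi * \<bar>real_of_int l\<bar> / sqrt (6 * real N))) - 1\<bar>
            \<le> C * real N powr (-1/10))"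
    by (intro exI[of _ C] exI[of _ N0])
qed (rule Vd_rank_div_Vd_asymp_equiv)

end
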